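(* Let $k$ be an algebraically closed field of characteristic zero, $G$ a group, $a\in Z(G)$, $\chi\in\hat G$ with $\chi(a)\neq 1$, and $H=kG(\chi^{-1},a,0)$. Assume that $|\chi|=s<\infty$ and that $q=\chi^{-1}(a)$ is a primitive $s$-th root of unity. Let $p,t\geq 1$ be integers, $\lambda,\sigma\in\hat G$ and $\beta\in k^\times$. Write $p=us+r$ with integers $u\geq 0$ and $0\leq r<s$. Then there are isomorphisms of $H$-modules $$V_p(\lambda)\otimes V_t(\sigma,\beta)\cong\Big(\bigoplus_{1\leq i\leq\min\{t,u\}}(s-r)V_{2i-1+|t-u|}(\sigma\lambda,\beta)\Big)\oplus\Big(\bigoplus_{i=1}^{\min\{t,u+1\}}rV_{2i-1+|t-u-1|}(\sigma\lambda,\beta)\Big),$$ $$V_t(\sigma,\beta)\otimes V_p(\lambda)\cong\Big(\bigoplus_{1\leq i\leq\min\{t,u\}}(s-r)V_{2i-1+|t-u|}(\sigma\lambda,\lambda(a)^s\beta)\Big)\oplus\Big(\bigoplus_{i=1}^{\min\{t,u+1\}}rV_{2i-1+|t-u-1|}(\sigma\lambda,\lambda(a)^s\beta)\Big).$$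
   Context: $Z(G)$ is the center of $G$; $\hat G$ is the group (under pointwise product) of characters, i.e. group homomorphisms $G\to k^\times=k\setminus\{0\}$; $|\chi|$ is the order of $\chi$ in $\hat G$. The Hopf algebra $H=kG(\chi^{-1},a,0)$ is generated as a $k$-algebra by the group algebra $kG$ and an element $x$ subject to $xg=\chi^{-1}(g)gx$ for $g\in G$; it has $k$-basis $\{gx^i\mid g\in G,\ i\geq 0\}$. Its coalgebra structure and antipode are given by $\Delta(x)=x\otimes a+1\otimes x$, $\varepsilon(x)=0$, $S(x)=-xa^{-1}$, $\Delta(g)=g\otimes g$, $\varepsilon(g)=1$, $S(g)=g^{-1}$ for $g\in G$. Modules are left modules, $\otimes=\otimes_k$, and $H$ acts on a tensor product of modules via $\Delta$. For $\lambda\in\hat G$ and an integer $t\geq 1$, $V_t(\lambda)$ is the $t$-dimensional $H$-module with $k$-basis $m_0,\dots,m_{t-1}$ and action $g\cdot m_i=\chi^i(g)\lambda(g)m_i$ for $g\in G$, $0\le i\le t-1$; $x\cdot m_i=m_{i+1}$ for $0\leq i\leq t-2$; $x\cdot m_{t-1}=0$. With $|\chi|=s<\infty$, for $\lambda\in\hat G$, $\beta\in k$ and an integer $n\geq 1$, write $(y-\beta)^n=y^n-\sum_{j=0}^{n-1}\alpha_jy^j$ in $k[y]$; then $V_n(\lambda,\beta)$ is the $ns$-dimensional $H$-module with $k$-basis $m_0,\dots,m_{ns-1}$ and action $g\cdot m_i=\chi^i(g)\lambda(g)m_i$ for $g\in G$, $0\leq i\leq ns-1$; $x\cdot m_i=m_{i+1}$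 for $0\leq i\leq ns-2$; $x\cdot m_{ns-1}=\sum_{j=0}^{n-1}\alpha_jm_{js}$. Conventions: for a module $M$ and an integer $r\geq 0$, $rM$ is the direct sum of $r$ copies of $M$ (so $0M=0$); a direct sum over an empty index range is $0$. *)

theory Defs
  imports
    "HOL-Algebra.Multiplicative_Group"
    "HOL-Library.Poly_Mapping"
    "HOL-Computational_Algebra.Polynomial"
begin

section \<open>Characters\<close>

definition mult_group_of_field :: "('k::field) monoid"
  where "mult_group_of_field =
    \<lparr>carrier = UNIV - {0}, monoid.mult = (*), one = 1\<rparr>"

text \<open>
  Characters are made extensional (value \<open>undefined\<close> outside \<open>carrier G\<close>), so that equality in
  the character group is equality of homomorphisms.
\<close>

definition character_group :: "('g, 'z) monoid_scheme \<Rightarrow> ('g \<Rightarrow> 'k::field) monoid"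
  where "character_group G =
    \<lparr>carrier = hom G mult_group_of_field \<inter> extensional (carrier G),
     monoid.mult = (\<lambda>\<chi> \<psi>. \<lambda>g\<in>carrier G. \<chi> g * \<psi> g),
     one = (\<lambda>g\<in>carrier G. 1)\<rparr>"

definition primitive_root_of_unity :: "nat \<Rightarrow> 'k::field \<Rightarrow> bool"
  where "primitive_root_of_unity s q \<longleftrightarrow>
    0 < s \<and> q ^ s = 1 \<and> (\<forall>j. 0 < j \<and> j < s \<longrightarrow> q ^ j \<noteq> 1)"


section \<open>Vector spaces with a basis\<close>

abbreviation "single \<equiv> Poly_Mapping.single"
abbreviation "lookup \<equiv> Poly_Mapping.lookup"
abbreviation "keys \<equiv> Poly_Mapping.keys"

text \<open>
  A vector space over \<open>'k\<close> with basis \<open>B :: 'b set\<close> is the set of all \<open>v :: 'b \<Rightarrow>\<^sub>0 'k\<close>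
  with \<open>keys v \<subseteq> B\<close>; the basis vector \<open>b\<close> is \<open>single b 1\<close>.  The tensor product over \<open>'k\<close> of
  the spaces with bases \<open>B\<close> and \<open>C\<close> is the space with basis \<open>B \<times> C\<close>.
\<close>

definition scale :: "'k::field \<Rightarrow> ('b \<Rightarrow>\<^sub>0 'k) \<Rightarrow> ('b \<Rightarrow>\<^sub>0 'k)"
  where "scale c = Poly_Mapping.map ((*) c)"

definition lin_ext :: "('b \<Rightarrow> ('c \<Rightarrow>\<^sub>0 'k)) \<Rightarrow> ('b \<Rightarrow>\<^sub>0 'k) \<Rightarrow> ('c \<Rightarrow>\<^sub>0 'k::field)"
  where "lin_ext f v = (\<Sum>b\<in>keys v. scale (lookup v b) (f b))"

definition bilin_ext ::
    "('b \<Rightarrow> 'c \<Rightarrow> ('d \<Rightarrow>\<^sub>0 'k)) \<Rightarrow> ('b \<Rightarrow>\<^sub>0 'k) \<Rightarrow> ('c \<Rightarrow>\<^sub>0 'k) \<Rightarrow> ('d \<Rightarrow>\<^sub>0 'k::field)"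
  where "bilin_ext f v w = lin_ext (\<lambda>b. lin_ext (f b) w) v"

definition tens :: "('b \<Rightarrow>\<^sub>0 'k) \<Rightarrow> ('c \<Rightarrow>\<^sub>0 'k) \<Rightarrow> ('b \<times> 'c \<Rightarrow>\<^sub>0 'k::field)"
  where "tens = bilin_ext (\<lambda>b c. single (b, c) 1)"


section \<open>The Hopf algebra\<close>

text \<open>
  \<open>hopf_ore G \<psi>\<close> is the algebra \<open>kG(\<psi>, a, 0)\<close>, generated by \<open>kG\<close> and \<open>x\<close> subject to
  \<open>x g = \<psi>(g) g x\<close>.  The pair \<open>(g, i)\<close> stands for the basis element \<open>g x\<^sup>i\<close>, whence
  \<open>(g x\<^sup>i) (h x\<^sup>j) = \<psi>(h)\<^sup>i (g h) x\<^sup>i\<^sup>+\<^sup>j\<close>.  The algebra does not depend on \<open>a\<close>; the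
  comultiplication does.  The counit and the antipode play no role for tensor products and direct
  sums of modules and are not defined.
\<close>

definition hopf_ore ::
    "('g, 'z) monoid_scheme \<Rightarrow> ('g \<Rightarrow> 'k::field) \<Rightarrow> ('g \<times> nat \<Rightarrow>\<^sub>0 'k) ring"
  where "hopf_ore G \<psi> =
    \<lparr>carrier = {h. keys h \<subseteq> carrier G \<times> UNIV},
     monoid.mult = bilin_ext (\<lambda>(g, i) (h, j). single (g \<otimes>\<^bsub>G\<^esub> h, i + j) (\<psi> h ^ i)),
     one = single (\<one>\<^bsub>G\<^esub>, 0) 1,
     ring.zero = 0,
     add = (+)\<rparr>"

definition grp :: "'g \<Rightarrow> ('g \<times> nat \<Rightarrow>\<^sub>0 'k::field)"
  where "grp g = single (g, 0) 1"

definition ore_x :: "('g, 'z) monoid_scheme \<Rightarrow> ('g \<times> nat \<Rightarrow>\<^sub>0 'k::field)"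
  where "ore_x G = single (\<one>\<^bsub>G\<^esub>, 1) 1"

text \<open>
  The tensor product \<open>A \<otimes> B\<close> of two algebras of finitely supported functions, with
  \<open>(u \<otimes> v) (u' \<otimes> v') = u u' \<otimes> v v'\<close>.
\<close>

definition tensor_algebra ::
    "('b \<Rightarrow>\<^sub>0 'k) ring \<Rightarrow> ('c \<Rightarrow>\<^sub>0 'k) ring \<Rightarrow> ('b \<times> 'c \<Rightarrow>\<^sub>0 'k::field) ring"
  where "tensor_algebra A B =
    \<lparr>carrier = {z. \<forall>(b, c)\<in>keys z. single b 1 \<in> carrier A \<and> single c 1 \<in> carrier B},
     monoid.mult = bilin_ext (\<lambda>(b, c) (b', c').
       tens (single b 1 \<otimes>\<^bsub>A\<^esub> single b' 1) (single c 1 \<otimes>\<^bsub>B\<^esub> single c' 1)),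
     one = tens \<one>\<^bsub>A\<^esub> \<one>\<^bsub>B\<^esub>,
     ring.zero = 0,
     add = (+)\<rparr>"

text \<open>
  \<open>\<Delta>\<close> is the algebra homomorphism with \<open>\<Delta>(g) = g \<otimes> g\<close> and \<open>\<Delta>(x) = x \<otimes> a + 1 \<otimes> x\<close>;
  on the basis, \<open>\<Delta>(g x\<^sup>i) = \<Delta>(g) \<Delta>(x)\<^sup>i\<close>.
\<close>

definition comult ::
    "('g, 'z) monoid_scheme \<Rightarrow> ('g \<Rightarrow> 'k::field) \<Rightarrow> 'g \<Rightarrow>
     ('g \<times> nat \<Rightarrow>\<^sub>0 'k) \<Rightarrow> (('g \<times> nat) \<times> ('g \<times> nat) \<Rightarrow>\<^sub>0 'k)"
  where "comult G \<psi> a = (let HH = tensor_algebra (hopf_ore G \<psi>) (hopf_ore G \<psi>) in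
    lin_ext (\<lambda>(g, i). tens (grp g) (grp g) \<otimes>\<^bsub>HH\<^esub>
      (tens (ore_x G) (grp a) + tens (grp \<one>\<^bsub>G\<^esub>) (ore_x G)) [^]\<^bsub>HH\<^esub> i))"


section \<open>Left modules\<close>

record (overloaded) ('h, 'b, 'k::zero) based_module =
  basis :: "'b set"
  act :: "'h \<Rightarrow> ('b \<Rightarrow>\<^sub>0 'k) \<Rightarrow> ('b \<Rightarrow>\<^sub>0 'k)"

definition space :: "('h, 'b, 'k::field) based_module \<Rightarrow> ('b \<Rightarrow>\<^sub>0 'k) set"
  where "space M = {v. keys v \<subseteq> basis M}"

text \<open>
  Left modules over a \<open>'k\<close>-algebra \<open>A\<close>.  The last condition says that the scalars
  \<open>c \<cdot> 1\<close> of \<open>A\<close> act by the given scalar multiplication of the vector space.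
\<close>

definition left_module ::
    "('c \<Rightarrow>\<^sub>0 'k) ring \<Rightarrow> ('c \<Rightarrow>\<^sub>0 'k, 'b, 'k::field) based_module \<Rightarrow> bool"
  where "left_module A M \<longleftrightarrow>
    (\<forall>h\<in>carrier A. \<forall>v\<in>space M. act M h v \<in> space M) \<and>
    (\<forall>h\<in>carrier A. \<forall>v\<in>space M. \<forall>w\<in>space M. act M h (v + w) = act M h v + act M h w) \<and>
    (\<forall>h\<in>carrier A. \<forall>h'\<in>carrier A. \<forall>v\<in>space M.
       act M (h \<oplus>\<^bsub>A\<^esub> h') v = act M h v + act M h' v) \<and>
    (\<forall>h\<in>carrier A. \<forall>h'\<in>carrier A. \<forall>v\<in>space M.
       act M (h \<otimes>\<^bsub>A\<^esub> h') v = act M h (act M h' v)) \<and>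
    (\<forall>v\<in>space M. act M \<one>\<^bsub>A\<^esub> v = v) \<and>
    (\<forall>c. \<forall>v\<in>space M. act M (scale c \<one>\<^bsub>A\<^esub>) v = scale c v)"

text \<open>
  The \<open>'k\<close>-linearity of \<open>\<phi>\<close> follows from the other conditions, since \<open>A\<close> contains the scalars.
\<close>

definition module_iso ::
    "('c \<Rightarrow>\<^sub>0 'k) ring \<Rightarrow> ('c \<Rightarrow>\<^sub>0 'k, 'b, 'k) based_module \<Rightarrow>
     ('c \<Rightarrow>\<^sub>0 'k, 'd, 'k::field) based_module \<Rightarrow> bool"
  where "module_iso A M N \<longleftrightarrow> left_module A M \<and> left_module A N \<and>
    (\<exists>\<phi>. bij_betw \<phi> (space M) (space N) \<and>
      (\<forall>v\<in>space M. \<forall>w\<in>space M. \<phi> (v + w) = \<phi> v + \<phi> w) \<and>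
      (\<forall>h\<in>carrier A. \<forall>v\<in>space M. \<phi> (act M h v) = act N h (\<phi> v)))"

text \<open>
  The tensor product of two modules over \<open>H\<close>, where \<open>h\<close> acts through
  \<open>\<Delta>(h) = \<Sum> u \<otimes> v\<close> by \<open>h (m \<otimes> n) = \<Sum> u m \<otimes> v n\<close>.
\<close>

definition tensor_module ::
    "(('c \<Rightarrow>\<^sub>0 'k) \<Rightarrow> ('c \<times> 'c \<Rightarrow>\<^sub>0 'k)) \<Rightarrow> ('c \<Rightarrow>\<^sub>0 'k, 'b, 'k) based_module \<Rightarrow>
     ('c \<Rightarrow>\<^sub>0 'k, 'd, 'k) based_module \<Rightarrow> ('c \<Rightarrow>\<^sub>0 'k, 'b \<times> 'd, 'k::field) based_module"
  where "tensor_module \<Delta> M N =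
    \<lparr>basis = basis M \<times> basis N,
     act = (\<lambda>h. bilin_ext (\<lambda>(u, v) (b, d).
       tens (act M (single u 1) (single b 1)) (act N (single v 1) (single d 1))) (\<Delta> h))\<rparr>"

definition direct_sum ::
    "'i set \<Rightarrow> ('i \<Rightarrow> ('h, 'b, 'k) based_module) \<Rightarrow> ('h, 'i \<times> 'b, 'k::field) based_module"
  where "direct_sum I M =
    \<lparr>basis = (SIGMA i:I. basis (M i)),
     act = (\<lambda>h. lin_ext (\<lambda>(i, b).
       lin_ext (\<lambda>c. single (i, c) 1) (act (M i) h (single b 1))))\<rparr>"

definition copies ::
    "nat \<Rightarrow> ('h, 'b, 'k) based_module \<Rightarrow> ('h, nat \<times> 'b, 'k::field) based_module"
  where "copies r M = direct_sum {..<r} (\<lambda>_. M)"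

definition binary_sum ::
    "('h, 'b, 'k) based_module \<Rightarrow> ('h, 'd, 'k) based_module \<Rightarrow>
     ('h, 'b + 'd, 'k::field) based_module"
  where "binary_sum M N =
    \<lparr>basis = basis M <+> basis N,
     act = (\<lambda>h. lin_ext (case_sum
       (\<lambda>b. lin_ext (\<lambda>c. single (Inl c) 1) (act M h (single b 1)))
       (\<lambda>d. lin_ext (\<lambda>c. single (Inr c) 1) (act N h (single d 1)))))\<rparr>"

text \<open>
  The operators \<open>\<rho> g\<close> and \<open>X\<close> give the actions of \<open>g\<close> and \<open>x\<close>, so \<open>g x\<^sup>i\<close> acts by \<open>\<rho> g \<circ> X\<^sup>i\<close>.
\<close>

definition action_from_generators ::
    "('g \<Rightarrow> ('b \<Rightarrow>\<^sub>0 'k) \<Rightarrow> ('b \<Rightarrow>\<^sub>0 'k)) \<Rightarrow> (('b \<Rightarrow>\<^sub>0 'k) \<Rightarrow> ('b \<Rightarrow>\<^sub>0 'k)) \<Rightarrow>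
     ('g \<times> nat \<Rightarrow>\<^sub>0 'k) \<Rightarrow> ('b \<Rightarrow>\<^sub>0 'k) \<Rightarrow> ('b \<Rightarrow>\<^sub>0 'k::field)"
  where "action_from_generators \<rho> X h v = lin_ext (\<lambda>(g, i). \<rho> g ((X ^^ i) v)) h"

text \<open>
  \<open>V_nilp \<chi> t \<mu>\<close> is \<open>V\<^sub>t(\<mu>)\<close>, and \<open>V_block \<chi> s n \<mu> \<beta>\<close> is \<open>V\<^sub>n(\<mu>, \<beta>)\<close> where \<open>s\<close> is the order of
  \<open>\<chi>\<close>; the scalar \<open>\<alpha>\<^sub>j\<close> in the latter is the coefficient of \<open>y\<^sup>j\<close> in \<open>y\<^sup>n - (y - \<beta>)\<^sup>n\<close>.
\<close>

definition V_nilp ::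
    "('g \<Rightarrow> 'k) \<Rightarrow> nat \<Rightarrow> ('g \<Rightarrow> 'k) \<Rightarrow> ('g \<times> nat \<Rightarrow>\<^sub>0 'k, nat, 'k::field) based_module"
  where "V_nilp \<chi> t \<mu> =
    \<lparr>basis = {..<t},
     act = action_from_generators
       (\<lambda>g. lin_ext (\<lambda>i. single i (\<chi> g ^ i * \<mu> g)))
       (lin_ext (\<lambda>i. if i + 1 < t then single (i + 1) 1 else 0))\<rparr>"

definition V_block ::
    "('g \<Rightarrow> 'k) \<Rightarrow> nat \<Rightarrow> nat \<Rightarrow> ('g \<Rightarrow> 'k) \<Rightarrow> 'k \<Rightarrow>
     ('g \<times> nat \<Rightarrow>\<^sub>0 'k, nat, 'k::field) based_module"
  where "V_block \<chi> s n \<mu> \<beta> =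
    (let \<alpha> = Polynomial.coeff (Polynomial.monom 1 n - [:- \<beta>, 1:] ^ n) in
    \<lparr>basis = {..<n * s},
     act = action_from_generators
       (\<lambda>g. lin_ext (\<lambda>i. single i (\<chi> g ^ i * \<mu> g)))
       (lin_ext (\<lambda>i. if i + 1 < n * s then single (i + 1) 1
         else \<Sum>j<n. single (j * s) (\<alpha> j)))\<rparr>)"

end

(* Put y = x^s. The two summands x (x) a and 1 (x) x of Delta(x) commute up to a primitive s-th root
   of unity, so y acts on a tensor product as the sum of their s-th powers: on V_p(lambda) (x)
   V_t(sigma,beta) it is a scalar multiple of y (x) 1, which is nilpotent, plus 1 (x) y, which has
   the single eigenvalue beta. As beta is nonzero, x is bijective and the module is determined by
   the Jordan type of y on one weight space of G. On V_p(lambda), y has r Jordan blocks of size u+1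
   and s-r of size u, hence that weight space is the sum of the corresponding tensor products of
   Jordan blocks, which split by the Clebsch-Gordan rule in characteristic zero. Explicit highest
   weight vectors give a homomorphism from the right-hand side onto the tensor product, and the
   dimensions agree. The other order of the factors differs only in the scalars. *)
theory Submission
  imports Defs
begin

section \<open>Finitely supported functions as a vector space\<close>

text \<open>Neither a Jordan normal form nor uniqueness of decompositions is invoked. The module
  \<open>V_n(\<mu>, \<gamma>)\<close> is presented by one generator of weight \<open>\<mu>\<close>
  with the relation \<open>(x^s - \<gamma>)^n = 0\<close>, so a homomorphism out of the direct sum
  amounts to a list of vectors of that weight, each killed by the power that its block size
  prescribes. The obstacle is to write such vectors down and to see both that they are killed and
  that they generate. For the first, the raising operator of sl2 survives only as a recurrence
  between integers, the coefficients of \<open>(A + B)^n v\<close> before the truncation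
  \<open>A^u = B^t = 0\<close>; no sl2-module is constructed. For the second, a computation modulo
  the image of the lowering operator suffices, and characteristic zero enters as the invertibility
  of a positive integer. Bijectivity of x appears only as the rule that a vector v lies in an
  x-stable subspace as soon as \<open>x^s v\<close> does. Both orders of the factors become
  instances of one abstract family \<open>e i j\<close>, after rescaling the tensors of basis
  vectors by values of characters at \<open>a\<close>.\<close>

lemma lookup_scale [simp]: "lookup (scale c v) b = c * lookup v b"
  by (simp add: scale_def map.rep_eq when_def)

global_interpretation pm: vector_space "scale :: 'k::field \<Rightarrow> ('b \<Rightarrow>\<^sub>0 'k) \<Rightarrow> ('b \<Rightarrow>\<^sub>0 'k)"
  by unfold_locales (auto intro!: poly_mapping_eqI simp: lookup_add algebra_simps)

abbreviation pm_linear :: "(('b \<Rightarrow>\<^sub>0 'k::field) \<Rightarrow> ('c \<Rightarrow>\<^sub>0 'k)) \<Rightarrow> bool"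
  where "pm_linear \<equiv> Vector_Spaces.linear scale scale"

lemma pm_linear_iff:
  "pm_linear f \<longleftrightarrow> (\<forall>v w. f (v + w) = f v + f w) \<and> (\<forall>c v. f (scale c v) = scale c (f v))"
  by (simp add: Vector_Spaces.linear_iff pm.vector_space_axioms)

lemma pm_linearI:
  "(\<And>v w. f (v + w) = f v + f w) \<Longrightarrow> (\<And>c v. f (scale c v) = scale c (f v)) \<Longrightarrow> pm_linear f"
  by (simp add: pm_linear_iff)

lemma pm_linear_add: "pm_linear f \<Longrightarrow> f (v + w) = f v + f w"
  by (simp add: pm_linear_iff)

lemma pm_linear_scale: "pm_linear f \<Longrightarrow> f (scale c v) = scale c (f v)"
  by (simp add: pm_linear_iff)

lemma pm_linear_zero: "pm_linear f \<Longrightarrow> f 0 = 0"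
  using pm_linear_scale[of f 0 0] by simp

lemma pm_linear_sum: "pm_linear f \<Longrightarrow> f (sum g A) = (\<Sum>a\<in>A. f (g a))"
  by (induction A rule: infinite_finite_induct) (auto simp: pm_linear_zero pm_linear_add)

lemma pm_linear_diff: "pm_linear f \<Longrightarrow> f (v - w) = f v - f w"
  using pm_linear_add[of f "v - w" w] by (simp add: algebra_simps)

lemma pm_linear_funpow:
  fixes f :: "('b \<Rightarrow>\<^sub>0 'k::field) \<Rightarrow> ('b \<Rightarrow>\<^sub>0 'k)"
  shows "pm_linear f \<Longrightarrow> pm_linear (f ^^ n)"
  by (induction n) (auto simp: pm_linear_iff)

lemma pm_linear_comp: "pm_linear f \<Longrightarrow> pm_linear g \<Longrightarrow> pm_linear (\<lambda>v. f (g v))"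
  by (simp add: pm_linear_iff)

lemma scale_single [simp]: "scale c (single b d) = single b (c * d)"
  by (rule poly_mapping_eqI) (simp add: lookup_single when_def)

lemma pm_expand:
  fixes v :: "'b \<Rightarrow>\<^sub>0 'k::field"
  assumes "finite B" "keys v \<subseteq> B"
  shows "v = (\<Sum>b\<in>B. scale (lookup v b) (single b 1))"
proof (rule poly_mapping_eqI)
  fix k
  show "lookup v k = lookup (\<Sum>b\<in>B. scale (lookup v b) (single b 1)) k"
    using assms by (auto simp: lookup_sum lookup_single when_def in_keys_iff subset_iff)
qed

lemma lin_ext_superset:
  fixes v :: "'b \<Rightarrow>\<^sub>0 'k::field"
  assumes "finite B" "keys v \<subseteq> B"
  shows "lin_ext f v = (\<Sum>b\<in>B. scale (lookup v b) (f b))"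
  unfolding lin_ext_def
  by (rule sum.mono_neutral_left) (use assms in \<open>auto simp: in_keys_iff\<close>)

lemma lin_ext_single [simp]: "lin_ext f (single b c) = scale c (f b)"
  by (simp add: lin_ext_superset[of "{b}"])

lemma pm_linear_lin_ext [simp, intro]:
  fixes f :: "'b \<Rightarrow> ('c \<Rightarrow>\<^sub>0 'k::field)"
  shows "pm_linear (lin_ext f)"
proof (rule pm_linearI)
  fix v w :: "'b \<Rightarrow>\<^sub>0 'k"
  let ?B = "keys v \<union> keys w"
  have "lin_ext f (v + w) = (\<Sum>b\<in>?B. scale (lookup (v + w) b) (f b))"
    by (rule lin_ext_superset) (auto simp: keys_add)
  also have "\<dots> = lin_ext f v + lin_ext f w"
    by (simp add: lin_ext_superset[of ?B] lookup_add pm.scale_left_distrib sum.distrib)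
  finally show "lin_ext f (v + w) = lin_ext f v + lin_ext f w" .
next
  fix c and v :: "'b \<Rightarrow>\<^sub>0 'k"
  have "lin_ext f (scale c v) = (\<Sum>b\<in>keys v. scale (lookup (scale c v) b) (f b))"
    by (rule lin_ext_superset) (auto simp: in_keys_iff)
  then show "lin_ext f (scale c v) = scale c (lin_ext f v)"
    by (simp add: lin_ext_def pm.scale_sum_right)
qed

lemma lin_ext_zero [simp]: "lin_ext f 0 = 0"
  by (simp add: lin_ext_def)

lemma pm_linear_lin_ext_param:
  assumes "\<And>b. pm_linear (F b)"
  shows "pm_linear (\<lambda>w. lin_ext (\<lambda>b. F b w) v)"
  using assms unfolding pm_linear_iff lin_ext_def
  by (simp add: pm.scale_right_distrib sum.distrib pm.scale_sum_right mult.commute)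

lemma lin_ext_eq_linear:
  assumes "pm_linear F" "\<And>b. b \<in> keys v \<Longrightarrow> f b = F (single b 1)"
  shows "lin_ext f v = F v"
proof -
  have "F v = F (\<Sum>b\<in>keys v. scale (lookup v b) (single b 1))"
    using pm_expand[of "keys v" v] by simp
  then show ?thesis
    using assms(2) by (simp add: lin_ext_def pm_linear_sum[OF assms(1)] pm_linear_scale[OF assms(1)] del: scale_single)
qed

lemma pm_linear_eqI:
  assumes "pm_linear f" "pm_linear g" "\<And>b. b \<in> B \<Longrightarrow> f (single b 1) = g (single b 1)" "keys v \<subseteq> B"
  shows "f v = g v"
  using lin_ext_eq_linear[OF assms(1), of v "\<lambda>b. f (single b 1)"]
    lin_ext_eq_linear[OF assms(2), of v "\<lambda>b. f (single b 1)"] assms(3,4) by fastforce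

lemma pm_linear_in_subspace:
  assumes "pm_linear f" "pm.subspace S" "\<And>b. b \<in> B \<Longrightarrow> f (single b 1) \<in> S" "keys v \<subseteq> B"
  shows "f v \<in> S"
proof -
  have "f v = lin_ext (\<lambda>b. f (single b 1)) v"
    using lin_ext_eq_linear[OF assms(1)] by metis
  then show ?thesis
    unfolding lin_ext_def using assms(2-4)
    by (auto intro!: pm.subspace_sum pm.subspace_scale)
qed

lemma subspace_keys:
  fixes B :: "'b set"
  shows "pm.subspace {v :: 'b \<Rightarrow>\<^sub>0 'k::field. keys v \<subseteq> B}"
proof (rule pm.subspaceI)
  show "v + w \<in> {v. keys v \<subseteq> B}" if "v \<in> {v. keys v \<subseteq> B}" "w \<in> {v. keys v \<subseteq> B}"
    for v w :: "'b \<Rightarrow>\<^sub>0 'k"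
    using that keys_add[of v w] by blast
qed (auto simp: in_keys_iff)

lemma subspace_space [intro]: "pm.subspace (space M)"
  unfolding space_def by (rule subspace_keys)

lemma single_in_space [intro]: "b \<in> basis M \<Longrightarrow> single b c \<in> space M"
  by (simp add: space_def)

lemma independent_singles: "pm.independent ((\<lambda>b. single b (1::'k::field)) ` B)"
  unfolding pm.independent_explicit_module
proof (intro allI impI)
  fix T u v
  assume T: "finite T" "T \<subseteq> (\<lambda>b. single b (1::'k)) ` B" "(\<Sum>v\<in>T. scale (u v) v) = 0" "v \<in> T"
  then obtain b where b: "v = single b 1" by auto
  have "0 = lookup (\<Sum>w\<in>T. scale (u w) w) b" using T by simp
  also have "\<dots> = (\<Sum>w\<in>T. if w = v then u w else 0)"
    unfolding lookup_sum
  proof (rule sum.cong)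
    fix w assume "w \<in> T"
    with T obtain b' where b': "w = single b' 1" by auto
    have "w = v \<longleftrightarrow> b' = b"
      unfolding b b' by (metis keys_single one_neq_zero singleton_insert_inj_eq')
    then show "lookup (scale (u w) w) b = (if w = v then u w else 0)"
      unfolding b' by (simp add: lookup_single when_def)
  qed simp
  also have "\<dots> = u v" using T by simp
  finally show "u v = 0" by simp
qed

lemma inj_on_singles: "inj_on (\<lambda>b. single b (1::'k::field)) B"
  by (rule inj_onI) (metis keys_single one_neq_zero singleton_insert_inj_eq')

text \<open>A kernel vector with nonzero coordinate at \<open>b\<close> expresses the image of
  \<open>b\<close> through the images of the other basis vectors. These would then span a space
  containing \<open>card (basis M)\<close> independent vectors, one more than they are.\<close>

lemma surjective_linear_bij_betw:
  fixes M :: "('h, 'b, 'k::field) based_module" and N :: "('h', 'c, 'k) based_module"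
  assumes lin: "pm_linear \<phi>" and surj: "\<phi> ` space M = space N"
    and fin: "finite (basis M)" and card: "card (basis M) = card (basis N)"
  shows "bij_betw \<phi> (space M) (space N)"
proof -
  have kernel: "w = 0" if w: "w \<in> space M" "\<phi> w = 0" for w
  proof (rule ccontr)
    assume "w \<noteq> 0"
    then obtain b where b: "b \<in> keys w" by fastforce
    let ?B = "basis M - {b}"
    let ?S = "pm.span ((\<lambda>c. \<phi> (single c 1)) ` ?B)"
    have bM: "b \<in> basis M" using b w by (auto simp: space_def)
    have subS: "pm.subspace ?S" by simp
    have other: "\<phi> (single c 1) \<in> ?S" if "c \<in> ?B" for c
      using that by (auto intro: pm.span_base)
    let ?w = "w - single b (lookup w b)"
    have kw: "keys ?w \<subseteq> ?B"
      using w by (auto simp: space_def in_keys_iff lookup_minus lookup_single when_def split: if_splits)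
    have "\<phi> ?w \<in> ?S"
      by (rule pm_linear_in_subspace[OF lin subS other kw])
    moreover have "\<phi> ?w = - scale (lookup w b) (\<phi> (single b 1))"
      unfolding pm_linear_diff[OF lin] w(2) using pm_linear_scale[OF lin, of "lookup w b" "single b 1"] by simp
    ultimately have "scale (lookup w b) (\<phi> (single b 1)) \<in> ?S"
      using pm.span_neg by fastforce
    then have "scale (1 / lookup w b) (scale (lookup w b) (\<phi> (single b 1))) \<in> ?S"
      by (rule pm.span_scale)
    then have "\<phi> (single b 1) \<in> ?S"
      using b by (simp add: in_keys_iff)
    then have all: "\<phi> (single c 1) \<in> ?S" if "c \<in> basis M" for c
      using other that by blast
    have "space N \<subseteq> ?S"
      unfolding surj[symmetric]
      by (auto simp: space_def intro!: pm_linear_in_subspace[OF lin subS all])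
    then have "(\<lambda>b. single b 1) ` basis N \<subseteq> ?S"
      by auto
    from pm.independent_span_bound[OF _ independent_singles this] fin
    have "card ((\<lambda>b. single b (1::'k)) ` basis N) \<le> card ((\<lambda>c. \<phi> (single c 1)) ` ?B)"
      by simp
    also have "\<dots> \<le> card ?B" using fin by (simp add: card_image_le)
    also have "\<dots> < card (basis M)" using fin bM by (rule card_Diff1_less)
    finally show False
      using card by (simp add: card_image inj_on_singles)
  qed
  have "inj_on \<phi> (space M)"
  proof (rule inj_onI)
    fix v w assume "v \<in> space M" "w \<in> space M" "\<phi> v = \<phi> w"
    then show "v = w"
      using kernel[of "v - w"] pm.subspace_diff[OF subspace_space, of v M w]
      by (simp add: pm_linear_diff[OF lin])
  qed
  then show ?thesis using surj by (simp add: bij_betw_def)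
qed

section \<open>Tensor products of nilpotent Jordan blocks\<close>

text \<open>Absolute values of the coefficients of the highest weight vector of degree
  \<open>j\<close> in the tensor product of the sl2-modules of dimensions \<open>u\<close> and
  \<open>t\<close>, scaled to be integers; the alternating sign is added in
  \<open>cg_power_coeff\<close>. Without the guard, truncated subtraction would make the second
  binomial 1 for \<open>i > j\<close>.\<close>

definition cg_coeff :: "nat \<Rightarrow> nat \<Rightarrow> nat \<Rightarrow> nat \<Rightarrow> nat"
  where "cg_coeff u t j i = (if i \<le> j then ((t - j + i - 1) choose i) * ((u - 1 - i) choose (j - i)) else 0)"

text \<open>The coefficient of \<open>A^e B^(j + n - e)\<close> in \<open>(A + B)^n v\<close>, where
  v is the highest weight vector of degree \<open>j\<close>. The polynomials are not truncated here,
  so \<open>u\<close> and \<open>t\<close> enter only through v and the recursion is Pascal's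
  rule.\<close>

fun cg_power_coeff :: "nat \<Rightarrow> nat \<Rightarrow> nat \<Rightarrow> nat \<Rightarrow> nat \<Rightarrow> int"
  where
    "cg_power_coeff u t j 0 e = (- 1) ^ e * int (cg_coeff u t j e)"
  | "cg_power_coeff u t j (Suc n) 0 = cg_power_coeff u t j n 0"
  | "cg_power_coeff u t j (Suc n) (Suc e) = cg_power_coeff u t j n (Suc e) + cg_power_coeff u t j n e"

text \<open>The condition that the raising operator kills the highest weight vector, read off at
  \<open>A^i B^(j - i - 1)\<close> with the signs removed. It combines one absorption identity for
  each of the two binomials.\<close>

lemma cg_coeff_step:
  assumes "j < u" "j < t" "i < j"
  shows "(i + 1) * (u - 1 - i) * cg_coeff u t j (Suc i) = (t - j + i) * (j - i) * cg_coeff u t j i"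
proof -
  define m where "m = t - j + i"
  define a where "a = u - 2 - i"
  define b where "b = j - i - 1"
  have m: "m > 0" "t - j + Suc i - 1 = m" "t - j + i - 1 = m - 1"
    using assms by (auto simp: m_def)
  have ab: "u - 1 - i = Suc a" "u - 1 - Suc i = a" "j - i = Suc b" "j - Suc i = b"
    using assms by (auto simp: a_def b_def)
  have 1: "Suc i * (m choose Suc i) = m * ((m - 1) choose i)"
    using Suc_times_binomial[of i "m - 1"] m(1) by (cases m) simp_all
  have 2: "Suc a * (a choose b) = (Suc a choose Suc b) * Suc b"
    by (rule Suc_times_binomial_eq)
  have "(i + 1) * (u - 1 - i) * cg_coeff u t j (Suc i)
      = (Suc i * (m choose Suc i)) * (Suc a * (a choose b))"
    using assms unfolding cg_coeff_def m(2) ab by (simp add: algebra_simps)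
  also have "\<dots> = (m * ((m - 1) choose i)) * ((Suc a choose Suc b) * Suc b)"
    by (simp only: 1 2)
  also have "\<dots> = (t - j + i) * (j - i) * cg_coeff u t j i"
    using assms unfolding cg_coeff_def m(3) ab m_def[symmetric] by (simp add: algebra_simps)
  finally show ?thesis .
qed

lemma cg_coeff_pos: "j < u \<Longrightarrow> j < t \<Longrightarrow> i \<le> j \<Longrightarrow> cg_coeff u t j i > 0"
  by (auto simp: cg_coeff_def)

lemma cg_power_coeff_eq_0: "e > j + n \<Longrightarrow> cg_power_coeff u t j n e = 0"
proof (induction n arbitrary: e)
  case 0
  then show ?case by (simp add: cg_coeff_def)
next
  case (Suc n)
  then obtain e' where "e = Suc e'" by (cases e) auto
  with Suc show ?case by simp
qed

text \<open>
  The commutator relation \<open>e f\<^sup>n v = n (\<mu> - n + 1) f\<^sup>n\<^sup>-\<^sup>1 v\<close> of \<open>sl\<^sub>2\<close> for a highest weight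
  vector \<open>v\<close> of weight \<open>\<mu> = u + t - 2 - 2 j\<close>, where \<open>e\<close> sends \<open>A\<^sup>i B\<^sup>l\<close> to
  \<open>i (u - i) A\<^sup>i\<^sup>-\<^sup>1 B\<^sup>l + l (t - l) A\<^sup>i B\<^sup>l\<^sup>-\<^sup>1\<close> and \<open>f\<close> is multiplication by \<open>A + B\<close>.
\<close>

lemma cg_power_coeff_recurrence:
  assumes "j < u" "j < t"
  shows "(int e + 1) * (int u - 1 - int e) * cg_power_coeff u t j n (Suc e)
     + (int j + int n - int e) * (int t - int j - int n + int e) * cg_power_coeff u t j n e
     = int n * (int u + int t - 1 - 2 * int j - int n) * cg_power_coeff u t j (n - 1) e"
proof (induction n arbitrary: e)
  case 0
  show ?case
  proof (cases "e < j")
    case True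
    have int: "int (u - 1 - e) = int u - 1 - int e" "int (t - j + e) = int t - int j + int e"
      "int (j - e) = int j - int e" "int (e + 1) = int e + 1"
      using assms True by auto
    have "int ((e + 1) * (u - 1 - e) * cg_coeff u t j (Suc e)) = int ((t - j + e) * (j - e) * cg_coeff u t j e)"
      by (simp only: cg_coeff_step[OF assms True])
    then have "(int e + 1) * (int u - 1 - int e) * int (cg_coeff u t j (Suc e))
        = (int t - int j + int e) * (int j - int e) * int (cg_coeff u t j e)"
      by (simp only: of_nat_mult int)
    then have "(- 1) ^ e * ((int e + 1) * (int u - 1 - int e) * int (cg_coeff u t j (Suc e)))
        = (- 1) ^ e * ((int t - int j + int e) * (int j - int e) * int (cg_coeff u t j e))"
      by simp
    then show ?thesis by (simp add: algebra_simps)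
  next
    case False
    then show ?thesis by (cases "e = j") (auto simp: cg_coeff_def)
  qed
next
  case (Suc n)
  define g where "g = cg_power_coeff u t j n"
  define W where "W = int u + int t - 1 - 2 * int j"
  have IH: "(int e + 1) * (int u - 1 - int e) * g (Suc e)
     + (int j + int n - int e) * (int t - int j - int n + int e) * g e
     = int n * (W - int n) * cg_power_coeff u t j (n - 1) e" for e
    using Suc.IH[of e] by (simp add: g_def W_def)
  show ?case
  proof (cases e)
    case 0
    \<comment> \<open>The factor \<open>int n\<close> absorbs the case \<open>n = 0\<close>, in
      which \<open>n - 1\<close> is truncated.\<close>
    have "int n * cg_power_coeff u t j (n - 1) 0 = int n * g 0"
      by (cases n) (auto simp: g_def)
    then have 1: "int n * (W - int n) * cg_power_coeff u t j (n - 1) 0 = int n * (W - int n) * g 0"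
      by (metis mult.assoc mult.commute)
    have "(int e + 1) * (int u - 1 - int e) * cg_power_coeff u t j (Suc n) (Suc e)
       + (int j + int (Suc n) - int e) * (int t - int j - int (Suc n) + int e) * cg_power_coeff u t j (Suc n) e
       = (int 0 + 1) * (int u - 1 - int 0) * g (Suc 0)
         + (int j + int n - int 0) * (int t - int j - int n + int 0) * g 0 + (W - 1 - 2 * int n) * g 0"
      by (simp add: 0 g_def[symmetric] W_def algebra_simps)
    also have "\<dots> = int n * (W - int n) * g 0 + (W - 1 - 2 * int n) * g 0"
      by (simp only: IH 1)
    finally show ?thesis by (simp add: 0 g_def[symmetric] W_def algebra_simps)
  next
    case (Suc e')
    have "int n * (cg_power_coeff u t j (n - 1) (Suc e') + cg_power_coeff u t j (n - 1) e') = int n * g (Suc e')"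
      by (cases n) (auto simp: g_def)
    then have 1: "int n * (W - int n) * cg_power_coeff u t j (n - 1) (Suc e')
        + int n * (W - int n) * cg_power_coeff u t j (n - 1) e' = int n * (W - int n) * g (Suc e')"
      by (metis mult.assoc mult.commute distrib_left)
    \<comment> \<open>Pascal's rule yields the induction hypotheses at \<open>e\<close> and
      \<open>e - 1\<close> plus a multiple of \<open>g e\<close>. Its factor
      \<open>W - 1 - 2 n\<close> is the increment of \<open>n (W - n)\<close> from \<open>n\<close>
      to \<open>n + 1\<close>.\<close>
    have "(int e + 1) * (int u - 1 - int e) * cg_power_coeff u t j (Suc n) (Suc e)
       + (int j + int (Suc n) - int e) * (int t - int j - int (Suc n) + int e) * cg_power_coeff u t j (Suc n) e
       = ((int (Suc e') + 1) * (int u - 1 - int (Suc e')) * g (Suc (Suc e'))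
         + (int j + int n - int (Suc e')) * (int t - int j - int n + int (Suc e')) * g (Suc e'))
       + ((int e' + 1) * (int u - 1 - int e') * g (Suc e')
         + (int j + int n - int e') * (int t - int j - int n + int e') * g e') + (W - 1 - 2 * int n) * g (Suc e')"
      by (simp add: Suc g_def[symmetric] W_def algebra_simps)
    also have "\<dots> = int n * (W - int n) * g (Suc e') + (W - 1 - 2 * int n) * g (Suc e')"
      by (simp only: IH 1)
    finally show ?thesis by (simp add: Suc g_def[symmetric] W_def algebra_simps)
  qed
qed

text \<open>At \<open>n = u + t - 1 - 2 j\<close> the right-hand side of the recurrence vanishes,
  which leaves a relation between neighbouring coefficients. Its factor \<open>u - 1 - j - e\<close>
  is zero at \<open>e = u - 1 - j\<close>, so the coefficient at \<open>u - j\<close> vanishes; the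
  vanishing propagates as long as \<open>u - 1 - e\<close> is nonzero, that is up to
  \<open>u - 1\<close>.\<close>

lemma cg_power_coeff_gap:
  assumes "j < u" "j < t" "u - j \<le> e" "e < u"
  shows "cg_power_coeff u t j (u + t - 1 - 2 * j) e = 0"
proof -
  define n where "n = u + t - 1 - 2 * j"
  have n: "int n = int u + int t - 1 - 2 * int j"
    using assms by (simp add: n_def)
  have rec: "(int e + 1) * (int u - 1 - int e) * cg_power_coeff u t j n (Suc e)
     = (int j + int n - int e) * (int u - 1 - int j - int e) * cg_power_coeff u t j n e" for e
  proof -
    have 1: "int t - int j - int n + int e = - (int u - 1 - int j - int e)"
      "int u + int t - 1 - 2 * int j - int n = 0"
      using n by simp_all
    show ?thesis
      using cg_power_coeff_recurrence[OF assms(1,2), of e n] unfolding 1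
      by (simp only: mult_minus_left mult_minus_right mult_zero_left mult_zero_right add_uminus_conv_diff
          eq_iff_diff_eq_0[symmetric])
  qed
  have "cg_power_coeff u t j n (u - j + k) = 0" if "k < j" for k
    using that
  proof (induction k)
    case 0
    have "(int (u - 1 - j) + 1) * (int u - 1 - int (u - 1 - j)) * cg_power_coeff u t j n (Suc (u - 1 - j)) = 0"
      unfolding rec using assms by simp
    moreover have "int (u - 1 - j) + 1 \<noteq> 0" "int u - 1 - int (u - 1 - j) \<noteq> 0" "Suc (u - 1 - j) = u - j"
      using assms 0 by auto
    ultimately show ?case by simp
  next
    case (Suc k)
    have "(int (u - j + k) + 1) * (int u - 1 - int (u - j + k)) * cg_power_coeff u t j n (Suc (u - j + k)) = 0"
      unfolding rec using Suc by simp
    moreover have "int (u - j + k) + 1 \<noteq> 0" "int u - 1 - int (u - j + k) \<noteq> 0"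
      using assms Suc by auto
    ultimately show ?case by simp
  qed
  from this[of "e - (u - j)"] assms show ?thesis
    by (simp add: n_def)
qed

text \<open>\<open>E a b\<close> plays the role of \<open>A^a B^b\<close> on a generator, where
  \<open>f = A + B\<close> and \<open>A^u = B^t = 0\<close>. The pair is encoded by a family of
  vectors because in the application its two members are known only through their effect on such a
  family.\<close>

locale jordan_grid =
  fixes f :: "('b \<Rightarrow>\<^sub>0 'k::field_char_0) \<Rightarrow> ('b \<Rightarrow>\<^sub>0 'k)" and E :: "nat \<Rightarrow> nat \<Rightarrow> ('b \<Rightarrow>\<^sub>0 'k)"
    and u t :: nat
  assumes lin: "pm_linear f"
    and step: "f (E a b) = E (Suc a) b + E a (Suc b)"
    and zero: "a \<ge> u \<or> b \<ge> t \<Longrightarrow> E a b = 0"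
begin

lemma funpow_nilpotent: "u + t \<le> n + a + b + 1 \<Longrightarrow> (f ^^ n) (E a b) = 0"
proof (induction n arbitrary: a b)
  case 0
  then have "a \<ge> u \<or> b \<ge> t" by linarith
  then show ?case by (simp add: zero)
next
  case (Suc n)
  then show ?case
    using Suc.IH[of "Suc a" b] Suc.IH[of a "Suc b"]
    by (simp add: funpow_Suc_right step pm_linear_add[OF pm_linear_funpow[OF lin]] del: funpow.simps)
qed

definition cg_vector :: "nat \<Rightarrow> ('b \<Rightarrow>\<^sub>0 'k)"
  where "cg_vector j = (\<Sum>i\<le>j. scale (of_int (cg_power_coeff u t j 0 i)) (E i (j - i)))"

lemma funpow_cg_vector:
  "(f ^^ n) (cg_vector j) = (\<Sum>i\<le>j + n. scale (of_int (cg_power_coeff u t j n i)) (E i (j + n - i)))"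
proof (induction n)
  case 0
  show ?case by (simp add: cg_vector_def)
next
  case (Suc n)
  let ?g = "\<lambda>n i. of_int (cg_power_coeff u t j n i) :: 'k"
  let ?N = "j + n"
  have "(f ^^ Suc n) (cg_vector j) = (\<Sum>i\<le>?N. scale (?g n i) (E (Suc i) (?N - i) + E i (Suc (?N - i))))"
    by (simp add: Suc.IH pm_linear_sum[OF lin] pm_linear_scale[OF lin] step)
  also have "\<dots> = (\<Sum>i\<le>?N. scale (?g n i) (E (Suc i) (Suc ?N - Suc i)))
      + (\<Sum>i\<le>?N. scale (?g n i) (E i (Suc ?N - i)))"
    by (simp add: pm.scale_right_distrib sum.distrib Suc_diff_le)
  also have "(\<Sum>i\<le>?N. scale (?g n i) (E i (Suc ?N - i))) = (\<Sum>i\<le>Suc ?N. scale (?g n i) (E i (Suc ?N - i)))"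
    by (simp add: cg_power_coeff_eq_0)
  also have "\<dots> = scale (?g n 0) (E 0 (Suc ?N)) + (\<Sum>i\<le>?N. scale (?g n (Suc i)) (E (Suc i) (Suc ?N - Suc i)))"
    by (subst sum.atMost_Suc_shift) simp
  finally show ?case
    by (simp add: sum.atMost_Suc_shift sum.distrib[symmetric] pm.scale_left_distrib[symmetric] add.commute
        add.left_commute del: sum.atMost_Suc)
qed

text \<open>The terms have total degree \<open>u + t - 1 - j\<close>. Those with
  \<open>i >= u\<close> die by \<open>A^u = 0\<close>, those with \<open>i < u - j\<close> because B
  then has exponent at least \<open>t\<close>, and in between the integer coefficients vanish. The
  exponent is the dimension of the sl2-module with this highest weight.\<close>

lemma funpow_cg_vector_eq_0:
  assumes "j < u" "j < t"
  shows "(f ^^ (u + t - 1 - 2 * j)) (cg_vector j) = 0"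
  unfolding funpow_cg_vector
proof (rule sum.neutral, rule ballI)
  fix i assume "i \<in> {..j + (u + t - 1 - 2 * j)}"
  consider "i \<ge> u" | "i < u - j" | "u - j \<le> i" "i < u" by linarith
  then show "scale (of_int (cg_power_coeff u t j (u + t - 1 - 2 * j) i)) (E i (j + (u + t - 1 - 2 * j) - i)) = 0"
  proof cases
    case 2
    then have "j + (u + t - 1 - 2 * j) - i \<ge> t" using assms by linarith
    then show ?thesis by (simp add: zero)
  next
    case 3
    then show ?thesis by (simp only: cg_power_coeff_gap[OF assms 3]) simp
  qed (simp add: zero)
qed

lemma cg_vector_in_subspace:
  "pm.subspace S \<Longrightarrow> (\<And>a b. E a b \<in> S) \<Longrightarrow> cg_vector j \<in> S"
  unfolding cg_vector_def by (intro pm.subspace_sum pm.subspace_scale)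

text \<open>
  Modulo the image of \<open>f\<close> one has \<open>E i (d - i) = (- 1)\<^sup>i E 0 d\<close>, so that \<open>cg_vector d\<close> becomes a
  positive multiple of \<open>E 0 d\<close>, and \<open>E 0 d\<close> becomes \<open>0\<close> for \<open>d \<ge> min u t\<close>.
\<close>

lemma cg_vectors_generate:
  assumes S: "pm.subspace S" "\<And>v. v \<in> S \<Longrightarrow> f v \<in> S"
    and cg: "\<And>j. j < min u t \<Longrightarrow> cg_vector j \<in> S"
  shows "E a b \<in> S"
proof (induction "a + b" arbitrary: a b rule: less_induct)
  case less
  let ?d = "a + b"
  have step': "E i (?d - i) - scale ((- 1) ^ i) (E 0 ?d) \<in> S" if "i \<le> ?d" for i
    using that
  proof (induction i)
    case 0
    show ?case by (simp add: pm.subspace_0[OF S(1)])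
  next
    case (Suc i)
    then have "f (E i (?d - Suc i)) \<in> S" by (intro S(2) less) simp
    moreover have "f (E i (?d - Suc i)) = E (Suc i) (?d - Suc i) + E i (?d - i)"
      using Suc.prems by (simp add: step Suc_diff_Suc)
    ultimately have "E (Suc i) (?d - Suc i) + E i (?d - i) \<in> S" by simp
    from pm.subspace_diff[OF S(1) this Suc.IH] Suc.prems show ?case by simp
  qed
  have "E 0 ?d \<in> S"
  proof (cases "?d < min u t")
    case True
    define \<kappa> where "\<kappa> = (\<Sum>i\<le>?d. cg_coeff u t ?d i)"
    have "\<kappa> > 0"
      unfolding \<kappa>_def using True by (intro sum_pos) (auto simp: cg_coeff_pos)
    have "(\<Sum>i\<le>?d. scale (of_int (cg_power_coeff u t ?d 0 i)) (E i (?d - i) - scale ((- 1) ^ i) (E 0 ?d))) \<in> S"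
      by (intro pm.subspace_sum[OF S(1)] pm.subspace_scale[OF S(1)] step') auto
    moreover have "(\<Sum>i\<le>?d. scale (of_int (cg_power_coeff u t ?d 0 i)) (E i (?d - i) - scale ((- 1) ^ i) (E 0 ?d)))
        = cg_vector ?d - scale (of_nat \<kappa>) (E 0 ?d)"
      by (simp add: cg_vector_def \<kappa>_def pm.scale_right_diff_distrib sum_subtractf pm.scale_sum_left
          power_add[symmetric] mult.commute mult.left_commute flip: mult.assoc)
    ultimately have "cg_vector ?d - scale (of_nat \<kappa>) (E 0 ?d) \<in> S" by simp
    from pm.subspace_diff[OF S(1) cg[OF True] this] have "scale (of_nat \<kappa>) (E 0 ?d) \<in> S"
      by simp
    \<comment> \<open>Dividing by the positive integer \<open>\<kappa>\<close> is the point that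
      depends on characteristic zero.\<close>
    from pm.subspace_scale[OF S(1) this, of "1 / of_nat \<kappa>"] \<open>\<kappa> > 0\<close>
    show ?thesis by simp
  next
    case False
    then consider "?d \<ge> t" | "?d \<ge> u" by linarith
    then show ?thesis
    proof cases
      case 1
      then show ?thesis by (simp add: zero pm.subspace_0[OF S(1)])
    next
      case 2
      \<comment> \<open>Since \<open>E u (?d - u) = 0\<close>, the congruence at index
        \<open>u\<close> already exhibits \<open>E 0 ?d\<close> up to sign.\<close>
      then have "scale (- ((- 1) ^ u)) (E u (?d - u) - scale ((- 1) ^ u) (E 0 ?d)) \<in> S"
        by (intro pm.subspace_scale[OF S(1)] step')
      then show ?thesis by (simp add: zero flip: power_add)
    qed
  qed
  then have "E a (?d - a) - scale ((- 1) ^ a) (E 0 ?d) + scale ((- 1) ^ a) (E 0 ?d) \<in> S"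
    by (intro pm.subspace_add[OF S(1)] pm.subspace_scale[OF S(1)] step') auto
  then show ?case by simp
qed

end

section \<open>Modules over the Hopf algebra\<close>

lemma lin_ext_space:
  assumes "\<And>b. b \<in> basis M \<Longrightarrow> f b \<in> space N" "v \<in> space M"
  shows "lin_ext f v \<in> space N"
proof (rule pm_linear_in_subspace[OF pm_linear_lin_ext subspace_space])
  show "keys v \<subseteq> basis M" using assms(2) by (simp add: space_def)
qed (simp add: assms(1))

text \<open>Stated at a single vector because every condition is linear in \<open>v\<close> and
  hence passes from basis vectors to the whole of \<open>space M\<close>.\<close>

definition ore_relations_at ::
    "('g, 'z) monoid_scheme \<Rightarrow> ('g \<Rightarrow> 'k::field) \<Rightarrow>
     ('g \<times> nat \<Rightarrow>\<^sub>0 'k, 'b, 'k) based_module \<Rightarrow> ('b \<Rightarrow>\<^sub>0 'k) \<Rightarrow> bool"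
  where "ore_relations_at G \<psi> M v \<longleftrightarrow>
    (\<forall>g\<in>carrier G. act M (grp g) v \<in> space M) \<and>
    act M (ore_x G) v \<in> space M \<and>
    (\<forall>g\<in>carrier G. \<forall>i. act M (single (g, i) 1) v = act M (grp g) ((act M (ore_x G) ^^ i) v)) \<and>
    (\<forall>g\<in>carrier G. \<forall>h\<in>carrier G. act M (grp (g \<otimes>\<^bsub>G\<^esub> h)) v = act M (grp g) (act M (grp h) v)) \<and>
    act M (grp \<one>\<^bsub>G\<^esub>) v = v \<and>
    (\<forall>g\<in>carrier G. act M (ore_x G) (act M (grp g) v) = scale (\<psi> g) (act M (grp g) (act M (ore_x G) v)))"

text \<open>Linearity is required on all finitely supported functions, also outside
  \<open>space M\<close>. All actions here are built by \<open>lin_ext\<close>, and unrestricted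
  linearity keeps the reductions to basis vectors free of membership conditions.\<close>

locale ore_module = group G for G :: "('g, 'z) monoid_scheme" (structure) +
  fixes \<psi> :: "'g \<Rightarrow> 'k::field" and M :: "('g \<times> nat \<Rightarrow>\<^sub>0 'k, 'b, 'k) based_module"
  assumes act_linear: "pm_linear (act M h)"
    and act_linear_left: "pm_linear (\<lambda>h. act M h v)"
    and relations_at_basis: "b \<in> basis M \<Longrightarrow> ore_relations_at G \<psi> M (single b 1)"
begin

abbreviation X where "X \<equiv> act M (ore_x G)"

lemma act_linear' [simp]: "pm_linear (act M h)" "pm_linear (X ^^ i)"
  "pm_linear (\<lambda>v. act M h ((X ^^ i) v))" "pm_linear (\<lambda>v. act M h (act M h' v))"
  "pm_linear (\<lambda>v. scale c (act M h (act M h' v)))"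
  using act_linear[of h] act_linear[of h'] pm_linear_funpow[of X i, OF act_linear]
  by (auto simp: pm_linear_iff pm.scale_right_distrib mult.commute)

lemma act_zero [simp]: "act M h 0 = 0"
  by (rule pm_linear_zero) simp

lemma act_scale: "act M h (scale c v) = scale c (act M h v)"
  by (rule pm_linear_scale) simp

lemma relations_at:
  assumes "v \<in> space M"
  shows "ore_relations_at G \<psi> M v"
proof -
  have v: "keys v \<subseteq> basis M" using assms by (simp add: space_def)
  have rel: "act M (grp g) (single b 1) \<in> space M"
    "X (single b 1) \<in> space M"
    "act M (single (g, i) 1) (single b 1) = act M (grp g) ((X ^^ i) (single b 1))"
    "act M (grp (g \<otimes> h)) (single b 1) = act M (grp g) (act M (grp h) (single b 1))"
    "act M (grp \<one>) (single b 1) = single b 1"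
    "X (act M (grp g) (single b 1)) = scale (\<psi> g) (act M (grp g) (X (single b 1)))"
    if "b \<in> basis M" "g \<in> carrier G" "h \<in> carrier G" for b g h i
    using relations_at_basis[OF that(1)] that(2,3) unfolding ore_relations_at_def by blast+
  show ?thesis
    unfolding ore_relations_at_def
  proof (intro conjI ballI allI)
    show "act M (grp g) v \<in> space M" if "g \<in> carrier G" for g
      using rel(1) that by (intro pm_linear_in_subspace[OF act_linear subspace_space _ v]) blast
    show "X v \<in> space M"
      using rel(2) one_closed by (intro pm_linear_in_subspace[OF act_linear subspace_space _ v]) blast
    show "act M (single (g, i) 1) v = act M (grp g) ((X ^^ i) v)" if "g \<in> carrier G" for g i
      by (rule pm_linear_eqI[OF act_linear act_linear'(3) rel(3)[OF _ that that] v])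
    show "act M (grp (g \<otimes> h)) v = act M (grp g) (act M (grp h) v)" if "g \<in> carrier G" "h \<in> carrier G" for g h
      by (rule pm_linear_eqI[OF act_linear act_linear'(4) rel(4)[OF _ that] v])
    show "act M (grp \<one>) v = v"
      using rel(5) one_closed by (intro pm_linear_eqI[OF act_linear pm.linear_ident _ v]) blast
    show "X (act M (grp g) v) = scale (\<psi> g) (act M (grp g) (X v))" if "g \<in> carrier G" for g
      by (rule pm_linear_eqI[OF act_linear'(4) act_linear'(5) rel(6)[OF _ that that] v])
  qed
qed

lemma grp_space [simp]: "g \<in> carrier G \<Longrightarrow> v \<in> space M \<Longrightarrow> act M (grp g) v \<in> space M"
  and X_space [simp]: "v \<in> space M \<Longrightarrow> X v \<in> space M"
  and act_single: "g \<in> carrier G \<Longrightarrow> v \<in> space M \<Longrightarrow>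
    act M (single (g, i) 1) v = act M (grp g) ((X ^^ i) v)"
  and grp_mult: "g \<in> carrier G \<Longrightarrow> h \<in> carrier G \<Longrightarrow> v \<in> space M \<Longrightarrow>
    act M (grp (g \<otimes> h)) v = act M (grp g) (act M (grp h) v)"
  and grp_one [simp]: "v \<in> space M \<Longrightarrow> act M (grp \<one>) v = v"
  and X_grp: "g \<in> carrier G \<Longrightarrow> v \<in> space M \<Longrightarrow>
    X (act M (grp g) v) = scale (\<psi> g) (act M (grp g) (X v))"
  using relations_at unfolding ore_relations_at_def by auto

lemma funpow_X_space [simp]: "v \<in> space M \<Longrightarrow> (X ^^ i) v \<in> space M"
  by (induction i) auto

lemma funpow_X_grp:
  assumes "g \<in> carrier G" "v \<in> space M"
  shows "(X ^^ i) (act M (grp g) v) = scale (\<psi> g ^ i) (act M (grp g) ((X ^^ i) v))"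
  by (induction i) (use assms in \<open>simp_all add: X_grp act_scale mult.commute\<close>)

lemma single_space: "g \<in> carrier G \<Longrightarrow> v \<in> space M \<Longrightarrow> act M (single (g, i) 1) v \<in> space M"
  by (simp add: act_single)

lemma act_mult_single:
  assumes "g \<in> carrier G" "k \<in> carrier G" "v \<in> space M"
  shows "act M (single (g \<otimes> k, i + j) (\<psi> k ^ i)) v = act M (single (g, i) 1) (act M (single (k, j) 1) v)"
proof -
  have "act M (single (g \<otimes> k, i + j) (\<psi> k ^ i)) v = scale (\<psi> k ^ i) (act M (single (g \<otimes> k, i + j) 1) v)"
    using pm_linear_scale[OF act_linear_left, of "\<psi> k ^ i" "single (g \<otimes> k, i + j) 1" v] by simp
  with assms show ?thesis
    by (simp add: act_single grp_mult single_space funpow_X_grp funpow_add act_scale)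
qed

lemma carrier_space:
  assumes "h \<in> carrier (hopf_ore G \<psi>)" "v \<in> space M"
  shows "act M h v \<in> space M"
proof (rule pm_linear_in_subspace[OF act_linear_left subspace_space])
  show "keys h \<subseteq> carrier G \<times> UNIV" using assms by (simp add: hopf_ore_def)
qed (use assms single_space in auto)

text \<open>Multiplicativity is bilinear in the two algebra elements, so it reduces to basis
  elements \<open>g x^i\<close> and \<open>k x^j\<close>, where moving \<open>x^i\<close> past
  \<open>k\<close> costs the factor \<open>\<psi>(k)^i\<close>.\<close>

lemma left_module: "left_module (hopf_ore G \<psi>) M"
  unfolding left_module_def
proof (intro conjI ballI allI)
  fix h h' v w
  show "act M h v \<in> space M" if "h \<in> carrier (hopf_ore G \<psi>)" "v \<in> space M"
    using that by (rule carrier_space)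
  show "act M h (v + w) = act M h v + act M h w"
    by (rule pm_linear_add) simp
  show "act M (h \<oplus>\<^bsub>hopf_ore G \<psi>\<^esub> h') v = act M h v + act M h' v"
    using pm_linear_add[OF act_linear_left, of h h' v] by (simp add: hopf_ore_def)
  show "act M (h \<otimes>\<^bsub>hopf_ore G \<psi>\<^esub> h') v = act M h (act M h' v)"
    if "h \<in> carrier (hopf_ore G \<psi>)" "h' \<in> carrier (hopf_ore G \<psi>)" "v \<in> space M"
  proof -
    have keys: "keys h \<subseteq> carrier G \<times> UNIV" "keys h' \<subseteq> carrier G \<times> UNIV"
      using that by (auto simp: hopf_ore_def)
    let ?m = "\<lambda>(g, i) (k, j). single (g \<otimes> k, i + j) (\<psi> k ^ i)"
    have lin_right: "pm_linear (\<lambda>h'. act M (bilin_ext ?m h h') v)" for h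
      unfolding bilin_ext_def
      by (intro pm_linear_comp[OF act_linear_left] pm_linear_lin_ext_param pm_linear_lin_ext)
    have lin_left: "pm_linear (\<lambda>h. act M (bilin_ext ?m h h') v)" for h'
      unfolding bilin_ext_def by (intro pm_linear_comp[OF act_linear_left] pm_linear_lin_ext)
    have "act M (bilin_ext ?m h h') v = act M h (act M h' v)"
    proof (rule pm_linear_eqI[OF lin_left act_linear_left _ keys(1)])
      fix p assume "p \<in> carrier G \<times> (UNIV :: nat set)"
      then obtain g i where p: "p = (g, i)" "g \<in> carrier G" by auto
      show "act M (bilin_ext ?m (single p 1) h') v = act M (single p 1) (act M h' v)"
      proof (rule pm_linear_eqI[OF lin_right pm_linear_comp[OF act_linear act_linear_left] _ keys(2)])
        fix q assume "q \<in> carrier G \<times> (UNIV :: nat set)"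
        then obtain k j where q: "q = (k, j)" "k \<in> carrier G" by auto
        show "act M (bilin_ext ?m (single p 1) (single q 1)) v = act M (single p 1) (act M (single q 1) v)"
          unfolding p q bilin_ext_def using act_mult_single[OF p(2) q(2) that(3), of i j] by simp
      qed
    qed
    then show ?thesis by (simp add: hopf_ore_def)
  qed
  show "act M \<one>\<^bsub>hopf_ore G \<psi>\<^esub> v = v" if "v \<in> space M"
    using that grp_one[of v] by (simp add: hopf_ore_def grp_def)
  show "act M (scale c \<one>\<^bsub>hopf_ore G \<psi>\<^esub>) v = scale c v" if "v \<in> space M" for c
    using that grp_one[of v] pm_linear_scale[OF act_linear_left, of c "grp \<one>" v] by (simp add: hopf_ore_def grp_def)
qed

end

lemma ore_module_hom:
  assumes M: "ore_module G \<psi> M" and N: "ore_module G \<psi> N" and lin: "pm_linear \<phi>"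
    and space: "\<And>b. b \<in> basis M \<Longrightarrow> \<phi> (single b 1) \<in> space N"
    and grp: "\<And>b g. b \<in> basis M \<Longrightarrow> g \<in> carrier G \<Longrightarrow>
      \<phi> (act M (grp g) (single b 1)) = act N (grp g) (\<phi> (single b 1))"
    and X: "\<And>b. b \<in> basis M \<Longrightarrow> \<phi> (act M (ore_x G) (single b 1)) = act N (ore_x G) (\<phi> (single b 1))"
    and h: "h \<in> carrier (hopf_ore G \<psi>)" and v: "v \<in> space M"
  shows "\<phi> (act M h v) = act N h (\<phi> v)"
proof -
  interpret M: ore_module G \<psi> M by fact
  interpret N: ore_module G \<psi> N by fact
  have keys: "keys w \<subseteq> basis M" if "w \<in> space M" for w using that by (simp add: space_def)
  have space': "\<phi> w \<in> space N" if "w \<in> space M" for w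
    using pm_linear_in_subspace[OF lin subspace_space space keys[OF that]] .
  have grp': "\<phi> (act M (grp g) w) = act N (grp g) (\<phi> w)" if "w \<in> space M" "g \<in> carrier G" for g w
    by (rule pm_linear_eqI[OF pm_linear_comp[OF lin M.act_linear] pm_linear_comp[OF N.act_linear lin]
          grp[OF _ that(2)] keys[OF that(1)]])
  have X': "\<phi> (M.X w) = N.X (\<phi> w)" if "w \<in> space M" for w
    by (rule pm_linear_eqI[OF pm_linear_comp[OF lin M.act_linear] pm_linear_comp[OF N.act_linear lin]
          X keys[OF that]])
  have pow: "\<phi> ((M.X ^^ i) w) = (N.X ^^ i) (\<phi> w)" if "w \<in> space M" for w i
    using that by (induction i) (auto simp: X')
  have "keys h \<subseteq> carrier G \<times> UNIV" using h by (auto simp: hopf_ore_def)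
  show ?thesis
    by (rule pm_linear_eqI[OF pm_linear_comp[OF lin M.act_linear_left] N.act_linear_left
          _ \<open>keys h \<subseteq> carrier G \<times> UNIV\<close>])
      (auto simp: v M.act_single N.act_single space' grp' pow)
qed

text \<open>The map runs from \<open>N\<close> to \<open>M\<close>, against the direction of
  \<open>module_iso\<close>, because the homomorphisms constructed below start at the direct sum.
  Its inverse inherits additivity and compatibility with the action.\<close>

lemma module_isoI:
  assumes "ore_module G \<psi> M" "ore_module G \<psi> N" "pm_linear \<phi>" "bij_betw \<phi> (space N) (space M)"
    and "\<And>h v. h \<in> carrier (hopf_ore G \<psi>) \<Longrightarrow> v \<in> space N \<Longrightarrow> \<phi> (act N h v) = act M h (\<phi> v)"
  shows "module_iso (hopf_ore G \<psi>) M N"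
proof -
  interpret M: ore_module G \<psi> M by fact
  interpret N: ore_module G \<psi> N by fact
  let ?\<theta> = "inv_into (space N) \<phi>"
  have inj: "inj_on \<phi> (space N)" and img: "\<phi> ` space N = space M"
    using assms(4) by (auto simp: bij_betw_def)
  have \<theta>: "?\<theta> v \<in> space N" "\<phi> (?\<theta> v) = v" if "v \<in> space M" for v
    using that img by (auto intro: inv_into_into f_inv_into_f)
  have "\<exists>\<theta>. bij_betw \<theta> (space M) (space N) \<and>
      (\<forall>v\<in>space M. \<forall>w\<in>space M. \<theta> (v + w) = \<theta> v + \<theta> w) \<and>
      (\<forall>h\<in>carrier (hopf_ore G \<psi>). \<forall>v\<in>space M. \<theta> (act M h v) = act N h (\<theta> v))"
  proof (intro exI conjI ballI)
    show "bij_betw ?\<theta> (space M) (space N)"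
      by (rule bij_betw_inv_into) fact
    show "?\<theta> (v + w) = ?\<theta> v + ?\<theta> w" if "v \<in> space M" "w \<in> space M" for v w
      using that \<theta> pm_linear_add[OF assms(3), of "?\<theta> v" "?\<theta> w"]
        pm.subspace_add[OF subspace_space, of "?\<theta> v" N "?\<theta> w"]
      by (intro inv_into_f_eq[OF inj]) auto
    show "?\<theta> (act M h v) = act N h (?\<theta> v)" if "h \<in> carrier (hopf_ore G \<psi>)" "v \<in> space M" for h v
      using that \<theta> assms(5)[OF that(1), of "?\<theta> v"]
      by (intro inv_into_f_eq[OF inj]) (auto intro: N.carrier_space)
  qed
  then show ?thesis
    unfolding module_iso_def using M.left_module N.left_module by blast
qed

lemma ore_module_from_generators:
  fixes G :: "('g, 'z) monoid_scheme" (structure)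
  assumes "group G" and act: "act M = action_from_generators \<rho> X"
    and lin: "\<And>g. pm_linear (\<rho> g)" "pm_linear X"
    and space: "\<And>g b. g \<in> carrier G \<Longrightarrow> b \<in> basis M \<Longrightarrow> \<rho> g (single b 1) \<in> space M"
      "\<And>b. b \<in> basis M \<Longrightarrow> X (single b 1) \<in> space M"
    and one: "\<And>b. b \<in> basis M \<Longrightarrow> \<rho> \<one> (single b 1) = single b 1"
    and mult: "\<And>g h b. g \<in> carrier G \<Longrightarrow> h \<in> carrier G \<Longrightarrow> b \<in> basis M \<Longrightarrow>
      \<rho> (g \<otimes> h) (single b 1) = \<rho> g (\<rho> h (single b 1))"
    and comm: "\<And>g b. g \<in> carrier G \<Longrightarrow> b \<in> basis M \<Longrightarrow>
      X (\<rho> g (single b 1)) = scale (\<psi> g) (\<rho> g (X (single b 1)))"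
  shows "ore_module G \<psi> M"
    and "g \<in> carrier G \<Longrightarrow> act M (grp g) v = \<rho> g v"
    and "v \<in> space M \<Longrightarrow> act M (ore_x G) v = X v"
proof -
  have single: "act M (single (g, i) c) v = scale c (\<rho> g ((X ^^ i) v))" for g i c v
    by (simp add: act action_from_generators_def)
  have keys: "keys w \<subseteq> basis M" if "w \<in> space M" for w using that by (simp add: space_def)
  have one': "\<rho> \<one> w = w" if "w \<in> space M" for w
    using that by (intro pm_linear_eqI[OF _ _ _ keys[OF that], of _ "\<lambda>v. v"])
      (auto simp: lin one pm.linear_ident)
  have X_space: "X w \<in> space M" if "w \<in> space M" for w
    using pm_linear_in_subspace[OF lin(2) subspace_space space(2) keys[OF that]] .
  show grp: "act M (grp g) v = \<rho> g v" for g v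
    by (simp add: grp_def single)
  show x: "act M (ore_x G) v = X v" if "v \<in> space M" for v
    using that by (simp add: ore_x_def single one' X_space)
  have pow_space: "(X ^^ i) w \<in> space M" if "w \<in> space M" for w i
    using that by (induction i) (auto simp: X_space)
  have pow: "(act M (ore_x G) ^^ i) w = (X ^^ i) w" if "w \<in> space M" for w i
    using that by (induction i) (auto simp: x pow_space)
  have lin_act: "pm_linear (act M h)" for h
    unfolding act action_from_generators_def
    by (rule pm_linear_lin_ext_param) (auto intro: pm_linear_comp[OF lin(1) pm_linear_funpow[OF lin(2)]])
  have lin_act_left: "pm_linear (\<lambda>h. act M h v)" for v
    unfolding act action_from_generators_def by simp
  show "ore_module G \<psi> M"
  proof (intro ore_module.intro \<open>group G\<close> ore_module_axioms.intro lin_act lin_act_left)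
    fix b assume b: "b \<in> basis M"
    then have b': "single b 1 \<in> space M" by auto
    show "ore_relations_at G \<psi> M (single b 1)"
      unfolding ore_relations_at_def grp x[OF b']
      using b b' by (auto simp: space one mult comm single pow x[OF space(1)])
  qed
qed

text \<open>Transports the relations along the inclusion of a summand, so that sums of modules
  inherit them at each of their basis vectors.\<close>

lemma ore_relations_at_image:
  assumes "ore_module G \<psi> M" and lin: "pm_linear \<iota>"
    and space: "\<And>w. w \<in> space M \<Longrightarrow> \<iota> w \<in> space N"
    and comm: "\<And>h w. \<iota> (act M h w) = act N h (\<iota> w)" and v: "v \<in> space M"
  shows "ore_relations_at G \<psi> N (\<iota> v)"
proof -
  interpret ore_module G \<psi> M by fact
  have pow: "(act N (ore_x G) ^^ i) (\<iota> w) = \<iota> ((X ^^ i) w)" for i w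
    by (induction i) (auto simp: comm)
  show ?thesis
    unfolding ore_relations_at_def comm[symmetric] pow
    using v by (auto simp: space act_single grp_mult X_grp pm_linear_scale[OF lin])
qed

section \<open>Direct sums of modules\<close>

lemma direct_sum_act_inj:
  assumes "\<And>i. pm_linear (act (M i) h)"
  shows "act (direct_sum I M) h (lin_ext (\<lambda>c. single (i, c) 1) v) = lin_ext (\<lambda>c. single (i, c) 1) (act (M i) h v)"
proof -
  have "pm_linear (\<lambda>v. act (direct_sum I M) h (lin_ext (\<lambda>c. single (i, c) 1) v))"
    unfolding direct_sum_def by (simp add: pm_linear_comp[OF pm_linear_lin_ext pm_linear_lin_ext])
  moreover have "pm_linear (\<lambda>v. lin_ext (\<lambda>c. single (i, c) 1) (act (M i) h v))"
    by (rule pm_linear_comp[OF pm_linear_lin_ext assms])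
  ultimately show ?thesis
    by (rule pm_linear_eqI[OF _ _ _ subset_UNIV]) (simp add: direct_sum_def)
qed

lemma ore_module_direct_sum:
  assumes "\<And>i. ore_module G \<psi> (M i)"
  shows "ore_module G \<psi> (direct_sum I M)"
proof (intro ore_module.intro ore_module_axioms.intro)
  show "group G" using assms by (blast intro: ore_module.axioms)
  show "pm_linear (act (direct_sum I M) h)" for h
    by (simp add: direct_sum_def)
  show "pm_linear (\<lambda>h. act (direct_sum I M) h v)" for v
    unfolding direct_sum_def
    by (auto intro!: pm_linear_lin_ext_param pm_linear_comp[OF pm_linear_lin_ext ore_module.act_linear_left[OF assms]])
  show "ore_relations_at G \<psi> (direct_sum I M) (single ib 1)" if ib: "ib \<in> basis (direct_sum I M)" for ib
  proof -
    obtain i b where *: "ib = (i, b)" "i \<in> I" "b \<in> basis (M i)"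
      using ib by (auto simp: direct_sum_def)
    have "ore_relations_at G \<psi> (direct_sum I M) (lin_ext (\<lambda>c. single (i, c) 1) (single b 1))"
    proof (rule ore_relations_at_image[OF assms])
      show "lin_ext (\<lambda>c. single (i, c) 1) w \<in> space (direct_sum I M)" if "w \<in> space (M i)" for w
        by (rule lin_ext_space[OF _ that]) (use *(2) in \<open>auto simp: space_def direct_sum_def\<close>)
    qed (use * ore_module.act_linear[OF assms] in \<open>auto simp: direct_sum_act_inj\<close>)
    then show ?thesis by (simp add: *)
  qed
qed

lemma binary_sum_act_Inl:
  assumes "pm_linear (act M h)"
  shows "act (binary_sum M N) h (lin_ext (\<lambda>c. single (Inl c) 1) v) = lin_ext (\<lambda>c. single (Inl c) 1) (act M h v)"
proof -
  have "pm_linear (\<lambda>v. act (binary_sum M N) h (lin_ext (\<lambda>c. single (Inl c) 1) v))"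
    unfolding binary_sum_def by (simp add: pm_linear_comp[OF pm_linear_lin_ext pm_linear_lin_ext])
  moreover have "pm_linear (\<lambda>v. lin_ext (\<lambda>c. single (Inl c) 1) (act M h v))"
    by (rule pm_linear_comp[OF pm_linear_lin_ext assms])
  ultimately show ?thesis
    by (rule pm_linear_eqI[OF _ _ _ subset_UNIV]) (simp add: binary_sum_def)
qed

lemma binary_sum_act_Inr:
  assumes "pm_linear (act N h)"
  shows "act (binary_sum M N) h (lin_ext (\<lambda>c. single (Inr c) 1) v) = lin_ext (\<lambda>c. single (Inr c) 1) (act N h v)"
proof -
  have "pm_linear (\<lambda>v. act (binary_sum M N) h (lin_ext (\<lambda>c. single (Inr c) 1) v))"
    unfolding binary_sum_def by (simp add: pm_linear_comp[OF pm_linear_lin_ext pm_linear_lin_ext])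
  moreover have "pm_linear (\<lambda>v. lin_ext (\<lambda>c. single (Inr c) 1) (act N h v))"
    by (rule pm_linear_comp[OF pm_linear_lin_ext assms])
  ultimately show ?thesis
    by (rule pm_linear_eqI[OF _ _ _ subset_UNIV]) (simp add: binary_sum_def)
qed

lemma ore_module_binary_sum:
  assumes M: "ore_module G \<psi> M" and N: "ore_module G \<psi> N"
  shows "ore_module G \<psi> (binary_sum M N)"
proof (intro ore_module.intro ore_module_axioms.intro)
  show "group G" using M by (blast intro: ore_module.axioms)
  show "pm_linear (act (binary_sum M N) h)" for h
    by (simp add: binary_sum_def)
  have "pm_linear (\<lambda>h. (case c of Inl b \<Rightarrow> lin_ext (\<lambda>c. single (Inl c) 1) (act M h (single b 1))
      | Inr d \<Rightarrow> lin_ext (\<lambda>c. single (Inr c) 1) (act N h (single d 1))))" for c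
    by (cases c) (simp_all add: pm_linear_comp[OF pm_linear_lin_ext ore_module.act_linear_left[OF M]]
        pm_linear_comp[OF pm_linear_lin_ext ore_module.act_linear_left[OF N]])
  then show "pm_linear (\<lambda>h. act (binary_sum M N) h v)" for v
    unfolding binary_sum_def by (auto intro!: pm_linear_lin_ext_param)
  show "ore_relations_at G \<psi> (binary_sum M N) (single c 1)" if "c \<in> basis (binary_sum M N)" for c
  proof (cases c)
    case (Inl b)
    have "ore_relations_at G \<psi> (binary_sum M N) (lin_ext (\<lambda>c. single (Inl c) 1) (single b 1))"
    proof (rule ore_relations_at_image[OF M])
      show "lin_ext (\<lambda>c. single (Inl c) 1) w \<in> space (binary_sum M N)" if "w \<in> space M" for w
        by (rule lin_ext_space[OF _ that]) (auto simp: space_def binary_sum_def)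
    qed (use that Inl ore_module.act_linear[OF M] in \<open>auto simp: binary_sum_act_Inl\<close>, auto simp: binary_sum_def)
    then show ?thesis by (simp add: Inl)
  next
    case (Inr b)
    have "ore_relations_at G \<psi> (binary_sum M N) (lin_ext (\<lambda>c. single (Inr c) 1) (single b 1))"
    proof (rule ore_relations_at_image[OF N])
      show "lin_ext (\<lambda>c. single (Inr c) 1) w \<in> space (binary_sum M N)" if "w \<in> space N" for w
        by (rule lin_ext_space[OF _ that]) (auto simp: space_def binary_sum_def)
    qed (use that Inr ore_module.act_linear[OF N] in \<open>auto simp: binary_sum_act_Inr\<close>, auto simp: binary_sum_def)
    then show ?thesis by (simp add: Inr)
  qed
qed

section \<open>Tensor products of modules through the comultiplication\<close>

lemma pm_bilinear_eqI:
  assumes "\<And>y. pm_linear (\<lambda>x. F x y)" "\<And>x. pm_linear (F x)"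
    and "\<And>y. pm_linear (\<lambda>x. G x y)" "\<And>x. pm_linear (G x)"
    and "\<And>b c. b \<in> B \<Longrightarrow> c \<in> C \<Longrightarrow> F (single b 1) (single c 1) = G (single b 1) (single c 1)"
    and "keys v \<subseteq> B" "keys w \<subseteq> C"
  shows "F v w = G v w"
proof (rule pm_linear_eqI[OF assms(1) assms(3) _ assms(6)])
  fix b assume "b \<in> B"
  then show "F (single b 1) w = G (single b 1) w"
    using pm_linear_eqI[OF assms(2) assms(4) assms(5) assms(7)] by blast
qed

lemma tens_single [simp]: "tens (single b c) (single d e) = single (b, d) (c * e)"
  by (simp add: tens_def bilin_ext_def)

lemma pm_linear_bilin_ext_left: "pm_linear (\<lambda>v. bilin_ext f v w)"
  by (simp add: bilin_ext_def)

lemma pm_linear_bilin_ext_right: "pm_linear (bilin_ext f v)"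
  unfolding bilin_ext_def by (rule pm_linear_lin_ext_param) simp

lemma pm_linear_tens_left [simp]: "pm_linear (\<lambda>v. tens v w)"
  unfolding tens_def by (rule pm_linear_bilin_ext_left)

lemma pm_linear_tens_right [simp]: "pm_linear (tens v)"
  unfolding tens_def by (rule pm_linear_bilin_ext_right)

lemma tens_scale_left: "tens (scale c v) w = scale c (tens v w)"
  and tens_zero_left [simp]: "tens 0 w = 0"
  by (rule pm_linear_scale[OF pm_linear_tens_left],
      rule pm_linear_zero[OF pm_linear_tens_left])

lemma tens_scale_right: "tens v (scale c w) = scale c (tens v w)"
  and tens_zero_right [simp]: "tens v 0 = 0"
  by (rule pm_linear_scale[OF pm_linear_tens_right],
      rule pm_linear_zero[OF pm_linear_tens_right])

text \<open>The action of \<open>H \<otimes> H\<close> on the tensor product, separated from the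
  comultiplication so that products in \<open>H \<otimes> H\<close> can be compared with
  compositions of operators.\<close>

definition tensor_act where
  "tensor_act M N = bilin_ext (\<lambda>(u, v) (b, d).
     tens (act M (single u 1) (single b 1)) (act N (single v 1) (single d 1)))"

lemma pm_linear_tensor_act [simp]:
  "pm_linear (tensor_act M N z)" "pm_linear (\<lambda>z. tensor_act M N z w)"
  by (simp_all add: tensor_act_def pm_linear_bilin_ext_left pm_linear_bilin_ext_right)

lemma act_tensor_module: "act (tensor_module \<Delta> M N) h = tensor_act M N (\<Delta> h)"
  by (simp add: tensor_module_def tensor_act_def)

lemma tensor_act_tens:
  assumes M: "\<And>h. pm_linear (act M h)" "\<And>v. pm_linear (\<lambda>h. act M h v)"
    and N: "\<And>h. pm_linear (act N h)" "\<And>v. pm_linear (\<lambda>h. act N h v)"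
  shows "tensor_act M N (tens p q) (tens m n) = tens (act M p m) (act N q n)"
proof -
  note comp = pm_linear_comp[OF pm_linear_tens_left] pm_linear_comp[OF pm_linear_tens_right]
    pm_linear_comp[OF pm_linear_tensor_act(1)] pm_linear_comp[OF pm_linear_tensor_act(2)]
  have 1: "tensor_act M N (tens p q) (tens (single b 1) (single d 1))
      = tens (act M p (single b 1)) (act N q (single d 1))" for b d
  proof (rule pm_bilinear_eqI[where F = "\<lambda>p q. tensor_act M N (tens p q) (tens (single b 1) (single d 1))"
        and G = "\<lambda>p q. tens (act M p (single b 1)) (act N q (single d 1))",
        OF _ _ _ _ _ subset_UNIV subset_UNIV])
    show "pm_linear (\<lambda>p. tensor_act M N (tens p q) (tens (single b 1) (single d 1)))" for q
      by (rule comp(4)[OF pm_linear_tens_left])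
    show "pm_linear (\<lambda>q. tensor_act M N (tens p q) (tens (single b 1) (single d 1)))" for p
      by (rule comp(4)[OF pm_linear_tens_right])
    show "pm_linear (\<lambda>p. tens (act M p (single b 1)) (act N q (single d 1)))" for q
      by (rule comp(1)[OF M(2)])
    show "pm_linear (\<lambda>q. tens (act M p (single b 1)) (act N q (single d 1)))" for p
      by (rule comp(2)[OF N(2)])
    show "tensor_act M N (tens (single u 1) (single v 1)) (tens (single b 1) (single d 1))
      = tens (act M (single u 1) (single b 1)) (act N (single v 1) (single d 1))" for u v
      by (simp add: tensor_act_def bilin_ext_def)
  qed
  show ?thesis
  proof (rule pm_bilinear_eqI[where F = "\<lambda>m n. tensor_act M N (tens p q) (tens m n)"
        and G = "\<lambda>m n. tens (act M p m) (act N q n)", OF _ _ _ _ 1 subset_UNIV subset_UNIV])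
    show "pm_linear (\<lambda>m. tensor_act M N (tens p q) (tens m n))" for n
      by (rule comp(3)[OF pm_linear_tens_left])
    show "pm_linear (\<lambda>n. tensor_act M N (tens p q) (tens m n))" for m
      by (rule comp(3)[OF pm_linear_tens_right])
    show "pm_linear (\<lambda>m. tens (act M p m) (act N q n))" for n
      by (rule comp(1)[OF M(1)])
    show "pm_linear (\<lambda>n. tens (act M p m) (act N q n))" for m
      by (rule comp(2)[OF N(1)])
  qed
qed

lemma hopf_ore_mult_single:
  "single (g, i) c \<otimes>\<^bsub>hopf_ore G \<psi>\<^esub> single (h, j) d = single (g \<otimes>\<^bsub>G\<^esub> h, i + j) (c * d * \<psi> h ^ i)"
  by (simp add: hopf_ore_def bilin_ext_def mult_ac)

locale ore_tensor = M: ore_module G \<psi> M + N: ore_module G \<psi> N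
  for G :: "('g, 'z) monoid_scheme" (structure) and \<psi> :: "'g \<Rightarrow> 'k::field"
    and M :: "('g \<times> nat \<Rightarrow>\<^sub>0 'k, 'b, 'k) based_module"
    and N :: "('g \<times> nat \<Rightarrow>\<^sub>0 'k, 'd, 'k) based_module" +
  fixes a :: 'g
  assumes a_carrier: "a \<in> carrier G" and a_central: "g \<in> carrier G \<Longrightarrow> a \<otimes> g = g \<otimes> a"
begin

abbreviation H where "H \<equiv> hopf_ore G \<psi>"
abbreviation HH where "HH \<equiv> tensor_algebra H H"
abbreviation T where "T \<equiv> tensor_act M N"
abbreviation D where "D \<equiv> tens (ore_x G) (grp a) + tens (grp \<one>) (ore_x G)"
abbreviation P where "P \<equiv> tensor_module (comult G \<psi> a) M N"

lemma T_tens: "T (tens p q) (tens m n) = tens (act M p m) (act N q n)"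
  by (rule tensor_act_tens[OF M.act_linear M.act_linear_left N.act_linear N.act_linear_left])

lemma basis_P: "basis P = basis M \<times> basis N"
  by (simp add: tensor_module_def)

lemma act_P: "act P h = T (comult G \<psi> a h)"
  by (rule act_tensor_module)

lemma carrier_HH: "carrier HH = {z. keys z \<subseteq> (carrier G \<times> UNIV) \<times> (carrier G \<times> UNIV)}"
  by (auto simp: tensor_algebra_def hopf_ore_def)

lemma tens_space:
  assumes "m \<in> space M" "n \<in> space N"
  shows "tens m n \<in> space P"
proof (rule pm_linear_in_subspace[OF pm_linear_tens_left subspace_space])
  show "keys m \<subseteq> basis M" using assms by (simp add: space_def)
  show "tens (single b 1) n \<in> space P" if b: "b \<in> basis M" for b
  proof (rule pm_linear_in_subspace[OF pm_linear_tens_right subspace_space])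
    show "keys n \<subseteq> basis N" using assms by (simp add: space_def)
  qed (use b in \<open>auto simp: space_def basis_P\<close>)
qed

lemma mult_HH_linear:
  "pm_linear (\<lambda>z. z \<otimes>\<^bsub>HH\<^esub> z')" "pm_linear (\<lambda>z'. z \<otimes>\<^bsub>HH\<^esub> z')"
  by (simp_all add: tensor_algebra_def pm_linear_bilin_ext_left pm_linear_bilin_ext_right)

lemma mult_HH_single:
  "single (b, c) 1 \<otimes>\<^bsub>HH\<^esub> single (b', c') 1
    = tens (single b 1 \<otimes>\<^bsub>H\<^esub> single b' 1) (single c 1 \<otimes>\<^bsub>H\<^esub> single c' 1)"
  by (simp add: tensor_algebra_def bilin_ext_def)

lemma mult_HH_closed:
  assumes "z \<in> carrier HH" "z' \<in> carrier HH"
  shows "z \<otimes>\<^bsub>HH\<^esub> z' \<in> carrier HH"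
proof -
  let ?B = "(carrier G \<times> (UNIV :: nat set)) \<times> (carrier G \<times> (UNIV :: nat set))"
  have keys: "keys z \<subseteq> ?B" "keys z' \<subseteq> ?B" using assms by (auto simp: carrier_HH)
  show ?thesis unfolding carrier_HH
  proof (rule pm_linear_in_subspace[OF mult_HH_linear(1) subspace_keys _ keys(1)])
    fix p assume p: "p \<in> ?B"
    show "single p 1 \<otimes>\<^bsub>HH\<^esub> z' \<in> {z. keys z \<subseteq> ?B}"
    proof (rule pm_linear_in_subspace[OF mult_HH_linear(2) subspace_keys _ keys(2)])
      fix q assume "q \<in> ?B"
      with p show "single p 1 \<otimes>\<^bsub>HH\<^esub> single q 1 \<in> {z. keys z \<subseteq> ?B}"
        by (auto simp: mult_HH_single hopf_ore_mult_single split: if_splits)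
    qed
  qed
qed

text \<open>By definition \<open>comult\<close> sends \<open>g x^i\<close> to a product in
  \<open>HH\<close>. This rule turns that product into operators, so \<open>g x^i\<close> acts on
  \<open>P\<close> through powers of \<open>T D\<close>, and compatibility of the comultiplication
  with products is checked as relations between operators on pure tensors.\<close>

lemma T_mult:
  assumes "z \<in> carrier HH" "z' \<in> carrier HH" "w \<in> space P"
  shows "T (z \<otimes>\<^bsub>HH\<^esub> z') w = T z (T z' w)"
proof -
  let ?B = "(carrier G \<times> (UNIV :: nat set)) \<times> (carrier G \<times> (UNIV :: nat set))"
  have keys: "keys z \<subseteq> ?B" "keys z' \<subseteq> ?B" "keys w \<subseteq> basis M \<times> basis N"
    using assms by (auto simp: carrier_HH space_def basis_P)
  have mult: "act M (h \<otimes>\<^bsub>H\<^esub> h') v = act M h (act M h' v)"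
    "act N (h \<otimes>\<^bsub>H\<^esub> h') v' = act N h (act N h' v')"
    if "h \<in> carrier H" "h' \<in> carrier H" "v \<in> space M" "v' \<in> space N" for h h' v v'
    using that M.left_module N.left_module unfolding left_module_def by blast+
  show ?thesis
  proof (rule pm_linear_eqI[OF pm_linear_tensor_act(1) pm_linear_comp[OF pm_linear_tensor_act(1) pm_linear_tensor_act(1)] _ keys(3)])
    fix y assume "y \<in> basis M \<times> basis N"
    then obtain d e where y: "y = (d, e)" "d \<in> basis M" "e \<in> basis N" by auto
    show "T (z \<otimes>\<^bsub>HH\<^esub> z') (single y 1) = T z (T z' (single y 1))"
    proof (rule pm_bilinear_eqI[OF _ _ _ _ _ keys(1,2)])
      show "pm_linear (\<lambda>z. T (z \<otimes>\<^bsub>HH\<^esub> z') (single y 1))" for z'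
        by (rule pm_linear_comp[OF pm_linear_tensor_act(2) mult_HH_linear(1)])
      show "pm_linear (\<lambda>z'. T (z \<otimes>\<^bsub>HH\<^esub> z') (single y 1))" for z
        by (rule pm_linear_comp[OF pm_linear_tensor_act(2) mult_HH_linear(2)])
      show "pm_linear (\<lambda>z. T z (T z' (single y 1)))" for z'
        by (rule pm_linear_tensor_act(2))
      show "pm_linear (\<lambda>z'. T z (T z' (single y 1)))" for z
        by (rule pm_linear_comp[OF pm_linear_tensor_act])
    next
      fix p q assume "p \<in> ?B" "q \<in> ?B"
      then obtain b c b' c' where pq: "p = (b, c)" "q = (b', c')" and
        carr: "single b 1 \<in> carrier H" "single c 1 \<in> carrier H" "single b' 1 \<in> carrier H" "single c' 1 \<in> carrier H"
        by (auto simp: hopf_ore_def)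
      have y': "single y 1 = tens (single d 1) (single e 1)" using y by simp
      have z': "single p 1 = tens (single b 1) (single c 1)" "single q 1 = tens (single b' 1) (single c' 1)"
        using pq by simp_all
      have "T (single p 1 \<otimes>\<^bsub>HH\<^esub> single q 1) (single y 1)
          = tens (act M (single b 1 \<otimes>\<^bsub>H\<^esub> single b' 1) (single d 1))
              (act N (single c 1 \<otimes>\<^bsub>H\<^esub> single c' 1) (single e 1))"
        unfolding pq mult_HH_single y' T_tens ..
      also have "\<dots> = T (single p 1) (T (single q 1) (single y 1))"
        unfolding z' y' T_tens
        by (simp only: mult(1)[OF carr(1,3) single_in_space[OF y(2)] single_in_space[OF y(3)]]
            mult(2)[OF carr(2,4) single_in_space[OF y(2)] single_in_space[OF y(3)]])
      finally show "T (single p 1 \<otimes>\<^bsub>HH\<^esub> single q 1) (single y 1) = T (single p 1) (T (single q 1) (single y 1))" .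
    qed
  qed
qed

lemma one_HH: "\<one>\<^bsub>HH\<^esub> = tens (grp \<one>) (grp \<one>)"
  by (simp add: tensor_algebra_def hopf_ore_def grp_def)

lemma D_carrier [simp]: "D \<in> carrier HH"
  unfolding carrier_HH
  by (intro pm.subspace_add[OF subspace_keys]) (auto simp: ore_x_def grp_def a_carrier)

lemma grp_carrier [simp]: "g \<in> carrier G \<Longrightarrow> tens (grp g) (grp g) \<in> carrier HH"
  by (auto simp: carrier_HH grp_def)

lemma D_pow_carrier [simp]: "D [^]\<^bsub>HH\<^esub> (i :: nat) \<in> carrier HH"
  by (induction i) (auto simp: nat_pow_def one_HH mult_HH_closed)

lemma P_eqI:
  assumes "pm_linear F" "pm_linear F'" "w \<in> space P"
    and "\<And>m n. m \<in> space M \<Longrightarrow> n \<in> space N \<Longrightarrow> F (tens m n) = F' (tens m n)"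
  shows "F w = F' w"
proof (rule pm_linear_eqI[OF assms(1,2)])
  show "keys w \<subseteq> basis M \<times> basis N" using assms(3) by (simp add: space_def basis_P)
  fix b assume "b \<in> basis M \<times> basis N"
  then obtain d e where "b = (d, e)" "single d 1 \<in> space M" "single e 1 \<in> space N" by auto
  then show "F (single b 1) = F' (single b 1)"
    using assms(4)[of "single d 1" "single e 1"] by simp
qed

lemma P_spaceI:
  assumes "pm_linear F" "w \<in> space P"
    and "\<And>m n. m \<in> space M \<Longrightarrow> n \<in> space N \<Longrightarrow> F (tens m n) \<in> space P"
  shows "F w \<in> space P"
proof (rule pm_linear_in_subspace[OF assms(1) subspace_space])
  show "keys w \<subseteq> basis M \<times> basis N" using assms(2) by (simp add: space_def basis_P)
  fix b assume "b \<in> basis M \<times> basis N"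
  then obtain d e where "b = (d, e)" "single d 1 \<in> space M" "single e 1 \<in> space N" by auto
  then show "F (single b 1) \<in> space P"
    using assms(3)[of "single d 1" "single e 1"] by simp
qed

lemma T_one: "w \<in> space P \<Longrightarrow> T (tens (grp \<one>) (grp \<one>)) w = w"
  by (rule P_eqI[OF pm_linear_tensor_act(1) pm.linear_ident]) (simp_all add: T_tens)

lemma T_D_tens: "m \<in> space M \<Longrightarrow> T D (tens m n) = tens (M.X m) (act N (grp a) n) + tens m (N.X n)"
  using pm_linear_add[OF pm_linear_tensor_act(2)[of M N], of "tens (ore_x G) (grp a)"] by (simp add: T_tens)

lemma T_D_space: "w \<in> space P \<Longrightarrow> T D w \<in> space P"
  by (erule P_spaceI[OF pm_linear_tensor_act(1)])
    (simp add: T_D_tens a_carrier tens_space pm.subspace_add[OF subspace_space])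

lemma T_D_pow:
  "w \<in> space P \<Longrightarrow> T (D [^]\<^bsub>HH\<^esub> (i :: nat)) w = (T D ^^ i) w"
proof (induction i arbitrary: w)
  case 0
  then show ?case by (simp add: nat_pow_def one_HH T_one)
next
  case (Suc i)
  have "T (D [^]\<^bsub>HH\<^esub> Suc i) w = T (D [^]\<^bsub>HH\<^esub> i) (T D w)"
    using T_mult[OF D_pow_carrier D_carrier Suc.prems, of i] by (simp add: nat_pow_def)
  then show ?case
    using Suc by (simp add: T_D_space funpow_swap1)
qed

lemma act_P_single:
  assumes "g \<in> carrier G" "w \<in> space P"
  shows "act P (single (g, i) 1) w = T (tens (grp g) (grp g)) ((T D ^^ i) w)"
proof -
  have "act P (single (g, i) 1) w = T (tens (grp g) (grp g) \<otimes>\<^bsub>HH\<^esub> D [^]\<^bsub>HH\<^esub> i) w"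
    unfolding act_P by (simp add: comult_def Let_def)
  also have "\<dots> = T (tens (grp g) (grp g)) ((T D ^^ i) w)"
    using assms by (simp add: T_mult T_D_pow)
  finally show ?thesis .
qed

lemma act_P_grp: "g \<in> carrier G \<Longrightarrow> w \<in> space P \<Longrightarrow> act P (grp g) w = T (tens (grp g) (grp g)) w"
  using act_P_single[of g w 0] by (simp add: grp_def)

lemma act_P_x: "w \<in> space P \<Longrightarrow> act P (ore_x G) w = T D w"
  using act_P_single[of \<one> w 1] T_one[OF T_D_space, of w] by (simp add: ore_x_def)

lemma act_P_grp_tens:
  "g \<in> carrier G \<Longrightarrow> m \<in> space M \<Longrightarrow> n \<in> space N \<Longrightarrow>
    act P (grp g) (tens m n) = tens (act M (grp g) m) (act N (grp g) n)"
  by (simp add: act_P_grp tens_space T_tens)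

lemma act_P_x_tens:
  "m \<in> space M \<Longrightarrow> n \<in> space N \<Longrightarrow>
    act P (ore_x G) (tens m n) = tens (M.X m) (act N (grp a) n) + tens m (N.X n)"
  by (simp add: act_P_x tens_space T_D_tens)

lemma ore_module_P: "ore_module G \<psi> P"
proof (intro ore_module.intro ore_module_axioms.intro)
  show "group G" by (rule M.is_group)
  show lin: "pm_linear (act P h)" for h
    by (simp add: act_P)
  show "pm_linear (\<lambda>h. act P h v)" for v
    unfolding act_P by (rule pm_linear_comp[OF pm_linear_tensor_act(2)]) (simp add: comult_def Let_def)
  show "ore_relations_at G \<psi> P (single b 1)" if "b \<in> basis P" for b
  proof -
    define m n where "m = single (fst b) (1::'k)" and "n = single (snd b) (1::'k)"
    have b: "single b 1 = tens m n" and mn: "m \<in> space M" "n \<in> space N"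
      using that by (auto simp: m_def n_def basis_P)
    have pow: "(act P (ore_x G) ^^ i) (tens m n) = (T D ^^ i) (tens m n)
        \<and> (T D ^^ i) (tens m n) \<in> space P" for i
      by (induction i) (auto simp: tens_space mn act_P_x T_D_space)
    show ?thesis
      unfolding ore_relations_at_def b
    proof (intro conjI ballI allI)
      fix g h assume g: "g \<in> carrier G" and h: "h \<in> carrier G"
      show "act P (grp g) (tens m n) \<in> space P"
        using g mn by (simp add: act_P_grp_tens tens_space)
      show "act P (single (g, i) 1) (tens m n) = act P (grp g) ((act P (ore_x G) ^^ i) (tens m n))" for i
        using g mn pow[of i] by (simp add: act_P_single act_P_grp tens_space)
      show "act P (grp (g \<otimes> h)) (tens m n) = act P (grp g) (act P (grp h) (tens m n))"
        using g h mn by (simp add: act_P_grp_tens M.grp_mult N.grp_mult)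
      \<comment> \<open>Centrality of \<open>a\<close> lets \<open>g\<close> pass the second factor
        of \<open>x \<otimes> a\<close>; the first factor contributes
        \<open>\<psi> g\<close>.\<close>
      have "act N (grp a) (act N (grp g) n) = act N (grp g) (act N (grp a) n)"
        using g mn a_carrier a_central[OF g] by (simp flip: N.grp_mult)
      then show "act P (ore_x G) (act P (grp g) (tens m n)) = scale (\<psi> g) (act P (grp g) (act P (ore_x G) (tens m n)))"
        using g mn a_carrier by (simp add: act_P_grp_tens act_P_x_tens M.X_grp N.X_grp
            pm_linear_add[OF lin] tens_scale_left tens_scale_right pm.scale_right_distrib)
    qed (use mn in \<open>simp_all add: act_P_x T_D_space tens_space act_P_grp_tens\<close>)
  qed
qed

end

section \<open>Characters and the modules $V_t(\lambda)$ and $V_n(\lambda, \beta)$\<close>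

lemma character_mult:
  "\<mu> \<in> carrier (character_group G) \<Longrightarrow> g \<in> carrier G \<Longrightarrow> h \<in> carrier G \<Longrightarrow>
    \<mu> (g \<otimes>\<^bsub>G\<^esub> h) = \<mu> g * \<mu> h"
  by (auto simp: character_group_def mult_group_of_field_def hom_def)

lemma character_nonzero:
  "\<mu> \<in> carrier (character_group G) \<Longrightarrow> g \<in> carrier G \<Longrightarrow> \<mu> g \<noteq> 0"
  by (auto simp: character_group_def mult_group_of_field_def hom_def)

lemma character_one:
  fixes G :: "('g, 'z) monoid_scheme" (structure)
  assumes "group G" "\<mu> \<in> carrier (character_group G)"
  shows "\<mu> \<one>\<^bsub>G\<^esub> = 1"
proof -
  interpret group G by fact
  show ?thesis
    using character_mult[OF assms(2), of \<one> \<one>] character_nonzero[OF assms(2), of \<one>] by simp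
qed

lemma character_groupI:
  assumes "\<mu> \<in> extensional (carrier G)" "\<And>g. g \<in> carrier G \<Longrightarrow> \<mu> g \<noteq> 0"
    and "\<And>g h. g \<in> carrier G \<Longrightarrow> h \<in> carrier G \<Longrightarrow> \<mu> (g \<otimes>\<^bsub>G\<^esub> h) = \<mu> g * \<mu> h"
  shows "\<mu> \<in> carrier (character_group G)"
  using assms by (auto simp: character_group_def mult_group_of_field_def hom_def)

lemma character_group_mult_apply:
  "g \<in> carrier G \<Longrightarrow> (\<chi> \<otimes>\<^bsub>character_group G\<^esub> \<mu>) g = \<chi> g * \<mu> g"
  by (simp add: character_group_def)

lemma character_group_one_apply:
  "g \<in> carrier G \<Longrightarrow> \<one>\<^bsub>character_group G\<^esub> g = 1"
  by (simp add: character_group_def)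

lemma character_eqI:
  assumes "\<chi> \<in> carrier (character_group G)" "\<mu> \<in> carrier (character_group G)"
    and "\<And>g. g \<in> carrier G \<Longrightarrow> \<chi> g = \<mu> g"
  shows "\<chi> = \<mu>"
  using assms by (intro extensionalityI[of _ "carrier G"]) (auto simp: character_group_def)

text \<open>This gives \<open>inv\<close> and \<open>ord\<close> their meaning for characters;
  extensionality reduces each group axiom to a pointwise identity.\<close>

lemma group_character_group:
  assumes "group G"
  shows "group (character_group G)"
proof (rule groupI)
  interpret group G by fact
  let ?C = "character_group G :: ('a \<Rightarrow> 'c) monoid"
  show closed: "\<chi> \<otimes>\<^bsub>?C\<^esub> \<mu> \<in> carrier ?C" if "\<chi> \<in> carrier ?C" "\<mu> \<in> carrier ?C" for \<chi> \<mu>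
    using that by (intro character_groupI)
      (auto simp: character_group_mult_apply character_mult character_nonzero, simp add: character_group_def)
  show one: "\<one>\<^bsub>?C\<^esub> \<in> carrier ?C"
    by (intro character_groupI) (auto simp: character_group_one_apply, simp add: character_group_def)
  show "\<chi> \<otimes>\<^bsub>?C\<^esub> \<mu> \<otimes>\<^bsub>?C\<^esub> \<nu> = \<chi> \<otimes>\<^bsub>?C\<^esub> (\<mu> \<otimes>\<^bsub>?C\<^esub> \<nu>)"
    if "\<chi> \<in> carrier ?C" "\<mu> \<in> carrier ?C" "\<nu> \<in> carrier ?C" for \<chi> \<mu> \<nu>
    using that by (intro character_eqI[of _ G]) (auto simp: character_group_mult_apply closed)
  show "\<one>\<^bsub>?C\<^esub> \<otimes>\<^bsub>?C\<^esub> \<chi> = \<chi>" if "\<chi> \<in> carrier ?C" for \<chi>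
    using that by (intro character_eqI[of _ G]) (auto simp: character_group_mult_apply character_group_one_apply closed one)
  show "\<exists>\<mu>\<in>carrier ?C. \<mu> \<otimes>\<^bsub>?C\<^esub> \<chi> = \<one>\<^bsub>?C\<^esub>" if \<chi>: "\<chi> \<in> carrier ?C" for \<chi>
  proof -
    let ?\<mu> = "\<lambda>g\<in>carrier G. inverse (\<chi> g)"
    have \<mu>: "?\<mu> \<in> carrier ?C"
      by (intro character_groupI) (auto simp: character_mult[OF \<chi>] character_nonzero[OF \<chi>])
    have "?\<mu> \<otimes>\<^bsub>?C\<^esub> \<chi> = \<one>\<^bsub>?C\<^esub>"
      using \<chi> \<mu> by (intro character_eqI[of _ G])
        (auto simp: character_group_mult_apply character_group_one_apply closed one character_nonzero)
    with \<mu> show ?thesis by blast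
  qed
qed

lemma character_group_pow_apply:
  "g \<in> carrier G \<Longrightarrow> (\<chi> [^]\<^bsub>character_group G\<^esub> (n :: nat)) g = \<chi> g ^ n"
  by (induction n) (auto simp: nat_pow_def character_group_one_apply character_group_mult_apply mult.commute)

lemma inv_character_apply:
  assumes "group G" "\<chi> \<in> carrier (character_group G)" "g \<in> carrier G"
  shows "(inv\<^bsub>character_group G\<^esub> \<chi>) g * \<chi> g = 1"
  using group.l_inv[OF group_character_group[OF assms(1)] assms(2)] assms(3)
  by (metis character_group_mult_apply character_group_one_apply)

text \<open>The order of \<open>\<chi>\<close> in pointwise form: multiples of \<open>s\<close> may
  be dropped from exponents of \<open>\<chi> g\<close>, and therefore \<open>x^s\<close> commutes
  with the group.\<close>

locale ore_weights = group G for G :: "('g, 'z) monoid_scheme" (structure) +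
  fixes \<chi> \<psi> :: "'g \<Rightarrow> 'k::field" and s :: nat
  assumes \<chi>: "\<chi> \<in> carrier (character_group G)"
    and \<psi>_\<chi>: "g \<in> carrier G \<Longrightarrow> \<psi> g * \<chi> g = 1"
    and \<chi>_pow: "g \<in> carrier G \<Longrightarrow> \<chi> g ^ s = 1"
    and s_pos: "s > 0"
begin

lemma \<chi>_nonzero [simp]: "g \<in> carrier G \<Longrightarrow> \<chi> g \<noteq> 0"
  using character_nonzero[OF \<chi>] .

lemma \<chi>_pow_mult [simp]: "g \<in> carrier G \<Longrightarrow> \<chi> g ^ (j * s) = 1" "g \<in> carrier G \<Longrightarrow> \<chi> g ^ (s * j) = 1"
  using \<chi>_pow power_mult[of "\<chi> g" s j] by (simp_all add: mult.commute)

lemma \<psi>_\<chi>_Suc: "g \<in> carrier G \<Longrightarrow> \<psi> g * (\<chi> g * c) = c"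
  using \<psi>_\<chi>[of g] by (simp flip: mult.assoc)

lemma V_nilp:
  assumes \<mu>: "\<mu> \<in> carrier (character_group G)"
  shows "ore_module G \<psi> (V_nilp \<chi> n \<mu>)"
    and "g \<in> carrier G \<Longrightarrow> act (V_nilp \<chi> n \<mu>) (grp g) (single i c) = single i (\<chi> g ^ i * \<mu> g * c)"
    and "i < n \<Longrightarrow> act (V_nilp \<chi> n \<mu>) (ore_x G) (single i c) = (if i + 1 < n then single (i + 1) c else 0)"
proof -
  let ?\<rho> = "\<lambda>g. lin_ext (\<lambda>i. single i (\<chi> g ^ i * \<mu> g)) :: (nat \<Rightarrow>\<^sub>0 'k) \<Rightarrow> _"
  let ?X = "lin_ext (\<lambda>i. if i + 1 < n then single (i + 1) 1 else 0) :: (nat \<Rightarrow>\<^sub>0 'k) \<Rightarrow> _"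
  let ?M = "V_nilp \<chi> n \<mu>"
  have space: "g \<in> carrier G \<Longrightarrow> b \<in> basis ?M \<Longrightarrow> ?\<rho> g (single b 1) \<in> space ?M"
    "b \<in> basis ?M \<Longrightarrow> ?X (single b 1) \<in> space ?M" for g b
    by (auto simp: V_nilp_def space_def)
  have one: "?\<rho> \<one> (single b 1) = single b 1" for b
    using character_one[OF is_group \<chi>] character_one[OF is_group \<mu>] by simp
  have mult: "?\<rho> (g \<otimes> h) (single b 1) = ?\<rho> g (?\<rho> h (single b 1))"
    if "g \<in> carrier G" "h \<in> carrier G" for g h b
    using that character_mult[OF \<chi>, of g h] character_mult[OF \<mu>, of g h] by (simp add: power_mult_distrib mult_ac)
  have comm: "?X (?\<rho> g (single b 1)) = scale (\<psi> g) (?\<rho> g (?X (single b 1)))" if "g \<in> carrier G" for g b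
    using that by (auto simp: \<psi>_\<chi>_Suc mult.assoc)
  have act: "act ?M = action_from_generators ?\<rho> ?X" by (simp add: V_nilp_def)
  note gen = ore_module_from_generators[OF is_group act pm_linear_lin_ext pm_linear_lin_ext space one mult comm]
  show "ore_module G \<psi> ?M" by (rule gen(1))
  show "g \<in> carrier G \<Longrightarrow> act ?M (grp g) (single i c) = single i (\<chi> g ^ i * \<mu> g * c)"
    by (simp add: gen(2) mult_ac)
  show "i < n \<Longrightarrow> act ?M (ore_x G) (single i c) = (if i + 1 < n then single (i + 1) c else 0)"
    by (subst gen(3)) (auto simp: V_nilp_def)
qed

abbreviation block_coeff :: "nat \<Rightarrow> 'k \<Rightarrow> nat \<Rightarrow> 'k"
  where "block_coeff n \<beta> \<equiv> Polynomial.coeff (Polynomial.monom 1 n - [:- \<beta>, 1:] ^ n)"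

lemma V_block:
  assumes \<mu>: "\<mu> \<in> carrier (character_group G)"
  shows "ore_module G \<psi> (V_block \<chi> s n \<mu> \<beta>)"
    and "g \<in> carrier G \<Longrightarrow> act (V_block \<chi> s n \<mu> \<beta>) (grp g) (single i c) = single i (\<chi> g ^ i * \<mu> g * c)"
    and "i < n * s \<Longrightarrow> act (V_block \<chi> s n \<mu> \<beta>) (ore_x G) (single i 1)
      = (if i + 1 < n * s then single (i + 1) 1 else \<Sum>j<n. single (j * s) (block_coeff n \<beta> j))"
proof -
  let ?S = "\<Sum>j<n. single (j * s) (block_coeff n \<beta> j) :: nat \<Rightarrow>\<^sub>0 'k"
  let ?\<rho> = "\<lambda>g. lin_ext (\<lambda>i. single i (\<chi> g ^ i * \<mu> g)) :: (nat \<Rightarrow>\<^sub>0 'k) \<Rightarrow> _"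
  let ?X = "lin_ext (\<lambda>i. if i + 1 < n * s then single (i + 1) 1 else ?S) :: (nat \<Rightarrow>\<^sub>0 'k) \<Rightarrow> _"
  let ?M = "V_block \<chi> s n \<mu> \<beta>"
  have "single (j * s) (block_coeff n \<beta> j) \<in> space ?M" if "j < n" for j
    using that s_pos by (intro single_in_space) (simp add: V_block_def)
  then have "?S \<in> space ?M"
    by (intro pm.subspace_sum[OF subspace_space]) auto
  then have space: "g \<in> carrier G \<Longrightarrow> b \<in> basis ?M \<Longrightarrow> ?\<rho> g (single b 1) \<in> space ?M"
    "b \<in> basis ?M \<Longrightarrow> ?X (single b 1) \<in> space ?M" for g b
    by (auto simp: V_block_def Let_def space_def)
  have one: "?\<rho> \<one> (single b 1) = single b 1" for b
    using character_one[OF is_group \<chi>] character_one[OF is_group \<mu>] by simp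
  have mult: "?\<rho> (g \<otimes> h) (single b 1) = ?\<rho> g (?\<rho> h (single b 1))"
    if "g \<in> carrier G" "h \<in> carrier G" for g h b
    using that character_mult[OF \<chi>, of g h] character_mult[OF \<mu>, of g h] by (simp add: power_mult_distrib mult_ac)
  have comm: "?X (?\<rho> g (single b 1)) = scale (\<psi> g) (?\<rho> g (?X (single b 1)))"
    if g: "g \<in> carrier G" and "b \<in> basis ?M" for g b
  proof (cases "b + 1 < n * s")
    case True
    then show ?thesis using g by (auto simp: \<psi>_\<chi>_Suc mult.assoc)
  next
    case False
    with that have b: "n * s = Suc b" by (simp add: V_block_def Let_def)
    \<comment> \<open>The vectors \<open>m_{js}\<close> occurring in \<open>?S\<close> all have
      weight \<open>\<mu>\<close>, since \<open>\<chi>(g)^s = 1\<close>. The last basis vector has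
      weight \<open>\<chi>(g)^(ns - 1) \<mu>(g) = \<psi>(g) \<mu>(g)\<close>, which is what the
      commutation rule asks for where x wraps around.\<close>
    have "?\<rho> g ?S = scale (\<mu> g) ?S"
      using g by (simp add: pm_linear_sum[OF pm_linear_lin_ext] pm.scale_sum_right mult.commute)
    moreover have "\<psi> g = \<chi> g ^ b"
    proof -
      have "\<chi> g ^ Suc b = 1" using \<chi>_pow_mult(1)[OF g, of n] by (simp only: b)
      then show ?thesis using \<psi>_\<chi>_Suc[OF g, of "\<chi> g ^ b"] by simp
    qed
    ultimately show ?thesis using False by simp
  qed
  have act: "act ?M = action_from_generators ?\<rho> ?X" by (simp add: V_block_def Let_def)
  note gen = ore_module_from_generators[OF is_group act pm_linear_lin_ext pm_linear_lin_ext space one mult comm]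
  show "ore_module G \<psi> ?M" by (rule gen(1))
  show "g \<in> carrier G \<Longrightarrow> act ?M (grp g) (single i c) = single i (\<chi> g ^ i * \<mu> g * c)"
    by (simp add: gen(2) mult_ac)
  show "i < n * s \<Longrightarrow> act ?M (ore_x G) (single i 1)
      = (if i + 1 < n * s then single (i + 1) 1 else ?S)"
    by (subst gen(3)) (auto simp: V_block_def Let_def)
qed

lemma basis_V_nilp [simp]: "basis (V_nilp \<chi> n \<mu>) = {..<n}"
  by (simp add: V_nilp_def)

lemma basis_V_block [simp]: "basis (V_block \<chi> s n \<mu> \<beta>) = {..<n * s}"
  by (simp add: V_block_def Let_def)

end

section \<open>Powers of $x$ and of $x^s - \gamma$\<close>

text \<open>The Gaussian binomial coefficient, defined by its q-Pascal rule because the denominators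
  of the quotient formula may vanish at roots of unity.\<close>

fun gauss_binomial :: "'k::comm_ring_1 \<Rightarrow> nat \<Rightarrow> nat \<Rightarrow> 'k"
  where
    "gauss_binomial q n 0 = 1"
  | "gauss_binomial q 0 (Suc m) = 0"
  | "gauss_binomial q (Suc n) (Suc m) = gauss_binomial q n m + q ^ Suc m * gauss_binomial q n (Suc m)"

lemma gauss_binomial_eq_0 [simp]: "m > n \<Longrightarrow> gauss_binomial q n m = 0"
  by (induction q n m rule: gauss_binomial.induct) auto

lemma gauss_binomial_self [simp]: "gauss_binomial q n n = 1"
  by (induction n) auto

text \<open>The quotient of neighbouring Gaussian binomials, multiplied out so that it holds in
  every commutative ring.\<close>

lemma gauss_binomial_ratio:
  "m \<le> n \<Longrightarrow> (1 - q ^ Suc m) * gauss_binomial q n (Suc m) = (1 - q ^ (n - m)) * gauss_binomial q n m"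
proof (induction n arbitrary: m)
  case 0
  then show ?case by simp
next
  case (Suc n)
  show ?case
  proof (cases "m = Suc n")
    case True
    then show ?thesis by simp
  next
    case False
    with Suc.prems have m: "m \<le> n" by simp
    let ?c = "gauss_binomial q n"
    have q: "q ^ Suc m * q ^ (n - m) = q ^ Suc n"
      using m by (simp only: power_add[symmetric]) simp
    have "(1 - q ^ Suc m) * gauss_binomial q (Suc n) (Suc m)
        = (1 - q ^ Suc m) * ?c m + q ^ Suc m * ((1 - q ^ Suc m) * ?c (Suc m))"
      by (simp add: algebra_simps)
    also have "\<dots> = (1 - q ^ Suc m) * ?c m + (q ^ Suc m - q ^ Suc m * q ^ (n - m)) * ?c m"
      by (simp only: Suc.IH[OF m]) (simp add: algebra_simps)
    also have "\<dots> = (1 - q ^ Suc n) * ?c m"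
      unfolding q by (simp add: algebra_simps)
    also have "\<dots> = (1 - q ^ (Suc n - m)) * gauss_binomial q (Suc n) m"
    proof (cases m)
      case 0
      then show ?thesis by simp
    next
      case (Suc k)
      have "k \<le> n" using m Suc by simp
      then have k: "q ^ Suc k * q ^ (n - k) = q ^ Suc n"
        by (simp only: power_add[symmetric]) simp
      have "(1 - q ^ (n - k)) * gauss_binomial q (Suc n) (Suc k)
          = (1 - q ^ (n - k)) * ?c k + (q ^ Suc k - q ^ Suc k * q ^ (n - k)) * ?c (Suc k)"
        by (simp add: algebra_simps)
      also have "\<dots> = (1 - q ^ Suc k) * ?c (Suc k) + (q ^ Suc k - q ^ Suc n) * ?c (Suc k)"
        by (simp only: Suc.IH[OF \<open>k \<le> n\<close>] k)
      also have "\<dots> = (1 - q ^ Suc n) * ?c (Suc k)"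
        by (simp add: algebra_simps)
      finally show ?thesis by (simp add: Suc)
    qed
    finally show ?thesis .
  qed
qed

text \<open>The q-Pascal rule and the ratio for \<open>s - 1\<close> give
  \<open>(1 - q^m) [s, m] = (1 - q^s) [s - 1, m - 1] = 0\<close>, and \<open>q^m\<close> differs
  from 1 for \<open>0 < m < s\<close>.\<close>

lemma gauss_binomial_root_of_unity:
  fixes q :: "'k::field"
  assumes "primitive_root_of_unity s q" "0 < m" "m < s"
  shows "gauss_binomial q s m = 0"
proof -
  have q: "q ^ s = 1" "\<And>j. 0 < j \<Longrightarrow> j < s \<Longrightarrow> q ^ j \<noteq> 1"
    using assms(1) by (auto simp: primitive_root_of_unity_def)
  obtain n k where nk: "s = Suc n" "m = Suc k" using assms by (metis gr0_conv_Suc less_trans)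
  have "k \<le> n" using assms nk by simp
  then have ratio: "(1 - q ^ Suc k) * gauss_binomial q n (Suc k) = (1 - q ^ (n - k)) * gauss_binomial q n k"
    by (rule gauss_binomial_ratio)
  have inv: "q ^ Suc k * q ^ (n - k) = 1"
  proof -
    have "Suc k + (n - k) = s" using \<open>k \<le> n\<close> nk by simp
    then show ?thesis using q(1) by (metis power_add)
  qed
  have "(1 - q ^ Suc k) * gauss_binomial q s m
      = (1 - q ^ Suc k) * gauss_binomial q n k + q ^ Suc k * ((1 - q ^ Suc k) * gauss_binomial q n (Suc k))"
    unfolding nk by (simp add: algebra_simps)
  also have "\<dots> = (1 - q ^ Suc k) * gauss_binomial q n k
      + (q ^ Suc k - q ^ Suc k * q ^ (n - k)) * gauss_binomial q n k"
    unfolding ratio by (simp add: algebra_simps)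
  also have "\<dots> = 0" unfolding inv by (simp add: algebra_simps)
  finally show ?thesis using q(2)[of m] assms nk by simp
qed

text \<open>The q-binomial theorem for \<open>X = P + Q\<close> with
  \<open>P (e i j) = e (i + 1) j\<close> and \<open>Q (e i j) = \<omega>^i e i (j + 1)\<close>, so
  that \<open>Q P = \<omega> P Q\<close>. The extra power of \<open>\<omega>\<close> comes from
  starting at a general \<open>i\<close>.\<close>

lemma gauss_binomial_theorem:
  fixes e :: "nat \<Rightarrow> nat \<Rightarrow> ('b \<Rightarrow>\<^sub>0 'k::field)"
  assumes lin: "pm_linear X" and X: "\<And>i j. X (e i j) = e (Suc i) j + scale (\<omega> ^ i) (e i (Suc j))"
  shows "(X ^^ n) (e i j)
    = (\<Sum>m\<le>n. scale (gauss_binomial \<omega> n m * \<omega> ^ (i * (n - m))) (e (i + m) (j + (n - m))))"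
proof (induction n)
  case 0
  show ?case by simp
next
  case (Suc n)
  let ?c = "\<lambda>n m. gauss_binomial \<omega> n m * \<omega> ^ (i * (n - m))"
  have "(X ^^ Suc n) (e i j) = (\<Sum>m\<le>n. scale (?c n m) (e (Suc (i + m)) (j + (n - m))
      + scale (\<omega> ^ (i + m)) (e (i + m) (Suc (j + (n - m))))))"
    by (simp add: Suc.IH pm_linear_sum[OF lin] pm_linear_scale[OF lin] X)
  also have "\<dots> = (\<Sum>m\<le>n. scale (?c n m) (e (i + Suc m) (j + (Suc n - Suc m))))
      + (\<Sum>m\<le>n. scale (\<omega> ^ m * gauss_binomial \<omega> n m * \<omega> ^ (i * (Suc n - m))) (e (i + m) (j + (Suc n - m))))"
    unfolding pm.scale_right_distrib sum.distrib
    by (intro arg_cong2[where f = "(+)"] sum.cong) (simp_all add: Suc_diff_le power_add mult_ac)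
  also have "(\<Sum>m\<le>n. scale (\<omega> ^ m * gauss_binomial \<omega> n m * \<omega> ^ (i * (Suc n - m))) (e (i + m) (j + (Suc n - m))))
      = (\<Sum>m\<le>Suc n. scale (\<omega> ^ m * gauss_binomial \<omega> n m * \<omega> ^ (i * (Suc n - m))) (e (i + m) (j + (Suc n - m))))"
    by simp
  also have "\<dots> = scale (\<omega> ^ (i * Suc n)) (e i (j + Suc n))
      + (\<Sum>m\<le>n. scale (\<omega> ^ Suc m * gauss_binomial \<omega> n (Suc m) * \<omega> ^ (i * (Suc n - Suc m)))
          (e (i + Suc m) (j + (Suc n - Suc m))))"
    by (subst sum.atMost_Suc_shift) simp
  also have "(\<Sum>m\<le>n. scale (?c n m) (e (i + Suc m) (j + (Suc n - Suc m)))) + \<dots>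
      = scale (\<omega> ^ (i * Suc n)) (e i (j + Suc n))
      + (\<Sum>m\<le>n. scale (?c (Suc n) (Suc m)) (e (i + Suc m) (j + (Suc n - Suc m))))"
    by (simp add: sum.distrib[symmetric] pm.scale_left_distrib[symmetric] distrib_right add.left_commute)
  also have "\<dots> = (\<Sum>m\<le>Suc n. scale (?c (Suc n) m) (e (i + m) (j + (Suc n - m))))"
    by (subst sum.atMost_Suc_shift) simp
  finally show ?case .
qed

lemma gauss_binomial_theorem_root_of_unity:
  fixes e :: "nat \<Rightarrow> nat \<Rightarrow> ('b \<Rightarrow>\<^sub>0 'k::field)"
  assumes lin: "pm_linear X" and X: "\<And>i j. X (e i j) = e (Suc i) j + scale (\<omega> ^ i) (e i (Suc j))"
    and \<omega>: "primitive_root_of_unity s \<omega>"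
  shows "(X ^^ s) (e i j) = e (i + s) j + e i (j + s)"
proof -
  have s: "s > 0" "\<omega> ^ s = 1" using \<omega> by (auto simp: primitive_root_of_unity_def)
  have "(X ^^ s) (e i j)
    = (\<Sum>m\<in>{0, s}. scale (gauss_binomial \<omega> s m * \<omega> ^ (i * (s - m))) (e (i + m) (j + (s - m))))"
    unfolding gauss_binomial_theorem[where e = e and \<omega> = \<omega>, OF lin X]
    by (rule sum.mono_neutral_right) (use gauss_binomial_root_of_unity[OF \<omega>] in auto)
  also have "\<dots> = e (i + s) j + e i (j + s)"
    using s by (simp add: power_mult mult.commute[of i])
  finally show ?thesis .
qed

text \<open>The operator \<open>y - \<gamma>\<close>, where y is \<open>x^s\<close> on one tensor
  factor. It is made to act on sequences of vectors because y on one factor is known only as a shift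
  by \<open>s\<close> along such a sequence.\<close>

definition shift_diff :: "nat \<Rightarrow> 'k::field \<Rightarrow> (nat \<Rightarrow> ('b \<Rightarrow>\<^sub>0 'k)) \<Rightarrow> (nat \<Rightarrow> ('b \<Rightarrow>\<^sub>0 'k))"
  where "shift_diff s \<gamma> h = (\<lambda>j. h (j + s) - scale \<gamma> (h j))"

lemma funpow_shift_diff_Suc:
  "(shift_diff s \<gamma> ^^ Suc n) h j = (shift_diff s \<gamma> ^^ n) h (j + s) - scale \<gamma> ((shift_diff s \<gamma> ^^ n) h j)"
  by (simp add: shift_diff_def)

lemma shift_diff_zero [simp]: "(shift_diff s \<gamma> ^^ b) (\<lambda>_. 0) = (\<lambda>_. 0)"
  by (induction b) (auto simp: shift_diff_def)

lemma funpow_shift_diff: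
  "(shift_diff s \<gamma> ^^ n) h j = (\<Sum>i\<le>n. scale (Polynomial.coeff ([:- \<gamma>, 1:] ^ n) i) (h (j + s * i)))"
proof (induction n arbitrary: j)
  case 0
  show ?case by simp
next
  case (Suc n)
  let ?F = "[:- \<gamma>, 1:] ^ n" and ?F' = "[:- \<gamma>, 1:] ^ Suc n"
  have top: "Polynomial.coeff ?F (Suc n) = 0"
    by (rule coeff_eq_0) (simp add: degree_linear_power)
  have c0: "Polynomial.coeff ?F' 0 = - \<gamma> * Polynomial.coeff ?F 0"
    and cS: "\<And>i. Polynomial.coeff ?F' (Suc i) = Polynomial.coeff ?F i - \<gamma> * Polynomial.coeff ?F (Suc i)"
    by simp_all
  have "(\<Sum>i\<le>Suc n. scale (Polynomial.coeff ?F' i) (h (j + s * i)))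
      = scale (- \<gamma> * Polynomial.coeff ?F 0) (h j) + ((\<Sum>i\<le>n. scale (Polynomial.coeff ?F i) (h (j + s * Suc i)))
        - (\<Sum>i\<le>n. scale (\<gamma> * Polynomial.coeff ?F (Suc i)) (h (j + s * Suc i))))"
    unfolding sum.atMost_Suc_shift c0 cS by (simp add: pm.scale_left_diff_distrib sum_subtractf)
  also have "\<dots> = (\<Sum>i\<le>n. scale (Polynomial.coeff ?F i) (h (j + s * Suc i)))
      - (\<Sum>i\<le>Suc n. scale (\<gamma> * Polynomial.coeff ?F i) (h (j + s * i)))"
    unfolding sum.atMost_Suc_shift by simp
  also have "\<dots> = (\<Sum>i\<le>n. scale (Polynomial.coeff ?F i) (h (j + s + s * i)))
      - scale \<gamma> (\<Sum>i\<le>n. scale (Polynomial.coeff ?F i) (h (j + s * i)))"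
    by (simp add: top pm.scale_sum_right add_ac del: power_Suc)
  also have "\<dots> = (shift_diff s \<gamma> ^^ Suc n) h j"
    by (simp only: funpow_shift_diff_Suc Suc.IH)
  finally show ?case ..
qed

text \<open>Consequently the wrap-around relation of \<open>V_n(\<mu>, \<gamma>)\<close> says that
  the \<open>n\<close>-fold \<open>shift_diff\<close> of the orbit of \<open>m_0\<close> under x
  vanishes.\<close>

lemma block_coeff_sum:
  "(\<Sum>i<n. scale (Polynomial.coeff (Polynomial.monom 1 n - [:- \<gamma>, 1:] ^ n) i) (h (j + s * i)))
    = h (j + s * n) - (shift_diff s \<gamma> ^^ n) h j"
  unfolding funpow_shift_diff lessThan_Suc_atMost[symmetric]
  by (simp add: coeff_linear_power pm.scale_left_diff_distrib sum_negf)

lemma funpow_shift_diff_orbit: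
  assumes "pm_linear X"
  shows "(shift_diff s \<gamma> ^^ n) (\<lambda>j. (X ^^ j) v) j = (X ^^ j) ((shift_diff s \<gamma> ^^ n) (\<lambda>j. (X ^^ j) v) 0)"
proof (induction n arbitrary: j)
  case 0
  show ?case by simp
next
  case (Suc n)
  let ?h = "(shift_diff s \<gamma> ^^ n) (\<lambda>j. (X ^^ j) v)"
  note lin = pm_linear_funpow[OF assms]
  have "?h (j + s) = (X ^^ j) (?h s)"
    using Suc.IH[of "j + s"] Suc.IH[of s] by (simp add: funpow_add)
  with Suc.IH[of j] show ?case
    by (simp add: funpow_shift_diff_Suc pm_linear_diff[OF lin] pm_linear_scale[OF lin] del: funpow.simps)
qed

lemma funpow_shift_diff_orbit_0:
  assumes "pm_linear X"
  shows "(shift_diff s \<gamma> ^^ n) (\<lambda>j. (X ^^ j) v) 0 = ((\<lambda>v. (X ^^ s) v - scale \<gamma> v) ^^ n) v"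
proof (induction n)
  case 0
  show ?case by simp
next
  case (Suc n)
  then show ?case
    using funpow_shift_diff_orbit[OF assms, of n s \<gamma> v s]
    unfolding funpow_shift_diff_Suc by simp
qed

section \<open>Surjections from direct sums\<close>

text \<open>Carries the homomorphisms along existentially, with only as much of the image as
  matters: \<open>S\<close> will consist of generators, and these sets simply unite when direct sums
  are formed.\<close>

definition covers ::
    "('c \<Rightarrow>\<^sub>0 'k::field) ring \<Rightarrow> ('c \<Rightarrow>\<^sub>0 'k, 'b, 'k) based_module \<Rightarrow> ('c \<Rightarrow>\<^sub>0 'k, 'd, 'k) based_module \<Rightarrow>
     ('b \<Rightarrow>\<^sub>0 'k) set \<Rightarrow> bool"
  where "covers A M N S \<longleftrightarrow> (\<exists>\<phi>. pm_linear \<phi> \<and> (\<forall>v\<in>space N. \<phi> v \<in> space M) \<and>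
    (\<forall>h\<in>carrier A. \<forall>v\<in>space N. \<phi> (act N h v) = act M h (\<phi> v)) \<and> S \<subseteq> \<phi> ` space N)"

lemma space_linear_eqI:
  assumes "pm_linear F" "pm_linear F'" "v \<in> space M" "\<And>b. b \<in> basis M \<Longrightarrow> F (single b 1) = F' (single b 1)"
  shows "F v = F' v"
  by (rule pm_linear_eqI[OF assms(1,2,4)]) (use assms(3) in \<open>auto simp: space_def\<close>)

lemma covers_direct_sum:
  assumes M: "\<And>h. pm_linear (act M h)" and N: "\<And>i h. pm_linear (act (N i) h)"
    and cov: "\<And>i. i \<in> I \<Longrightarrow> covers A M (N i) (S i)"
  shows "covers A M (direct_sum I N) (\<Union>i\<in>I. S i)"
proof -
  have "\<forall>i\<in>I. \<exists>\<phi>. pm_linear \<phi> \<and> (\<forall>v\<in>space (N i). \<phi> v \<in> space M) \<and>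
      (\<forall>h\<in>carrier A. \<forall>v\<in>space (N i). \<phi> (act (N i) h v) = act M h (\<phi> v)) \<and> S i \<subseteq> \<phi> ` space (N i)"
    using cov unfolding covers_def by blast
  from bchoice[OF this] obtain \<phi> where \<phi>: "\<And>i. i \<in> I \<Longrightarrow> pm_linear (\<phi> i)"
      "\<And>i v. i \<in> I \<Longrightarrow> v \<in> space (N i) \<Longrightarrow> \<phi> i v \<in> space M"
      "\<And>i h v. i \<in> I \<Longrightarrow> h \<in> carrier A \<Longrightarrow> v \<in> space (N i) \<Longrightarrow> \<phi> i (act (N i) h v) = act M h (\<phi> i v)"
      "\<And>i. i \<in> I \<Longrightarrow> S i \<subseteq> \<phi> i ` space (N i)"
    by blast
  let ?\<Phi> = "lin_ext (\<lambda>(i, b). \<phi> i (single b 1))"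
  let ?\<iota> = "\<lambda>i. lin_ext (\<lambda>c. single (i, c) 1)"
  have \<Phi>\<iota>: "?\<Phi> (?\<iota> i v) = \<phi> i v" if "i \<in> I" for i v
    by (rule pm_linear_eqI[OF pm_linear_comp[OF pm_linear_lin_ext pm_linear_lin_ext] \<phi>(1)[OF that] _ subset_UNIV]) simp
  have \<iota>_space: "?\<iota> i v \<in> space (direct_sum I N)" if "i \<in> I" "v \<in> space (N i)" for i v
    by (rule lin_ext_space[OF _ that(2)]) (use that(1) in \<open>auto simp: direct_sum_def space_def\<close>)
  show ?thesis unfolding covers_def
  proof (intro exI[of _ ?\<Phi>] conjI ballI)
    show "pm_linear ?\<Phi>" by simp
    show "?\<Phi> v \<in> space M" if "v \<in> space (direct_sum I N)" for v
      by (rule lin_ext_space[OF _ that]) (auto simp: direct_sum_def intro!: \<phi>(2))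
    show "?\<Phi> (act (direct_sum I N) h v) = act M h (?\<Phi> v)"
      if "h \<in> carrier A" "v \<in> space (direct_sum I N)" for h v
    proof (rule space_linear_eqI[OF pm_linear_comp[OF pm_linear_lin_ext] pm_linear_comp[OF M pm_linear_lin_ext] that(2)])
      show "pm_linear (act (direct_sum I N) h)" by (simp add: direct_sum_def)
      fix ib assume "ib \<in> basis (direct_sum I N)"
      then obtain i b where ib: "ib = (i, b)" "i \<in> I" "b \<in> basis (N i)"
        by (auto simp: direct_sum_def)
      have eq: "single ib 1 = ?\<iota> i (single b 1)" by (simp add: ib)
      show "?\<Phi> (act (direct_sum I N) h (single ib 1)) = act M h (?\<Phi> (single ib 1))"
        unfolding eq direct_sum_act_inj[OF N] \<Phi>\<iota>[OF ib(2)]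
        by (rule \<phi>(3)[OF ib(2) that(1) single_in_space[OF ib(3)]])
    qed
    show "(\<Union>i\<in>I. S i) \<subseteq> ?\<Phi> ` space (direct_sum I N)"
    proof
      fix y assume "y \<in> (\<Union>i\<in>I. S i)"
      then obtain i v where "i \<in> I" "v \<in> space (N i)" "y = \<phi> i v" using \<phi>(4) by blast
      then show "y \<in> ?\<Phi> ` space (direct_sum I N)"
        by (intro image_eqI[OF _ \<iota>_space]) (simp_all only: \<Phi>\<iota>)
    qed
  qed
qed

lemma covers_binary_sum:
  assumes M: "\<And>h. pm_linear (act M h)" and N: "\<And>h. pm_linear (act N h)" and N': "\<And>h. pm_linear (act N' h)"
    and cov: "covers A M N S" "covers A M N' S'"
  shows "covers A M (binary_sum N N') (S \<union> S')"
proof -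
  obtain \<phi> where \<phi>: "pm_linear \<phi>"
      "\<And>v. v \<in> space N \<Longrightarrow> \<phi> v \<in> space M"
      "\<And>h v. h \<in> carrier A \<Longrightarrow> v \<in> space N \<Longrightarrow> \<phi> (act N h v) = act M h (\<phi> v)" "S \<subseteq> \<phi> ` space N"
    using cov(1) unfolding covers_def by blast
  obtain \<phi>' where \<phi>': "pm_linear \<phi>'"
      "\<And>v. v \<in> space N' \<Longrightarrow> \<phi>' v \<in> space M"
      "\<And>h v. h \<in> carrier A \<Longrightarrow> v \<in> space N' \<Longrightarrow> \<phi>' (act N' h v) = act M h (\<phi>' v)" "S' \<subseteq> \<phi>' ` space N'"
    using cov(2) unfolding covers_def by blast
  let ?\<Phi> = "lin_ext (case_sum (\<lambda>b. \<phi> (single b 1)) (\<lambda>b. \<phi>' (single b 1)))"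
  let ?l = "lin_ext (\<lambda>c. single (Inl c) 1)" and ?r = "lin_ext (\<lambda>c. single (Inr c) 1)"
  have l: "?\<Phi> (?l v) = \<phi> v" for v
    by (rule pm_linear_eqI[OF pm_linear_comp[OF pm_linear_lin_ext pm_linear_lin_ext] \<phi>(1) _ subset_UNIV]) simp
  have r: "?\<Phi> (?r v) = \<phi>' v" for v
    by (rule pm_linear_eqI[OF pm_linear_comp[OF pm_linear_lin_ext pm_linear_lin_ext] \<phi>'(1) _ subset_UNIV]) simp
  have l_space: "?l v \<in> space (binary_sum N N')" if "v \<in> space N" for v
    by (rule lin_ext_space[OF _ that]) (auto simp: binary_sum_def space_def)
  have r_space: "?r v \<in> space (binary_sum N N')" if "v \<in> space N'" for v
    by (rule lin_ext_space[OF _ that]) (auto simp: binary_sum_def space_def)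
  show ?thesis unfolding covers_def
  proof (intro exI[of _ ?\<Phi>] conjI ballI)
    show "pm_linear ?\<Phi>" by simp
    show "?\<Phi> v \<in> space M" if "v \<in> space (binary_sum N N')" for v
      by (rule lin_ext_space[OF _ that]) (auto simp: binary_sum_def intro!: \<phi>(2) \<phi>'(2))
    show "?\<Phi> (act (binary_sum N N') h v) = act M h (?\<Phi> v)"
      if "h \<in> carrier A" "v \<in> space (binary_sum N N')" for h v
    proof (rule space_linear_eqI[OF pm_linear_comp[OF pm_linear_lin_ext] pm_linear_comp[OF M pm_linear_lin_ext] that(2)])
      show "pm_linear (act (binary_sum N N') h)" by (simp add: binary_sum_def)
      fix c assume c: "c \<in> basis (binary_sum N N')"
      show "?\<Phi> (act (binary_sum N N') h (single c 1)) = act M h (?\<Phi> (single c 1))"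
      proof (cases c)
        case (Inl b)
        then have eq: "single c 1 = ?l (single b 1)" and b: "b \<in> basis N"
          using c by (auto simp: binary_sum_def)
        show ?thesis
          unfolding eq binary_sum_act_Inl[OF N] l by (rule \<phi>(3)[OF that(1) single_in_space[OF b]])
      next
        case (Inr b)
        then have eq: "single c 1 = ?r (single b 1)" and b: "b \<in> basis N'"
          using c by (auto simp: binary_sum_def)
        show ?thesis
          unfolding eq binary_sum_act_Inr[OF N'] r by (rule \<phi>'(3)[OF that(1) single_in_space[OF b]])
      qed
    qed
    show "S \<union> S' \<subseteq> ?\<Phi> ` space (binary_sum N N')"
    proof
      fix y assume "y \<in> S \<union> S'"
      then consider v where "v \<in> space N" "y = \<phi> v" | v where "v \<in> space N'" "y = \<phi>' v"
        using \<phi>(4) \<phi>'(4) by blast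
      then show "y \<in> ?\<Phi> ` space (binary_sum N N')"
      proof cases
        case 1
        then show ?thesis by (intro image_eqI[OF _ l_space]) (simp_all only: l)
      next
        case 2
        then show ?thesis by (intro image_eqI[OF _ r_space]) (simp_all only: r)
      qed
    qed
  qed
qed

context ore_weights
begin

text \<open>The universal property of \<open>V_n(\<mu>, \<gamma>)\<close>: the assignment of
  \<open>x^i v\<close> to \<open>m_i\<close> is a homomorphism as soon as \<open>v\<close> has
  weight \<open>\<mu>\<close> and is killed by \<open>(x^s - \<gamma>)^n\<close>.\<close>

lemma covers_V_block:
  assumes M: "ore_module G \<psi> M" and \<mu>: "\<mu> \<in> carrier (character_group G)" and n: "n > 0"
    and v: "v \<in> space M" and grp: "\<And>g. g \<in> carrier G \<Longrightarrow> act M (grp g) v = scale (\<mu> g) v"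
    and nil: "((\<lambda>v. (act M (ore_x G) ^^ s) v - scale \<gamma> v) ^^ n) v = 0"
  shows "covers (hopf_ore G \<psi>) M (V_block \<chi> s n \<mu> \<gamma>) {v}"
proof -
  interpret M: ore_module G \<psi> M by fact
  let ?V = "V_block \<chi> s n \<mu> \<gamma>"
  interpret V: ore_module G \<psi> ?V by (rule V_block(1)[OF \<mu>])
  let ?\<phi> = "lin_ext (\<lambda>i. (M.X ^^ i) v)"
  have hom: "?\<phi> (act ?V h w) = act M h (?\<phi> w)"
    if "h \<in> carrier (hopf_ore G \<psi>)" "w \<in> space ?V" for h w
  proof (rule ore_module_hom[OF V.ore_module_axioms M pm_linear_lin_ext _ _ _ that])
    show "?\<phi> (single i 1) \<in> space M" for i using v by simp
    show "?\<phi> (act ?V (grp g) (single i 1)) = act M (grp g) (?\<phi> (single i 1))"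
      if g: "g \<in> carrier G" for g i
    proof -
      have "scale (\<mu> g) ((M.X ^^ i) v) = scale (\<psi> g ^ i) (act M (grp g) ((M.X ^^ i) v))"
        using M.funpow_X_grp[OF g v, of i] grp[OF g] pm_linear_scale[OF M.act_linear'(2), where c = "\<mu> g" and v = v] by simp
      then have "scale (\<chi> g ^ i) (scale (\<mu> g) ((M.X ^^ i) v))
          = scale (\<chi> g ^ i) (scale (\<psi> g ^ i) (act M (grp g) ((M.X ^^ i) v)))"
        by (rule arg_cong)
      then have "scale (\<chi> g ^ i * \<mu> g) ((M.X ^^ i) v)
          = scale ((\<psi> g * \<chi> g) ^ i) (act M (grp g) ((M.X ^^ i) v))"
        by (simp add: power_mult_distrib mult.commute)
      then show ?thesis using g \<psi>_\<chi>[OF g] by (simp add: V_block(2)[OF \<mu>])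
    qed
    show "?\<phi> (act ?V (ore_x G) (single i 1)) = M.X (?\<phi> (single i 1))" if i: "i \<in> basis ?V" for i
    proof (cases "i + 1 < n * s")
      case True
      then show ?thesis by (simp add: V_block(3)[OF \<mu>])
    next
      case False
      with i have ns: "Suc i = s * n" "i < n * s" by (auto simp: mult.commute)
      \<comment> \<open>At the last basis vector, \<open>nil\<close> is the required identity once
        it is solved for \<open>x^(ns) v\<close>.\<close>
      have "?\<phi> (act ?V (ore_x G) (single i 1))
          = (\<Sum>j<n. scale (block_coeff n \<gamma> j) ((\<lambda>j. (M.X ^^ j) v) (0 + s * j)))"
        using False ns(2) by (simp add: V_block(3)[OF \<mu>] pm_linear_sum[OF pm_linear_lin_ext] mult.commute)
      also have "\<dots> = (M.X ^^ Suc i) v"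
        unfolding block_coeff_sum[where h = "\<lambda>j. (M.X ^^ j) v"]
          funpow_shift_diff_orbit_0[OF M.act_linear] nil ns(1) by simp
      finally show ?thesis by simp
    qed
  qed
  show ?thesis unfolding covers_def
  proof (intro exI[of _ ?\<phi>] conjI ballI)
    show "?\<phi> w \<in> space M" if "w \<in> space ?V" for w
      by (rule lin_ext_space[OF _ that]) (simp add: v)
    have "?\<phi> (single 0 1) = v" by (simp only: lin_ext_single funpow_0 pm.scale_one)
    moreover have "single 0 1 \<in> space ?V" using n s_pos by (intro single_in_space) simp
    ultimately show "{v} \<subseteq> ?\<phi> ` space ?V" by (metis image_eqI insert_subset empty_subsetI)
  qed (use hom in auto)
qed

end

section \<open>Block sizes and dimensions\<close>

lemma block_size_eq:
  assumes "1 \<le> i" "i \<le> min t u"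
  shows "nat (2 * int i - 1 + \<bar>int t - int u\<bar>) = u + t - 1 - 2 * (min t u - i)"
  using assms by (cases "t \<le> u") (auto simp: nat_eq_iff)

text \<open>The Clebsch-Gordan dimension count: with \<open>d = |t - u|\<close>, the first
  \<open>m\<close> sizes add up to \<open>m (m + d)\<close>, and for \<open>m = min t u\<close> the
  other factor is \<open>max t u\<close>.\<close>

lemma sum_block_size: "(\<Sum>i\<in>{1..min t u}. nat (2 * int i - 1 + \<bar>int t - int u\<bar>)) = t * u"
proof -
  define d where "d = max t u - min t u"
  have "(\<Sum>i\<in>{1..m}. nat (2 * int i - 1 + int d)) = m * (m + d)" for m
    by (induction m) (auto simp: nat_eq_iff algebra_simps)
  moreover have "\<bar>int t - int u\<bar> = int d" by (auto simp: d_def)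
  moreover have "min t u * (min t u + d) = t * u" by (cases "t \<le> u") (auto simp: d_def mult.commute)
  ultimately show ?thesis by simp
qed

lemma card_basis_direct_sum:
  assumes "finite I" "\<And>i. i \<in> I \<Longrightarrow> finite (basis (M i))"
  shows "finite (basis (direct_sum I M))" "card (basis (direct_sum I M)) = (\<Sum>i\<in>I. card (basis (M i)))"
  using assms by (auto simp: direct_sum_def)

text \<open>Either of the two direct sums in the claim: \<open>s - r\<close> copies at
  \<open>u\<close>, and \<open>r\<close> copies at \<open>u + 1\<close>.\<close>

definition block_sum ::
    "('g \<Rightarrow> 'k::field) \<Rightarrow> nat \<Rightarrow> nat \<Rightarrow> nat \<Rightarrow> nat \<Rightarrow> ('g \<Rightarrow> 'k) \<Rightarrow> 'k \<Rightarrow>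
     ('g \<times> nat \<Rightarrow>\<^sub>0 'k, nat \<times> nat \<times> nat, 'k) based_module"
  where "block_sum \<chi> s k t u \<mu> \<gamma> = direct_sum {1..min t u} (\<lambda>i. copies k
    (V_block \<chi> s (nat (2 * int i - 1 + \<bar>int t - int u\<bar>)) \<mu> \<gamma>))"

context ore_weights
begin

lemma ore_module_block_sum:
  assumes "\<mu> \<in> carrier (character_group G)"
  shows "ore_module G \<psi> (block_sum \<chi> s k t u \<mu> \<gamma>)"
  unfolding block_sum_def copies_def
  by (intro ore_module_direct_sum V_block(1) assms)

lemma card_basis_block_sum:
  "finite (basis (block_sum \<chi> s k t u \<mu> \<gamma>))"
  "card (basis (block_sum \<chi> s k t u \<mu> \<gamma>)) = k * (t * u) * s"
proof -
  have fin: "finite (basis (copies k (V_block \<chi> s n \<mu> \<gamma>)))"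
    and card: "card (basis (copies k (V_block \<chi> s n \<mu> \<gamma>))) = k * (n * s)" for n
    by (auto simp: copies_def card_basis_direct_sum)
  show "finite (basis (block_sum \<chi> s k t u \<mu> \<gamma>))"
    unfolding block_sum_def by (rule card_basis_direct_sum) (auto simp: fin)
  have "card (basis (block_sum \<chi> s k t u \<mu> \<gamma>))
      = (\<Sum>i\<in>{1..min t u}. k * (nat (2 * int i - 1 + \<bar>int t - int u\<bar>) * s))"
    unfolding block_sum_def by (subst card_basis_direct_sum(2)) (auto simp: fin card)
  also have "\<dots> = k * (\<Sum>i\<in>{1..min t u}. nat (2 * int i - 1 + \<bar>int t - int u\<bar>)) * s"
    by (simp only: sum_distrib_left sum_distrib_right mult.assoc)
  also have "\<dots> = k * (t * u) * s"
    by (simp only: sum_block_size)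
  finally show "card (basis (block_sum \<chi> s k t u \<mu> \<gamma>)) = k * (t * u) * s" .
qed

text \<open>The vector of degree \<open>j\<close> generates the summand with index
  \<open>i = min t u - j\<close>, so the largest block belongs to degree 0.\<close>

lemma covers_block_sum:
  fixes v :: "nat \<Rightarrow> nat \<Rightarrow> ('b \<Rightarrow>\<^sub>0 'k)"
  assumes M: "ore_module G \<psi> M" and \<mu>: "\<mu> \<in> carrier (character_group G)"
    and v: "\<And>c j. c < k \<Longrightarrow> j < min t u \<Longrightarrow> v c j \<in> space M"
    and grp: "\<And>c j g. c < k \<Longrightarrow> j < min t u \<Longrightarrow> g \<in> carrier G \<Longrightarrow> act M (grp g) (v c j) = scale (\<mu> g) (v c j)"
    and nil: "\<And>c j. c < k \<Longrightarrow> j < min t u \<Longrightarrow>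
      ((\<lambda>v. (act M (ore_x G) ^^ s) v - scale \<gamma> v) ^^ (u + t - 1 - 2 * j)) (v c j) = 0"
  shows "covers (hopf_ore G \<psi>) M (block_sum \<chi> s k t u \<mu> \<gamma>) {v c j | c j. c < k \<and> j < min t u}"
proof -
  interpret M: ore_module G \<psi> M by fact
  let ?V = "\<lambda>i. V_block \<chi> s (nat (2 * int i - 1 + \<bar>int t - int u\<bar>)) \<mu> \<gamma>"
  have V: "pm_linear (act (?V i) h)" for i h
    using ore_module.act_linear[OF V_block(1)[OF \<mu>]] .
  have copies_linear: "pm_linear (act (copies k (?V i)) h)" for i h
    by (simp add: copies_def direct_sum_def)
  have "covers (hopf_ore G \<psi>) M (block_sum \<chi> s k t u \<mu> \<gamma>)
      (\<Union>i\<in>{1..min t u}. \<Union>c\<in>{..<k}. {v c (min t u - i)})"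
    unfolding block_sum_def
  proof (rule covers_direct_sum[OF M.act_linear copies_linear])
    fix i assume i: "i \<in> {1..min t u}"
    show "covers (hopf_ore G \<psi>) M (copies k (?V i)) (\<Union>c\<in>{..<k}. {v c (min t u - i)})"
      unfolding copies_def
    proof (rule covers_direct_sum[OF M.act_linear V])
      fix c assume "c \<in> {..<k}"
      then have c: "c < k" and j: "min t u - i < min t u" using i by auto
      have size: "nat (2 * int i - 1 + \<bar>int t - int u\<bar>) = u + t - 1 - 2 * (min t u - i)"
        using i by (intro block_size_eq) auto
      show "covers (hopf_ore G \<psi>) M (?V i) {v c (min t u - i)}"
        by (rule covers_V_block[OF M \<mu> _ v[OF c j] grp[OF c j]])
          (use i nil[OF c j] in \<open>auto simp: size\<close>)
    qed
  qed
  moreover have "(\<Union>i\<in>{1..min t u}. \<Union>c\<in>{..<k}. {v c (min t u - i)}) = {v c j | c j. c < k \<and> j < min t u}"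
  proof (intro equalityI subsetI)
    fix y assume "y \<in> {v c j | c j. c < k \<and> j < min t u}"
    then obtain c j where "y = v c (min t u - (min t u - j))" "c < k" "j < min t u" by auto
    then show "y \<in> (\<Union>i\<in>{1..min t u}. \<Union>c\<in>{..<k}. {v c (min t u - i)})"
      by (intro UN_I[of "min t u - j"] UN_I[of c]) auto
  next
    fix y assume "y \<in> (\<Union>i\<in>{1..min t u}. \<Union>c\<in>{..<k}. {v c (min t u - i)})"
    then obtain i c where "i \<in> {1..min t u}" "c < k" and y: "y = v c (min t u - i)" by blast
    then have "c < k \<and> min t u - i < min t u" by auto
    with y show "y \<in> {v c j | c j. c < k \<and> j < min t u}" by blast
  qed
  ultimately show ?thesis by simp
qed

end

section \<open>Modules generated by a weight vector under two $q$-commuting operators\<close>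

text \<open>
  In the application \<open>e i j\<close> is \<open>P\<^sup>i Q\<^sup>j e\<^sub>0\<^sub>0\<close>, where \<open>P\<close> is the one of the two summands \<open>x \<otimes> a\<close>
  and \<open>1 \<otimes> x\<close> of \<open>\<Delta>(x)\<close> that acts nilpotently, and \<open>Q\<close> is the other one.
\<close>

locale ore_grid = ore_weights G \<chi> \<psi> s + M: ore_module G \<psi> M
  for G :: "('g, 'z) monoid_scheme" (structure) and \<chi> \<psi> :: "'g \<Rightarrow> 'k::field_char_0" and s
    and M :: "('g \<times> nat \<Rightarrow>\<^sub>0 'k, 'b, 'k) based_module" +
  fixes e :: "nat \<Rightarrow> nat \<Rightarrow> ('b \<Rightarrow>\<^sub>0 'k)" and \<mu> :: "'g \<Rightarrow> 'k" and \<omega> \<gamma> :: 'k and p t u r :: nat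
  assumes \<mu>: "\<mu> \<in> carrier (character_group G)"
    and e_space: "e i j \<in> space M"
    and grp_e: "g \<in> carrier G \<Longrightarrow> act M (grp g) (e i j) = scale (\<chi> g ^ (i + j) * \<mu> g) (e i j)"
    and X_e: "M.X (e i j) = e (Suc i) j + scale (\<omega> ^ i) (e i (Suc j))"
    and e_zero: "p \<le> i \<Longrightarrow> e i j = 0"
    and shift_e: "(shift_diff s \<gamma> ^^ t) (e i) = (\<lambda>_. 0)"
    and basis_e: "b \<in> basis M \<Longrightarrow> \<exists>i j c. single b 1 = scale c (e i j)"
    and finite_basis: "finite (basis M)" and card_basis: "card (basis M) = p * (t * s)"
    and \<omega>: "primitive_root_of_unity s \<omega>"
    and \<gamma>: "\<gamma> \<noteq> 0"
    and p: "p = u * s + r" "r < s"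
begin

abbreviation f where "f \<equiv> \<lambda>v. (M.X ^^ s) v - scale \<gamma> v"

lemma f_linear: "pm_linear f"
  using M.act_linear'(2)[of s] by (simp add: pm_linear_iff pm.scale_right_diff_distrib pm.scale_right_distrib mult.commute)

lemma Xs_e: "(M.X ^^ s) (e i j) = e (i + s) j + e i (j + s)"
  by (rule gauss_binomial_theorem_root_of_unity[where e = e and \<omega> = \<omega>, OF M.act_linear X_e \<omega>])

text \<open>Because \<open>x^s - \<gamma> = P^s + (Q^s - \<gamma>)\<close>: the first summand raises
  \<open>i\<close> by \<open>s\<close>, the second contributes one more \<open>shift_diff\<close>.
  The index \<open>j\<close> stays fixed, which produces a Jordan grid.\<close>

lemma f_shift:
  "f ((shift_diff s \<gamma> ^^ b) (e i) j) = (shift_diff s \<gamma> ^^ b) (e (i + s)) j + (shift_diff s \<gamma> ^^ Suc b) (e i) j"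
proof (induction b arbitrary: j)
  case 0
  show ?case by (simp add: Xs_e shift_diff_def)
next
  case (Suc b)
  show ?case
    unfolding funpow_shift_diff_Suc[where n = b] funpow_shift_diff_Suc[where n = "Suc b" and h = "e i" and j = j]
      pm_linear_diff[OF f_linear] pm_linear_scale[OF f_linear] Suc.IH
    by (simp add: pm.scale_right_distrib)
qed

lemma shift_eq_0: "p \<le> i \<or> t \<le> b \<Longrightarrow> (shift_diff s \<gamma> ^^ b) (e i) = (\<lambda>_. 0)"
proof (elim disjE)
  assume "p \<le> i"
  then have "e i = (\<lambda>_. 0)" by (auto simp: e_zero)
  then show ?thesis by simp
next
  assume "t \<le> b"
  then have "(shift_diff s \<gamma> ^^ b) (e i) = (shift_diff s \<gamma> ^^ (b - t)) ((shift_diff s \<gamma> ^^ t) (e i))"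
    by (metis funpow_add le_add_diff_inverse2 o_apply)
  then show ?thesis by (simp add: shift_e)
qed

lemma jordan_grid_shift:
  assumes "i + s * k \<ge> p"
  shows "jordan_grid f (\<lambda>a b. (shift_diff s \<gamma> ^^ b) (e (i + s * a)) j) k t"
proof (rule jordan_grid.intro)
  show "pm_linear f" by (rule f_linear)
  show "f ((shift_diff s \<gamma> ^^ b) (e (i + s * a)) j) = (shift_diff s \<gamma> ^^ b) (e (i + s * Suc a)) j
      + (shift_diff s \<gamma> ^^ Suc b) (e (i + s * a)) j" for a b
    by (simp only: f_shift mult_Suc_right add_ac)
  show "(shift_diff s \<gamma> ^^ b) (e (i + s * a)) j = 0" if "k \<le> a \<or> t \<le> b" for a b
  proof -
    have "p \<le> i + s * a \<or> t \<le> b"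
      using that assms by (meson add_left_mono le_trans mult_le_mono2)
    then show ?thesis by (simp add: shift_eq_0)
  qed
qed

lemma shift_space: "(shift_diff s \<gamma> ^^ b) (e i) j \<in> space M"
proof (induction b arbitrary: j)
  case (Suc b)
  then show ?case
    unfolding funpow_shift_diff_Suc by (intro pm.subspace_diff pm.subspace_scale subspace_space)
qed (simp add: e_space)

text \<open>\<open>shift_diff\<close> mixes positions that differ by \<open>s\<close>, and
  \<open>\<chi>^s\<close> is trivial, so weights are preserved.\<close>

lemma grp_shift:
  assumes g: "g \<in> carrier G"
  shows "act M (grp g) ((shift_diff s \<gamma> ^^ b) (e i) j) = scale (\<chi> g ^ (i + j) * \<mu> g) ((shift_diff s \<gamma> ^^ b) (e i) j)"
proof (induction b arbitrary: j)
  case 0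
  show ?case by (simp add: grp_e g)
next
  case (Suc b)
  have "\<chi> g ^ (i + (j + s)) = \<chi> g ^ (i + j)"
    using \<chi>_pow[OF g] by (simp add: power_add)
  then show ?case
    unfolding funpow_shift_diff_Suc pm_linear_diff[OF M.act_linear] pm_linear_scale[OF M.act_linear] Suc.IH
    by (simp add: pm.scale_right_diff_distrib mult_ac)
qed

text \<open>The exponent in \<open>{0..<s}\<close> that complements \<open>c\<close> to a multiple
  of \<open>s\<close>, so that \<open>e c (corank c)\<close> has weight \<open>\<mu>\<close>; the
  outer \<open>mod\<close> handles \<open>c = 0\<close>.\<close>

definition corank :: "nat \<Rightarrow> nat"
  where "corank c = (s - c) mod s"

text \<open>The number of \<open>a\<close> with \<open>c + s * a < p\<close>, that is the size of
  the \<open>c\<close>-th Jordan block of \<open>x^s\<close> on \<open>V_p\<close>.\<close>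

definition row_length :: "nat \<Rightarrow> nat"
  where "row_length c = (if c < r then u + 1 else u)"

text \<open>For fixed \<open>c\<close> these vectors form a grid of weight \<open>\<mu>\<close>: a
  Jordan block of length \<open>row_length c\<close> tensored with one of length
  \<open>t\<close>.\<close>

definition row :: "nat \<Rightarrow> nat \<Rightarrow> nat \<Rightarrow> ('b \<Rightarrow>\<^sub>0 'k)"
  where "row c a b = (shift_diff s \<gamma> ^^ b) (e (c + s * a)) (corank c)"

lemma corank_dvd: "c < s \<Longrightarrow> s dvd c + corank c"
  by (cases "c = 0") (auto simp: corank_def)

lemma corank_unique:
  assumes "s dvd c + d" "c < s" "d < s"
  shows "d = corank c"
proof -
  obtain k where k: "c + d = s * k" using assms(1) by (elim dvdE)
  have "s * k < s * 2" using assms(2,3) k by linarith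
  then have "k = 0 \<or> k = 1" by auto
  then show ?thesis
  proof
    assume "k = 1"
    with k have "d = s - c" by simp
    with assms(3) show ?thesis by (simp add: corank_def)
  qed (use k in \<open>simp add: corank_def\<close>)
qed

lemma jordan_grid_row: "jordan_grid f (row c) (row_length c) t"
  unfolding row_def using p by (intro jordan_grid_shift) (auto simp: row_length_def algebra_simps)

definition top_vector :: "nat \<Rightarrow> nat \<Rightarrow> ('b \<Rightarrow>\<^sub>0 'k)"
  where "top_vector c = jordan_grid.cg_vector (row c) (row_length c) t"

lemma top_vector_space: "top_vector c j \<in> space M"
  unfolding top_vector_def
  by (rule jordan_grid.cg_vector_in_subspace[OF jordan_grid_row subspace_space]) (simp add: row_def shift_space)

lemma grp_top_vector:
  assumes "c < s" "g \<in> carrier G"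
  shows "act M (grp g) (top_vector c j) = scale (\<mu> g) (top_vector c j)"
proof -
  let ?S = "{v. act M (grp g) v = scale (\<mu> g) v}"
  have "top_vector c j \<in> ?S"
    unfolding top_vector_def
  proof (rule jordan_grid.cg_vector_in_subspace[OF jordan_grid_row])
    show "pm.subspace ?S"
      by (rule pm.subspaceI)
        (auto simp: pm_linear_add[OF M.act_linear] M.act_scale pm.scale_right_distrib mult.commute)
    fix a b
    obtain k where "c + corank c = s * k" using corank_dvd[OF assms(1)] by (auto elim: dvdE)
    then have "c + s * a + corank c = s * (a + k)" by (simp add: algebra_simps)
    then show "row c a b \<in> ?S"
      using assms(2) by (simp add: row_def grp_shift)
  qed
  then show ?thesis by simp
qed

lemma f_top_vector:
  "j < min t (row_length c) \<Longrightarrow> (f ^^ (row_length c + t - 1 - 2 * j)) (top_vector c j) = 0"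
  unfolding top_vector_def by (rule jordan_grid.funpow_cg_vector_eq_0[OF jordan_grid_row]) auto

text \<open>The top vectors all have weight \<open>\<mu>\<close>, and the other weights have to be
  reached by x alone. Pushing \<open>e i j\<close> forward by x until its weight is
  \<open>\<mu>\<close> shows that \<open>x^s\<close> maps it into \<open>S\<close>; nilpotency of
  \<open>f\<close> together with \<open>\<gamma> \<noteq> 0\<close> then pulls it back.\<close>

lemma e_in_submodule:
  assumes S: "pm.subspace S" "\<And>v. v \<in> S \<Longrightarrow> M.X v \<in> S"
    and top: "\<And>c j. c < s \<Longrightarrow> j < min t (row_length c) \<Longrightarrow> top_vector c j \<in> S"
  shows "e i j \<in> S"
proof -
  have XS: "(M.X ^^ n) v \<in> S" if "v \<in> S" for n v
    by (induction n) (auto simp: S(2) that)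
  have fS: "f v \<in> S" if "v \<in> S" for v
    using that by (intro pm.subspace_diff[OF S(1)] pm.subspace_scale[OF S(1)] XS)
  have row: "row c a b \<in> S" if "c < s" for c a b
    using jordan_grid.cg_vectors_generate[OF jordan_grid_row S(1) fS] top[OF that]
    unfolding top_vector_def by (auto simp: min.commute)
  have zero_weight: "e i j \<in> S" if dvd: "s dvd i + j" for i j
  proof -
    have "s dvd i mod s + j mod s"
      using dvd by (simp add: dvd_eq_mod_eq_0 mod_add_eq)
    moreover have lt: "i mod s < s" "j mod s < s" using s_pos by auto
    ultimately have "j mod s = corank (i mod s)"
      by (intro corank_unique)
    then have j: "j = corank (i mod s) + s * (j div s)" by (metis mult_div_mod_eq add.commute)
    \<comment> \<open>A step from \<open>j\<close> to \<open>j + s\<close> uses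
      \<open>h (j + s) = shift_diff s \<gamma> h j + scale \<gamma> (h j)\<close>, which raises
      \<open>b\<close>; hence all \<open>b\<close> are treated at once.\<close>
    have "(shift_diff s \<gamma> ^^ b) (e i) (corank (i mod s) + s * m) \<in> S" for b m
    proof (induction m arbitrary: b)
      case 0
      show ?case using row[OF lt(1), of "i div s" b] by (simp add: row_def)
    next
      case (Suc m)
      have "(shift_diff s \<gamma> ^^ Suc b) (e i) (corank (i mod s) + s * m)
          + scale \<gamma> ((shift_diff s \<gamma> ^^ b) (e i) (corank (i mod s) + s * m)) \<in> S"
        by (intro pm.subspace_add[OF S(1)] pm.subspace_scale[OF S(1)] Suc)
      then show ?case
        unfolding funpow_shift_diff_Suc by (simp add: add_ac)
    qed
    from this[of 0 "j div s"] j show ?thesis by simp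
  qed
  \<comment> \<open>Each application of x raises \<open>i + j\<close> by one, so the vector expands
    into vectors \<open>e i' j'\<close> with \<open>s dvd i' + j'\<close>, although
    \<open>e i j\<close> is not yet known to lie in \<open>S\<close>.\<close>
  have X_e_zero_weight: "(M.X ^^ n) (e i j) \<in> S" if "s dvd i + j + n" for n i j
    using that
  proof (induction n arbitrary: i j)
    case 0
    then show ?case by (simp add: zero_weight)
  next
    case (Suc n)
    have "(M.X ^^ n) (e (Suc i) j) + scale (\<omega> ^ i) ((M.X ^^ n) (e i (Suc j))) \<in> S"
      using Suc by (intro pm.subspace_add[OF S(1)] pm.subspace_scale[OF S(1)] Suc.IH) auto
    then show ?case
      by (simp add: funpow_Suc_right X_e pm_linear_add[OF M.act_linear'(2)] pm_linear_scale[OF M.act_linear'(2)]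
          del: funpow.simps)
  qed
  have Xs: "(M.X ^^ s) (e i j) \<in> S" for i j
  proof -
    \<comment> \<open>The least \<open>n\<close> with \<open>s dvd i + j + n\<close>. As
      \<open>n <= s\<close>, the remaining \<open>s - n\<close> applications of x stay inside
      \<open>S\<close>.\<close>
    define n where "n = (s - (i + j) mod s) mod s"
    have "s dvd i + j + n"
    proof -
      have "(i + j + n) mod s = ((i + j) mod s + (s - (i + j) mod s)) mod s"
        unfolding n_def by (simp add: mod_simps)
      also have "\<dots> = 0" using s_pos by (simp add: less_imp_le)
      finally show ?thesis by blast
    qed
    moreover have "n \<le> s" unfolding n_def using s_pos by (simp add: less_imp_le)
    ultimately show ?thesis
      using XS[OF X_e_zero_weight, of i j n "s - n"] by (simp flip: funpow_add[THEN fun_cong, unfolded o_apply])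
  qed
  have Xs_shift: "(M.X ^^ s) ((shift_diff s \<gamma> ^^ b) (e i) j) \<in> S" for b i j
  proof (induction b arbitrary: j)
    case (Suc b)
    then show ?case
      unfolding funpow_shift_diff_Suc pm_linear_diff[OF M.act_linear'(2)] pm_linear_scale[OF M.act_linear'(2)]
      by (intro pm.subspace_diff[OF S(1)] pm.subspace_scale[OF S(1)])
  qed (simp add: Xs)
  text \<open>Since \<open>f = x\<^sup>s - \<gamma>\<close> is nilpotent and \<open>\<gamma> \<noteq> 0\<close>, each vector \<open>v\<close> lies in the span of the \<open>x\<^sup>s\<^sup>n v\<close> with \<open>n > 0\<close>.\<close>
  have unipotent: "v \<in> S" if "(M.X ^^ s) v \<in> S" "(f ^^ n) v = 0" for n v
    using that
  proof (induction n arbitrary: v)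
    case 0
    then show ?case by (simp add: pm.subspace_0[OF S(1)])
  next
    case (Suc n)
    have "f v \<in> S"
    proof (rule Suc.IH)
      have "(M.X ^^ s) (f v) = (M.X ^^ s) ((M.X ^^ s) v) - scale \<gamma> ((M.X ^^ s) v)"
        by (simp add: pm_linear_diff[OF M.act_linear'(2)] pm_linear_scale[OF M.act_linear'(2)])
      also have "\<dots> \<in> S"
        by (intro pm.subspace_diff[OF S(1)] pm.subspace_scale[OF S(1)] XS Suc.prems)
      finally show "(M.X ^^ s) (f v) \<in> S" .
      show "(f ^^ n) (f v) = 0" using Suc.prems(2) by (simp only: funpow_Suc_right o_apply)
    qed
    from pm.subspace_diff[OF S(1) Suc.prems(1) this] have "scale \<gamma> v \<in> S" by simp
    from pm.subspace_scale[OF S(1) this, of "1 / \<gamma>"] \<gamma> show ?case by simp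
  qed
  have "(f ^^ (p + t)) (e i j) = 0"
  proof -
    \<comment> \<open>The crude row length \<open>p\<close> serves every \<open>i\<close> uniformly;
      only nilpotency of \<open>f\<close> is wanted here.\<close>
    have "p \<le> i + s * p" using s_pos by (simp add: trans_le_add2)
    from jordan_grid.funpow_nilpotent[OF jordan_grid_shift[OF this], of "p + t" 0 0 j]
    show ?thesis by simp
  qed
  with unipotent Xs show ?thesis by blast
qed

text \<open>The rows \<open>c < r\<close> have length \<open>u + 1\<close> and feed the second sum;
  the remaining \<open>s - r\<close> rows, renumbered as \<open>r + c\<close>, have length
  \<open>u\<close> and feed the first. The image is an x-stable subspace containing all top vectors,
  hence every \<open>e i j\<close>.\<close>

lemma module_iso_block_sums:
  "module_iso (hopf_ore G \<psi>) M
    (binary_sum (block_sum \<chi> s (s - r) t u \<mu> \<gamma>) (block_sum \<chi> s r t (u + 1) \<mu> \<gamma>))"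
proof -
  let ?N1 = "block_sum \<chi> s (s - r) t u \<mu> \<gamma>" and ?N2 = "block_sum \<chi> s r t (u + 1) \<mu> \<gamma>"
  let ?N = "binary_sum ?N1 ?N2"
  let ?S1 = "{top_vector (r + c) j | c j. c < s - r \<and> j < min t u}"
  let ?S2 = "{top_vector c j | c j. c < r \<and> j < min t (u + 1)}"
  have N12: "ore_module G \<psi> ?N1" "ore_module G \<psi> ?N2"
    by (rule ore_module_block_sum[OF \<mu>])+
  have N: "ore_module G \<psi> ?N" by (rule ore_module_binary_sum[OF N12])
  have 1: "covers (hopf_ore G \<psi>) M ?N1 ?S1"
  proof (rule covers_block_sum[OF M.ore_module_axioms \<mu>])
    fix c j assume *: "c < s - r" "j < min t u"
    then show "(f ^^ (u + t - 1 - 2 * j)) (top_vector (r + c) j) = 0"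
      using f_top_vector[of j "r + c"] by (simp add: row_length_def)
    show "act M (grp g) (top_vector (r + c) j) = scale (\<mu> g) (top_vector (r + c) j)" if "g \<in> carrier G" for g
      using * that by (intro grp_top_vector) auto
  qed (rule top_vector_space)
  have 2: "covers (hopf_ore G \<psi>) M ?N2 ?S2"
  proof (rule covers_block_sum[OF M.ore_module_axioms \<mu>])
    fix c j assume *: "c < r" "j < min t (u + 1)"
    then show "(f ^^ (u + 1 + t - 1 - 2 * j)) (top_vector c j) = 0"
      using f_top_vector[of j c] by (simp add: row_length_def)
    show "act M (grp g) (top_vector c j) = scale (\<mu> g) (top_vector c j)" if "g \<in> carrier G" for g
      using * that p by (intro grp_top_vector) auto
  qed (rule top_vector_space)
  obtain \<phi> where "pm_linear \<phi> \<and> (\<forall>v\<in>space ?N. \<phi> v \<in> space M) \<and>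
      (\<forall>h\<in>carrier (hopf_ore G \<psi>). \<forall>v\<in>space ?N. \<phi> (act ?N h v) = act M h (\<phi> v)) \<and> ?S1 \<union> ?S2 \<subseteq> \<phi> ` space ?N"
    using covers_binary_sum[OF M.act_linear ore_module.act_linear[OF N12(1)] ore_module.act_linear[OF N12(2)] 1 2]
    unfolding covers_def by (elim exE)
  then have \<phi>: "pm_linear \<phi>" "\<And>v. v \<in> space ?N \<Longrightarrow> \<phi> v \<in> space M"
      "\<And>h v. h \<in> carrier (hopf_ore G \<psi>) \<Longrightarrow> v \<in> space ?N \<Longrightarrow> \<phi> (act ?N h v) = act M h (\<phi> v)"
    and top: "?S1 \<subseteq> \<phi> ` space ?N" "?S2 \<subseteq> \<phi> ` space ?N"
    by simp_all
  have sub: "pm.subspace (\<phi> ` space ?N)"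
  proof (rule pm.subspaceI)
    show "0 \<in> \<phi> ` space ?N"
      by (intro image_eqI[of _ _ 0]) (simp_all add: pm_linear_zero[OF \<phi>(1)] pm.subspace_0[OF subspace_space])
    show "x + y \<in> \<phi> ` space ?N" if xy: "x \<in> \<phi> ` space ?N" "y \<in> \<phi> ` space ?N" for x y
    proof -
      from xy(1) obtain v where "x = \<phi> v" "v \<in> space ?N" by (rule imageE)
      moreover from xy(2) obtain w where "y = \<phi> w" "w \<in> space ?N" by (rule imageE)
      ultimately show ?thesis
        by (intro image_eqI[of _ _ "v + w"]) (simp_all add: pm_linear_add[OF \<phi>(1)] pm.subspace_add[OF subspace_space])
    qed
    show "scale c x \<in> \<phi> ` space ?N" if x: "x \<in> \<phi> ` space ?N" for c x
    proof -
      from x obtain v where "x = \<phi> v" "v \<in> space ?N" by (rule imageE)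
      then show ?thesis
        by (intro image_eqI[of _ _ "scale c v"]) (simp_all add: pm_linear_scale[OF \<phi>(1)] pm.subspace_scale[OF subspace_space])
    qed
  qed
  have e: "e i j \<in> \<phi> ` space ?N" for i j
  proof (rule e_in_submodule[OF sub])
    show "M.X v \<in> \<phi> ` space ?N" if v: "v \<in> \<phi> ` space ?N" for v
    proof -
      from v obtain w where w: "v = \<phi> w" "w \<in> space ?N" by (rule imageE)
      have "ore_x G \<in> carrier (hopf_ore G \<psi>)" by (simp add: hopf_ore_def ore_x_def)
      then have "M.X v = \<phi> (act ?N (ore_x G) w)" using \<phi>(3) w by simp
      then show ?thesis using ore_module.X_space[OF N w(2)] by blast
    qed
    show "top_vector c j \<in> \<phi> ` space ?N" if "c < s" "j < min t (row_length c)" for c j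
    proof (cases "c < r")
      case True
      with that have "top_vector c j \<in> ?S2" by (auto simp: row_length_def)
      with top(2) show ?thesis by (rule subsetD)
    next
      case False
      with that have "top_vector (r + (c - r)) j \<in> ?S1" unfolding row_length_def by fastforce
      with top(1) have "top_vector (r + (c - r)) j \<in> \<phi> ` space ?N" by (rule subsetD)
      with False show ?thesis by simp
    qed
  qed
  have "w \<in> \<phi> ` space ?N" if "w \<in> space M" for w
  proof (rule pm_linear_in_subspace[OF pm.linear_ident sub])
    show "keys w \<subseteq> basis M" using that by (simp add: space_def)
    show "single b 1 \<in> \<phi> ` space ?N" if "b \<in> basis M" for b
      using basis_e[OF that] pm.subspace_scale[OF sub e] by metis
  qed
  then have surj: "\<phi> ` space ?N = space M" using \<phi>(2) by blast
  have basis: "basis ?N = basis ?N1 <+> basis ?N2" by (simp add: binary_sum_def)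
  \<comment> \<open>This is \<open>(s - r) t u s + r t (u + 1) s = (u s + r) t s\<close>.\<close>
  have "card (basis ?N) = card (basis M)"
    unfolding basis card_basis
    using p by (subst card_Plus) (auto simp: card_basis_block_sum algebra_simps)
  moreover have "finite (basis ?N)" unfolding basis by (simp add: card_basis_block_sum)
  ultimately have "bij_betw \<phi> (space ?N) (space M)"
    by (intro surjective_linear_bij_betw[OF \<phi>(1) surj]) auto
  then show ?thesis
    by (rule module_isoI[OF M.ore_module_axioms N \<phi>(1) _ \<phi>(3)])
qed

end

section \<open>The two orders of the tensor product\<close>

lemma (in ore_module) grp_X:
  assumes "g \<in> carrier G" "v \<in> space M" "\<psi> g * c = 1"
  shows "act M (grp g) (X v) = scale c (X (act M (grp g) v))"
  using assms by (simp add: X_grp mult.commute)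

context ore_weights
begin

text \<open>The basis continued by zero, so that x is a shift at every index.\<close>

definition nilp_vector :: "nat \<Rightarrow> nat \<Rightarrow> (nat \<Rightarrow>\<^sub>0 'k)"
  where "nilp_vector n i = (if i < n then single i 1 else 0)"

lemma nilp_vector:
  assumes "\<mu> \<in> carrier (character_group G)"
  shows "nilp_vector n i \<in> space (V_nilp \<chi> n \<mu>)"
    and "act (V_nilp \<chi> n \<mu>) (ore_x G) (nilp_vector n i) = nilp_vector n (Suc i)"
    and "g \<in> carrier G \<Longrightarrow> act (V_nilp \<chi> n \<mu>) (grp g) (nilp_vector n i) = scale (\<chi> g ^ i * \<mu> g) (nilp_vector n i)"
proof -
  interpret V: ore_module G \<psi> "V_nilp \<chi> n \<mu>" by (rule V_nilp(1)[OF assms])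
  show "nilp_vector n i \<in> space (V_nilp \<chi> n \<mu>)" by (simp add: nilp_vector_def space_def)
  show "V.X (nilp_vector n i) = nilp_vector n (Suc i)"
    by (simp add: nilp_vector_def V_nilp(3)[OF assms])
  show "g \<in> carrier G \<Longrightarrow> act (V_nilp \<chi> n \<mu>) (grp g) (nilp_vector n i) = scale (\<chi> g ^ i * \<mu> g) (nilp_vector n i)"
    by (simp add: nilp_vector_def V_nilp(2)[OF assms])
qed

text \<open>The basis continued by the powers of x beyond \<open>n * s - 1\<close>, so that x is a
  shift at every index and the wrap-around is hidden in a \<open>shift_diff\<close>
  identity.\<close>

definition block_vector :: "nat \<Rightarrow> ('g \<Rightarrow> 'k) \<Rightarrow> 'k \<Rightarrow> nat \<Rightarrow> (nat \<Rightarrow>\<^sub>0 'k)"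
  where "block_vector n \<mu> \<beta> j = (act (V_block \<chi> s n \<mu> \<beta>) (ore_x G) ^^ j) (single 0 1)"

lemma block_vector:
  assumes \<mu>: "\<mu> \<in> carrier (character_group G)" and n: "n > 0"
  shows "block_vector n \<mu> \<beta> j \<in> space (V_block \<chi> s n \<mu> \<beta>)"
    and "act (V_block \<chi> s n \<mu> \<beta>) (ore_x G) (block_vector n \<mu> \<beta> j) = block_vector n \<mu> \<beta> (Suc j)"
    and "g \<in> carrier G \<Longrightarrow> act (V_block \<chi> s n \<mu> \<beta>) (grp g) (block_vector n \<mu> \<beta> j)
      = scale (\<chi> g ^ j * \<mu> g) (block_vector n \<mu> \<beta> j)"
    and "j < n * s \<Longrightarrow> block_vector n \<mu> \<beta> j = single j 1"
    and "(shift_diff s \<beta> ^^ n) (block_vector n \<mu> \<beta>) = (\<lambda>_. 0)"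
proof -
  let ?V = "V_block \<chi> s n \<mu> \<beta>" and ?y = "block_vector n \<mu> \<beta>"
  interpret V: ore_module G \<psi> ?V by (rule V_block(1)[OF \<mu>])
  have ns: "0 < n * s" using n s_pos by simp
  have "single 0 1 \<in> space ?V" using ns by (intro single_in_space) simp
  then show y_space: "?y j \<in> space ?V" for j
    unfolding block_vector_def by (rule V.funpow_X_space)
  show X_y: "V.X (?y j) = ?y (Suc j)" for j
    by (simp add: block_vector_def)
  show grp: "act ?V (grp g) (?y j) = scale (\<chi> g ^ j * \<mu> g) (?y j)" if g: "g \<in> carrier G" for g
  proof (induction j)
    case 0
    show ?case using V_block(2)[OF \<mu> g, of n \<beta> 0 1] by (simp add: block_vector_def del: single_one)
  next
    case (Suc j)
    show ?case
      unfolding X_y[symmetric] V.grp_X[OF g y_space \<psi>_\<chi>[OF g]] Suc.IH V.act_scale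
      by (simp add: mult_ac)
  qed
  show y_single: "?y j = single j 1" if "j < n * s" for j
    using that
  proof (induction j)
    case 0
    show ?case by (simp add: block_vector_def)
  next
    case (Suc j)
    then show ?case by (simp add: X_y[symmetric] V_block(3)[OF \<mu>])
  qed
  have top: "?y (s * n) = (\<Sum>i<n. scale (block_coeff n \<beta> i) (?y (0 + s * i)))"
  proof -
    have "Suc (n * s - 1) = s * n" using ns by (simp add: mult.commute)
    then have "?y (s * n) = V.X (single (n * s - 1) 1)"
      using X_y[of "n * s - 1"] y_single[of "n * s - 1"] ns by simp
    also have "\<dots> = (\<Sum>i<n. single (i * s) (block_coeff n \<beta> i))"
      using ns by (subst V_block(3)[OF \<mu>]) auto
    also have "\<dots> = (\<Sum>i<n. scale (block_coeff n \<beta> i) (?y (0 + s * i)))"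
    proof (rule sum.cong[OF refl])
      fix i assume "i \<in> {..<n}"
      then have "?y (0 + s * i) = single (i * s) 1"
        using s_pos y_single[of "i * s"] by (simp add: mult.commute)
      then show "single (i * s) (block_coeff n \<beta> i) = scale (block_coeff n \<beta> i) (?y (0 + s * i))"
        by simp
    qed
    finally show ?thesis .
  qed
  then have "(shift_diff s \<beta> ^^ n) ?y 0 = 0"
    unfolding block_coeff_sum by simp
  then show "(shift_diff s \<beta> ^^ n) ?y = (\<lambda>_. 0)"
    using funpow_shift_diff_orbit[OF V.act_linear[of "ore_x G"], where s = s and \<gamma> = \<beta> and n = n and v = "single 0 1"]
      pm_linear_zero[OF V.act_linear'(2)]
    unfolding block_vector_def by fastforce
qed

end

text \<open>Here \<open>x \<otimes> a\<close> is the nilpotent summand P, and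
  \<open>Q = 1 \<otimes> x\<close>. The normalising scalars have period \<open>s\<close> in
  \<open>j\<close> because \<open>\<chi>(a)^s = 1\<close>, so the eigenvalue \<open>\<beta>\<close>
  of \<open>Q^s\<close> is unchanged.\<close>

lemma V_nilp_tensor_V_block:
  fixes G :: "('g, 'z) monoid_scheme" and \<chi> \<psi> lam sigma :: "'g \<Rightarrow> 'k::field_char_0"
  assumes weights: "ore_weights G \<chi> \<psi> s"
    and a: "a \<in> carrier G" "\<And>g. g \<in> carrier G \<Longrightarrow> a \<otimes>\<^bsub>G\<^esub> g = g \<otimes>\<^bsub>G\<^esub> a"
    and q: "primitive_root_of_unity s (\<psi> a)"
    and lam: "lam \<in> carrier (character_group G)" and sigma: "sigma \<in> carrier (character_group G)"
    and "\<beta> \<noteq> 0" "t > 0" "p = u * s + r" "r < s"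
  shows "module_iso (hopf_ore G \<psi>)
    (tensor_module (comult G \<psi> a) (V_nilp \<chi> p lam) (V_block \<chi> s t sigma \<beta>))
    (binary_sum (block_sum \<chi> s (s - r) t u (sigma \<otimes>\<^bsub>character_group G\<^esub> lam) \<beta>)
      (block_sum \<chi> s r t (u + 1) (sigma \<otimes>\<^bsub>character_group G\<^esub> lam) \<beta>))"
proof -
  interpret ore_weights G \<chi> \<psi> s by fact
  let ?M = "V_nilp \<chi> p lam" and ?N = "V_block \<chi> s t sigma \<beta>"
  let ?\<mu> = "sigma \<otimes>\<^bsub>character_group G\<^esub> lam"
  interpret ore_tensor G \<psi> ?M ?N a
    by (intro ore_tensor.intro ore_tensor_axioms.intro V_nilp(1)[OF lam] V_block(1)[OF sigma] a)
  note x = nilp_vector[OF lam, where n = p] and y = block_vector[OF sigma \<open>t > 0\<close>, where \<beta> = \<beta>]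
  let ?x = "nilp_vector p" and ?y = "block_vector t sigma \<beta>"
  \<comment> \<open>Since \<open>a\<close> multiplies \<open>?y j\<close> by
    \<open>\<chi>(a)^j sigma(a)\<close>, the coefficient of \<open>e (Suc i) j\<close> becomes 1
    exactly when \<open>c (Suc i) j = \<chi>(a)^j sigma(a) c i j\<close>. The solution with
    \<open>c 0 j = 1\<close> has \<open>c i j = \<psi>(a)^i c i (j + 1)\<close>, whence
    \<open>\<omega> = \<psi>(a)\<close>.\<close>
  define c where "c i j = \<chi> a ^ (i * j) * sigma a ^ i" for i j
  define e where "e i j = scale (c i j) (tens (?x i) (?y j))" for i j
  have \<mu>: "?\<mu> \<in> carrier (character_group G)"
    by (rule monoid.m_closed[OF group.is_monoid[OF group_character_group[OF is_group]] sigma lam])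
  have c_nonzero: "c i j \<noteq> 0" for i j
    using a character_nonzero[OF sigma] by (simp add: c_def)
  have "ore_grid G \<chi> \<psi> s P e ?\<mu> (\<psi> a) \<beta> p t u r"
  proof (intro ore_grid.intro ore_grid_axioms.intro ore_weights_axioms ore_module_P \<mu> q assms(7,9,10))
    fix i j
    show "e i j \<in> space P"
      unfolding e_def by (intro pm.subspace_scale[OF subspace_space] tens_space x(1) y(1))
    show "act P (grp g) (e i j) = scale (\<chi> g ^ (i + j) * ?\<mu> g) (e i j)" if g: "g \<in> carrier G" for g
      using g by (simp add: e_def pm_linear_scale[OF ore_module.act_linear[OF ore_module_P]]
          act_P_grp_tens x y tens_scale_left tens_scale_right character_group_mult_apply power_add mult_ac)
    show "act P (ore_x G) (e i j) = e (Suc i) j + scale (\<psi> a ^ i) (e i (Suc j))"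
    proof -
      have "act P (ore_x G) (e i j) = scale (c i j) (scale (\<chi> a ^ j * sigma a) (tens (?x (Suc i)) (?y j)) + tens (?x i) (?y (Suc j)))"
        by (simp add: e_def pm_linear_scale[OF ore_module.act_linear[OF ore_module_P]]
            act_P_x_tens x y a tens_scale_right)
      also have "c i j * (\<chi> a ^ j * sigma a) = c (Suc i) j"
        by (simp add: c_def power_add mult_ac)
      moreover have "\<psi> a ^ i * c i (Suc j) = c i j"
      proof -
        have "\<psi> a ^ i * c i (Suc j) = (\<psi> a * \<chi> a) ^ i * c i j"
          by (simp add: c_def power_add power_mult_distrib mult_ac)
        then show ?thesis using \<psi>_\<chi>[OF a(1)] by simp
      qed
      ultimately show ?thesis
        by (simp add: e_def pm.scale_right_distrib)
    qed
    show "e i j = 0" if "p \<le> i"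
      using that by (simp add: e_def nilp_vector_def)
  next
    fix i
    have "(shift_diff s \<beta> ^^ b) (e i) j = scale (c i j) (tens (?x i) ((shift_diff s \<beta> ^^ b) ?y j))" for b j
    proof (induction b arbitrary: j)
      case 0
      show ?case by (simp add: e_def)
    next
      case (Suc b)
      have "c i (j + s) = c i j"
        using a(1) by (simp add: c_def distrib_left power_add)
      then show ?case
        unfolding funpow_shift_diff_Suc Suc.IH
        by (simp add: pm_linear_diff[OF pm_linear_tens_right] tens_scale_right pm.scale_right_diff_distrib mult.commute)
    qed
    then show "(shift_diff s \<beta> ^^ t) (e i) = (\<lambda>_. 0)"
      by (auto simp: y(5))
  next
    fix b assume "b \<in> basis P"
    then obtain i j where b: "b = (i, j)" "i < p" "j < t * s" by (auto simp: basis_P)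
    then have "single b 1 = scale (1 / c i j) (e i j)"
      using c_nonzero by (simp add: e_def y(4) nilp_vector_def)
    then show "\<exists>i j c. single b 1 = scale c (e i j)" by blast
  qed (simp_all add: basis_P card_cartesian_product)
  then show ?thesis by (rule ore_grid.module_iso_block_sums)
qed

text \<open>Now \<open>1 \<otimes> x\<close> is the nilpotent summand and
  \<open>Q = x \<otimes> a\<close>. The element \<open>a\<close> multiplies \<open>?x i\<close> by
  \<open>\<chi>(a)^i lam(a)\<close>: the first factor gives \<open>\<omega> = \<chi>(a)\<close>, the
  inverse of q, while \<open>lam(a)\<close> is absorbed into the vectors and multiplies the
  eigenvalue of \<open>Q^s\<close> by \<open>lam(a)^s\<close>.\<close>

lemma V_block_tensor_V_nilp:
  fixes G :: "('g, 'z) monoid_scheme" and \<chi> \<psi> lam sigma :: "'g \<Rightarrow> 'k::field_char_0"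
  assumes weights: "ore_weights G \<chi> \<psi> s"
    and a: "a \<in> carrier G" "\<And>g. g \<in> carrier G \<Longrightarrow> a \<otimes>\<^bsub>G\<^esub> g = g \<otimes>\<^bsub>G\<^esub> a"
    and q: "primitive_root_of_unity s (\<psi> a)"
    and lam: "lam \<in> carrier (character_group G)" and sigma: "sigma \<in> carrier (character_group G)"
    and "\<beta> \<noteq> 0" "t > 0" "p = u * s + r" "r < s"
  shows "module_iso (hopf_ore G \<psi>)
    (tensor_module (comult G \<psi> a) (V_block \<chi> s t sigma \<beta>) (V_nilp \<chi> p lam))
    (binary_sum (block_sum \<chi> s (s - r) t u (sigma \<otimes>\<^bsub>character_group G\<^esub> lam) (lam a ^ s * \<beta>))
      (block_sum \<chi> s r t (u + 1) (sigma \<otimes>\<^bsub>character_group G\<^esub> lam) (lam a ^ s * \<beta>)))"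
proof -
  interpret ore_weights G \<chi> \<psi> s by fact
  let ?M = "V_block \<chi> s t sigma \<beta>" and ?N = "V_nilp \<chi> p lam"
  let ?\<mu> = "sigma \<otimes>\<^bsub>character_group G\<^esub> lam" and ?\<gamma> = "lam a ^ s * \<beta>"
  interpret ore_tensor G \<psi> ?M ?N a
    by (intro ore_tensor.intro ore_tensor_axioms.intro V_nilp(1)[OF lam] V_block(1)[OF sigma] a)
  note x = nilp_vector[OF lam, where n = p] and y = block_vector[OF sigma \<open>t > 0\<close>, where \<beta> = \<beta>]
  let ?x = "nilp_vector p" and ?y = "block_vector t sigma \<beta>"
  define e where "e i j = scale (lam a ^ j) (tens (?y j) (?x i))" for i j
  have \<mu>: "?\<mu> \<in> carrier (character_group G)"
    by (rule monoid.m_closed[OF group.is_monoid[OF group_character_group[OF is_group]] sigma lam])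
  have lam_a: "lam a \<noteq> 0" by (rule character_nonzero[OF lam a(1)])
  have "\<chi> a ^ j = 1 \<longleftrightarrow> \<psi> a ^ j = 1" for j
  proof -
    have "\<psi> a ^ j * \<chi> a ^ j = 1" using \<psi>_\<chi>[OF a(1)] by (simp flip: power_mult_distrib)
    then show ?thesis by auto
  qed
  then have q': "primitive_root_of_unity s (\<chi> a)"
    using q by (simp add: primitive_root_of_unity_def)
  have "ore_grid G \<chi> \<psi> s P e ?\<mu> (\<chi> a) ?\<gamma> p t u r"
  proof (intro ore_grid.intro ore_grid_axioms.intro ore_weights_axioms ore_module_P \<mu> q' assms(9,10))
    fix i j
    show "e i j \<in> space P"
      unfolding e_def by (intro pm.subspace_scale[OF subspace_space] tens_space x(1) y(1))
    show "act P (grp g) (e i j) = scale (\<chi> g ^ (i + j) * ?\<mu> g) (e i j)" if g: "g \<in> carrier G" for g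
      using g by (simp add: e_def pm_linear_scale[OF ore_module.act_linear[OF ore_module_P]]
          act_P_grp_tens x y tens_scale_left tens_scale_right character_group_mult_apply power_add mult_ac)
    show "act P (ore_x G) (e i j) = e (Suc i) j + scale (\<chi> a ^ i) (e i (Suc j))"
      by (simp add: e_def pm_linear_scale[OF ore_module.act_linear[OF ore_module_P]]
          act_P_x_tens x y a tens_scale_right pm.scale_right_distrib add.commute mult_ac)
    show "e i j = 0" if "p \<le> i"
      using that by (simp add: e_def nilp_vector_def)
  next
    fix i
    \<comment> \<open>The scalars \<open>lam(a)^j\<close> need not have period \<open>s\<close>, so
      each \<open>shift_diff\<close> releases a factor \<open>lam(a)^s\<close>; this matches the
      change from \<open>\<beta>\<close> to \<open>?\<gamma>\<close>.\<close>
    have "(shift_diff s ?\<gamma> ^^ b) (e i) j = scale (lam a ^ (j + s * b)) (tens ((shift_diff s \<beta> ^^ b) ?y j) (?x i))" for b j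
    proof (induction b arbitrary: j)
      case 0
      show ?case by (simp add: e_def)
    next
      case (Suc b)
      show ?case
        unfolding funpow_shift_diff_Suc Suc.IH
        by (simp add: pm_linear_diff[OF pm_linear_tens_left] tens_scale_left pm.scale_right_diff_distrib
            power_add mult_ac)
    qed
    then show "(shift_diff s ?\<gamma> ^^ t) (e i) = (\<lambda>_. 0)"
      by (auto simp: y(5))
  next
    fix b assume "b \<in> basis P"
    then obtain i j where b: "b = (j, i)" "i < p" "j < t * s" by (auto simp: basis_P)
    then have "single b 1 = scale (1 / lam a ^ j) (e i j)"
      using lam_a by (simp add: e_def y(4) nilp_vector_def)
    then show "\<exists>i j c. single b 1 = scale c (e i j)" by blast
  qed (use lam_a \<open>\<beta> \<noteq> 0\<close> in \<open>simp_all add: basis_P card_cartesian_product mult_ac\<close>)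
  then show ?thesis by (rule ore_grid.module_iso_block_sums)
qed

theorem theorem3p6:
  fixes G :: "('g, 'z) monoid_scheme"
    and \<chi> lam sigma :: "'g \<Rightarrow> 'k::{alg_closed_field, field_char_0}"
    and a :: 'g and \<beta> :: 'k
    and s p t u r :: nat
  assumes "group G"
    and "a \<in> carrier G" and "\<forall>g\<in>carrier G. a \<otimes>\<^bsub>G\<^esub> g = g \<otimes>\<^bsub>G\<^esub> a"
    and "\<chi> \<in> carrier (character_group G)" and "\<chi> a \<noteq> 1"
    and "group.ord (character_group G) \<chi> = s" and "s > 0"
    and "primitive_root_of_unity s ((inv\<^bsub>character_group G\<^esub> \<chi>) a)"
    and "p \<ge> 1" and "t \<ge> 1"
    and "lam \<in> carrier (character_group G)" and "sigma \<in> carrier (character_group G)"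
    and "\<beta> \<noteq> 0"
    and "p = u * s + r" and "r < s"
  defines "\<psi> \<equiv> inv\<^bsub>character_group G\<^esub> \<chi>"
  defines "H \<equiv> hopf_ore G \<psi>"
  defines "Tensor \<equiv> tensor_module (comult G \<psi> a)"
  defines "RHS \<equiv> \<lambda>\<gamma>. binary_sum
      (direct_sum {1..min t u} (\<lambda>i. copies (s - r)
        (V_block \<chi> s (nat (2 * int i - 1 + \<bar>int t - int u\<bar>))
          (sigma \<otimes>\<^bsub>character_group G\<^esub> lam) \<gamma>)))
      (direct_sum {1..min t (u + 1)} (\<lambda>i. copies r
        (V_block \<chi> s (nat (2 * int i - 1 + \<bar>int t - int u - 1\<bar>))
          (sigma \<otimes>\<^bsub>character_group G\<^esub> lam) \<gamma>)))"
  shows "module_iso H (Tensor (V_nilp \<chi> p lam) (V_block \<chi> s t sigma \<beta>)) (RHS \<beta>)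
       \<and> module_iso H (Tensor (V_block \<chi> s t sigma \<beta>) (V_nilp \<chi> p lam)) (RHS (lam a ^ s * \<beta>))"
proof -
  have pow: "\<chi> g ^ s = 1" if "g \<in> carrier G" for g
    using group.pow_ord_eq_1[OF group_character_group[OF assms(1)] assms(4)] assms(6) that
    by (metis character_group_pow_apply character_group_one_apply)
  have weights: "ore_weights G \<chi> \<psi> s"
    using assms(4,7) pow inv_character_apply[OF assms(1,4)]
    by (intro ore_weights.intro ore_weights_axioms.intro assms(1)) (auto simp: \<psi>_def)
  have central: "a \<otimes>\<^bsub>G\<^esub> g = g \<otimes>\<^bsub>G\<^esub> a" if "g \<in> carrier G" for g
    using assms(3) that by blast
  have q: "primitive_root_of_unity s (\<psi> a)"
    using assms(8) by (simp add: \<psi>_def)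
  have "t > 0" using assms(10) by simp
  have RHS: "RHS \<gamma> = binary_sum (block_sum \<chi> s (s - r) t u (sigma \<otimes>\<^bsub>character_group G\<^esub> lam) \<gamma>)
      (block_sum \<chi> s r t (u + 1) (sigma \<otimes>\<^bsub>character_group G\<^esub> lam) \<gamma>)" for \<gamma>
  proof -
    \<comment> \<open>The claim writes \<open>|t - u - 1|\<close> where \<open>block_sum\<close> at
      \<open>u + 1\<close> has \<open>|t - (u + 1)|\<close>.\<close>
    have "int t - int (u + 1) = int t - int u - 1" by simp
    then show ?thesis by (simp only: RHS_def block_sum_def)
  qed
  show ?thesis
    unfolding H_def Tensor_def RHS
    by (intro conjI V_nilp_tensor_V_block V_block_tensor_V_nilp weights assms(2,11-15) central q \<open>t > 0\<close>)
qed

end
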